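(* For any $2$-preptyx $P$, with $P^*$ as defined in the context, we have the following: (a) $P^*$ is a normal $2$-preptyx; (b) if $P$ is a $2$-ptyx (i.e. preserves dilators), then so is $P^*$; (c) there is a family of morphisms $\xi^D:P(D)+1\Rightarrow P^*(D+1)$ that is natural in the predilator $D$, in the sense that $\xi^E\circ(P(\nu)+1)=P^*(\nu+1)\circ\xi^D$ for any morphism $\nu:D\Rightarrow E$ of predilators.
   Context: **Predilators.** Linear orders are countable with underlying set contained in $\mathbb N$; $\mathbf{LO}$ is the category of linear orders and order embeddings; $\mathbf{LO}_0$ is the category of the finite orders $n=\{0,\dots,n-1\}$ and strictly increasing functions. For $f,g:X\to Y$, $f\le g$ means $f(x)\le_Y g(x)$ for all $x\in X$. $[X]^{<\omega}$ is the set of finite subsets of $X$, with $[f]^{<\omega}(a)=\{f(x)\mid x\in a\}$. A (coded) predilator is a pair $D=(D,\operatorname{supp}^D)$ of a monotone functor $D:\mathbf{LO}_0\to\mathbf{LO}$ ($f\le g$ implies $D(f)\le D(g)$) and a natural transformation $\operatorname{supp}^D:D\Rightarrow[\cdot]^{<\omega}$ with $\{\sigma\in D(Y)\mid\operatorname{supp}^D_Y(\sigma)\subseteq\operatorname{rng}(f)\}\subseteq\operatorname{rng}(D(f))$ for every morphism $f:X\to Y$. (Class-sized predilators are defined in the same way with domain $\mathbf{LO}$; the two notions give equivalent categories via restriction and the extension $\overline{(\cdot)}$ below. Below, $X,Y$ range over $\mathbf{LO}_0$ in the coded reading and over $\mathbf{LO}$ in the class-sized one.) A morphism $\mu:D\Rightarrow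 E$ is a natural transformation of functors. Put $\operatorname{Tr}(D)=\{(n,\sigma)\mid\sigma\in D(n),\operatorname{supp}^D_n(\sigma)=n\}$, $\operatorname{Tr}(\mu)(n,\sigma)=(n,\mu_n(\sigma))$ (an injective function $\operatorname{Tr}(D)\to\operatorname{Tr}(E)$), and $\operatorname{rng}(\mu):=\operatorname{rng}(\operatorname{Tr}(\mu))\subseteq\operatorname{Tr}(E)$. For a finite order $a$, $|a|$ is its cardinality, identified with $\{0,\dots,|a|-1\}$, and $\operatorname{en}_a:|a|\to a$ is the increasing enumeration; $\iota_X^Y$ denotes inclusions; for an embedding $f:a\to b$ of finite orders, $|f|:|a|\to|b|$ satisfies $\operatorname{en}_b\circ|f|=f\circ\operatorname{en}_a$. The extension is $\overline D(X)=\{(a,\sigma)\mid a\in[X]^{<\omega},(|a|,\sigma)\in\operatorname{Tr}(D)\}$ for arbitrary linear orders $X$, with $(a,\sigma)<(b,\tau)$ iff $D(|\iota_a^{a\cup b}|)(\sigma)<D(|\iota_b^{a\cup b}|)(\tau)$. $D$ is a dilator if $\overline D(X)$ is well founded for every well order $X$. Each $\sigma\in D(X)$ has a unique normal form $\sigma=D(\iota_a^X\circ\operatorname{en}_a)(\sigma_0)$ with $a\in[X]^{<\omega}$ and $(|a|,\sigma_0)\in\operatorname{Tr}(D)$. For $A\subseteq\operatorname{Tr}(D)$, the predilator $D[A]$ is given by the suborders $D[A](X)=\{\sigma\in D(X)\mid(|a|,\sigma_0)\in A\text{ for the normal form of }\sigma\}$, with $D[A](f)$ and supports obtained by restriction;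 $\iota[A]:D[A]\Rightarrow D$ is the morphism of inclusions. **Ptykes.** A $2$-preptyx is a pair $(P,\operatorname{Supp})$ of an endofunctor $P$ of the category of predilators and a natural transformation $\operatorname{Supp}:\operatorname{Tr}(P(\cdot))\Rightarrow[\operatorname{Tr}(\cdot)]^{<\omega}$ with $\{\sigma\in\operatorname{Tr}(P(E))\mid\operatorname{Supp}_E(\sigma)\subseteq\operatorname{rng}(\mu)\}\subseteq\operatorname{rng}(P(\mu))$ for every morphism $\mu:D\Rightarrow E$. It is a $2$-ptyx if it maps dilators to dilators. A segment is a morphism $\nu:D\Rightarrow E$ such that each $\operatorname{rng}(\nu_X)$ is an initial segment of $E(X)$. $P$ is normal if $P(\nu)$ is a segment for every segment $\nu$. Put $\operatorname{Supp}_{D,X}(\sigma):=\operatorname{Supp}_D(|a|,\sigma_0)$ for $\sigma\in P(D)(X)$ with normal form $\sigma=P(D)(\iota_a^X\circ\operatorname{en}_a)(\sigma_0)$. (Formally, preptykes are given by $\Delta^0_1$-definitions in second order arithmetic, possibly with parameters.) **$D+1$.** $X+1=X\cup\{\top\}$ with new maximum $\top$. $(D+1)(X)=D(X)+1$; $(D+1)(f)$ extends $D(f)$ by $\top\mapsto\top$; $\operatorname{supp}^{D+1}_X$ extends $\operatorname{supp}^D_X$ by $\top\mapsto\emptyset$; $\nu+1$ extends $\nu$ by $\top\mapsto\top$. **$P^*$.** On $\operatorname{Tr}(D)$ define $(m,\sigma)\ll(n,\tau)$ iff $D(f)(\sigma)<_{D(X)}D(g)(\tau)$ for all embeddings $f:m\to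 X$, $g:n\to X$ into a linear order $X$. Identifying $n=\{0,\dots,n-1\}$ with a subset of $\omega$ gives $\operatorname{Tr}(D)\subseteq\overline D(\omega)$, and $<_{\operatorname{Tr}(D)}$ is the induced linear order. For $\rho\in\operatorname{Tr}(D)$ put $D[\rho]=D[\{\sigma\in\operatorname{Tr}(D)\mid\sigma\ll\rho\}]$ and $\iota[D,\rho]=\iota[\{\sigma\in\operatorname{Tr}(D)\mid\sigma\ll\rho\}]:D[\rho]\Rightarrow D$. For $\nu:D\Rightarrow E$ and $\rho\in\operatorname{Tr}(D)$, $\nu^\rho:D[\rho]\Rightarrow E[\operatorname{Tr}(\nu)(\rho)]$ is the unique morphism with $\iota[E,\operatorname{Tr}(\nu)(\rho)]\circ\nu^\rho=\nu\circ\iota[D,\rho]$. Given a $2$-preptyx $P$, $P^*(D)(X)$ is the set of pairs $(\rho,\sigma)$ with $\rho\in\operatorname{Tr}(D)$ and $\sigma\in P(D[\rho])(X)\cup\{\top\}$, ordered by $(\rho,\sigma)<(\rho',\sigma')$ iff $\rho<_{\operatorname{Tr}(D)}\rho'$, or $\rho=\rho'$ and $\sigma<_{P(D[\rho])(X)+1}\sigma'$. Put $P^*(D)(f)(\rho,\sigma)=(\rho,(P(D[\rho])+1)(f)(\sigma))$ and $\operatorname{supp}^{P^*(D)}_X(\rho,\sigma)=\operatorname{supp}^{P(D[\rho])+1}_X(\sigma)$. For $\nu:D\Rightarrow E$ put $P^*(\nu)_X(\rho,\sigma)=(\operatorname{Tr}(\nu)(\rho),P(\nu^\rho)_X(\sigma))$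 if $\sigma\ne\top$, and $P^*(\nu)_X(\rho,\top)=(\operatorname{Tr}(\nu)(\rho),\top)$. The supports are $\operatorname{Supp}^*_{D,X}(\rho,\sigma)=\{\rho\}\cup\operatorname{Supp}_{D,X}(P(\iota[D,\rho])_X(\sigma))$ if $\sigma\neq\top$, and $\operatorname{Supp}^*_{D,X}(\rho,\top)=\{\rho\}$; the natural transformation making $P^*$ a preptyx is $\operatorname{Supp}^*_D(n,\sigma):=\operatorname{Supp}^*_{D,n}(\sigma)$. *)

theory Defs
  imports Main "HOL-Library.FuncSet" "HOL-Library.Countable"
begin

text \<open>
  A linear order with underlying set contained in the natural numbers is a relation
  \<open>r :: nat rel\<close> with \<open>Linear_order r\<close>; its underlying set is \<open>Field r\<close>, and the finite order
  \<open>{0,...,n-1}\<close> is \<open>natLeq_on n\<close>. We work with coded predilators, whose domain is the category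
  of the orders \<open>natLeq_on n\<close>.

  All functions that belong to a linear order morphism, a predilator or a morphism of
  predilators are extensional, i.e. they have the value \<open>undefined\<close> outside of their domain.
  Equality in HOL thus coincides with the set theoretic equality of these objects.
\<close>

definition lo_emb :: "nat rel \<Rightarrow> nat rel \<Rightarrow> (nat \<Rightarrow> nat) set" where
  "lo_emb X Y = {f \<in> Field X \<rightarrow>\<^sub>E Field Y.
     \<forall>x\<in>Field X. \<forall>y\<in>Field X. (f x, f y) \<in> Y \<longleftrightarrow> (x, y) \<in> X}"

definition lo_less :: "nat rel \<Rightarrow> nat \<Rightarrow> nat \<Rightarrow> bool" where
  "lo_less X x y \<longleftrightarrow> (x, y) \<in> X \<and> x \<noteq> y"

abbreviation fin_emb :: "nat \<Rightarrow> nat \<Rightarrow> (nat \<Rightarrow> nat) set" where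
  "fin_emb n m \<equiv> lo_emb (natLeq_on n) (natLeq_on m)"

text \<open>
  The value \<open>pd_map D n m f\<close> is \<open>D(f)\<close> for \<open>f : n \<rightarrow> m\<close>. Domain and codomain are arguments
  because they cannot be recovered from the function \<open>f\<close>.
\<close>

record predilator_data =
  pd_ord :: "nat \<Rightarrow> nat rel"
  pd_map :: "nat \<Rightarrow> nat \<Rightarrow> (nat \<Rightarrow> nat) \<Rightarrow> (nat \<Rightarrow> nat)"
  pd_supp :: "nat \<Rightarrow> nat \<Rightarrow> nat set"

abbreviation pd_carrier :: "predilator_data \<Rightarrow> nat \<Rightarrow> nat set" where
  "pd_carrier D n \<equiv> Field (pd_ord D n)"

definition predilator :: "predilator_data \<Rightarrow> bool" where
  "predilator D \<longleftrightarrow>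
     (\<forall>n. Linear_order (pd_ord D n)) \<and>
     (\<forall>n m. pd_map D n m \<in> fin_emb n m \<rightarrow>\<^sub>E lo_emb (pd_ord D n) (pd_ord D m)) \<and>
     (\<forall>n. pd_map D n n (\<lambda>x\<in>{..<n}. x) = (\<lambda>\<sigma>\<in>pd_carrier D n. \<sigma>)) \<and>
     (\<forall>n m k. \<forall>f\<in>fin_emb n m. \<forall>g\<in>fin_emb m k.
        pd_map D n k (compose {..<n} g f)
          = compose (pd_carrier D n) (pd_map D m k g) (pd_map D n m f)) \<and>
     (\<forall>n m. \<forall>f\<in>fin_emb n m. \<forall>g\<in>fin_emb n m. (\<forall>x<n. f x \<le> g x) \<longrightarrow>
        (\<forall>\<sigma>\<in>pd_carrier D n. (pd_map D n m f \<sigma>, pd_map D n m g \<sigma>) \<in> pd_ord D m)) \<and>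
     (\<forall>n. pd_supp D n \<in> pd_carrier D n \<rightarrow>\<^sub>E Fpow {..<n}) \<and>
     (\<forall>n m. \<forall>f\<in>fin_emb n m. \<forall>\<sigma>\<in>pd_carrier D n.
        pd_supp D m (pd_map D n m f \<sigma>) = f ` pd_supp D n \<sigma>) \<and>
     (\<forall>n m. \<forall>f\<in>fin_emb n m.
        {\<sigma> \<in> pd_carrier D m. pd_supp D m \<sigma> \<subseteq> f ` {..<n}} \<subseteq> pd_map D n m f ` pd_carrier D n)"

type_synonym pd_mor = "nat \<Rightarrow> nat \<Rightarrow> nat"

definition pd_hom :: "predilator_data \<Rightarrow> predilator_data \<Rightarrow> pd_mor set" where
  "pd_hom D E = {\<mu>. (\<forall>n. \<mu> n \<in> lo_emb (pd_ord D n) (pd_ord E n)) \<and>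
     (\<forall>n m. \<forall>f\<in>fin_emb n m.
        compose (pd_carrier D n) (\<mu> m) (pd_map D n m f)
          = compose (pd_carrier D n) (pd_map E n m f) (\<mu> n))}"

definition pd_id :: "predilator_data \<Rightarrow> pd_mor" where
  "pd_id D = (\<lambda>n. \<lambda>\<sigma>\<in>pd_carrier D n. \<sigma>)"

text \<open>The first argument is the domain of the composed morphism \<open>\<nu> \<circ> \<mu>\<close>.\<close>

definition pd_comp :: "predilator_data \<Rightarrow> pd_mor \<Rightarrow> pd_mor \<Rightarrow> pd_mor" where
  "pd_comp D \<nu> \<mu> = (\<lambda>n. compose (pd_carrier D n) (\<nu> n) (\<mu> n))"

type_synonym tr = "nat \<times> nat"

definition Tr :: "predilator_data \<Rightarrow> tr set" where
  "Tr D = {(n, \<sigma>). \<sigma> \<in> pd_carrier D n \<and> pd_supp D n \<sigma> = {..<n}}"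

definition Tr_map :: "pd_mor \<Rightarrow> tr \<Rightarrow> tr" where
  "Tr_map \<mu> = (\<lambda>(n, \<sigma>). (n, \<mu> n \<sigma>))"

definition pd_rng :: "predilator_data \<Rightarrow> pd_mor \<Rightarrow> tr set" where
  "pd_rng D \<mu> = Tr_map \<mu> ` Tr D"

text \<open>
  A finite order is given by a relation \<open>r\<close>; a finite suborder of \<open>X\<close> with underlying set \<open>a\<close>
  is \<open>Restr X a\<close>. For an embedding \<open>f\<close> of \<open>r\<close> into \<open>s\<close>, \<open>lo_abs r s f\<close> is the \<open>|f|\<close> that is
  induced between the cardinalities.
\<close>

abbreviation lo_card :: "nat rel \<Rightarrow> nat" where
  "lo_card r \<equiv> card (Field r)"

definition lo_en :: "nat rel \<Rightarrow> nat \<Rightarrow> nat" where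
  "lo_en r = (THE f. f \<in> lo_emb (natLeq_on (lo_card r)) r \<and> f ` {..<lo_card r} = Field r)"

definition lo_abs :: "nat rel \<Rightarrow> nat rel \<Rightarrow> (nat \<Rightarrow> nat) \<Rightarrow> (nat \<Rightarrow> nat)" where
  "lo_abs r s f = (THE g. g \<in> fin_emb (lo_card r) (lo_card s) \<and>
     compose {..<lo_card r} (lo_en s) g = compose {..<lo_card r} f (lo_en r))"

definition ext_carrier :: "predilator_data \<Rightarrow> nat rel \<Rightarrow> (nat set \<times> nat) set" where
  "ext_carrier D X = {(a, \<sigma>). a \<in> Fpow (Field X) \<and> (card a, \<sigma>) \<in> Tr D}"

definition ext_less :: "predilator_data \<Rightarrow> nat rel \<Rightarrow> (nat set \<times> nat) rel" where
  "ext_less D X = {((a, \<sigma>), (b, \<tau>)). (a, \<sigma>) \<in> ext_carrier D X \<and> (b, \<tau>) \<in> ext_carrier D X \<and>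
     lo_less (pd_ord D (card (a \<union> b)))
       (pd_map D (card a) (card (a \<union> b)) (lo_abs (Restr X a) (Restr X (a \<union> b)) (\<lambda>x\<in>a. x)) \<sigma>)
       (pd_map D (card b) (card (a \<union> b)) (lo_abs (Restr X b) (Restr X (a \<union> b)) (\<lambda>x\<in>b. x)) \<tau>)}"

definition dilator :: "predilator_data \<Rightarrow> bool" where
  "dilator D \<longleftrightarrow> predilator D \<and> (\<forall>X :: nat rel. Well_order X \<longrightarrow> wf (ext_less D X))"

text \<open>
  As a function, \<open>\<iota> \<circ> en\<close> for the inclusion \<open>\<iota>\<close> of \<open>a\<close> into \<open>n\<close> coincides with the
  enumeration \<open>en\<close> of \<open>a\<close>.
\<close>

definition normal_form :: "predilator_data \<Rightarrow> nat \<Rightarrow> nat \<Rightarrow> nat set \<times> nat" where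
  "normal_form D n \<sigma> = (THE (a, \<sigma>\<^sub>0). a \<in> Fpow {..<n} \<and> (card a, \<sigma>\<^sub>0) \<in> Tr D \<and>
     \<sigma> = pd_map D (card a) n (lo_en (Restr (natLeq_on n) a)) \<sigma>\<^sub>0)"

definition nf_trace :: "predilator_data \<Rightarrow> nat \<Rightarrow> nat \<Rightarrow> tr" where
  "nf_trace D n \<sigma> = (case normal_form D n \<sigma> of (a, \<sigma>\<^sub>0) \<Rightarrow> (card a, \<sigma>\<^sub>0))"

definition sub_carrier :: "predilator_data \<Rightarrow> tr set \<Rightarrow> nat \<Rightarrow> nat set" where
  "sub_carrier D A n = {\<sigma> \<in> pd_carrier D n. nf_trace D n \<sigma> \<in> A}"

definition sub_pd :: "predilator_data \<Rightarrow> tr set \<Rightarrow> predilator_data" where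
  "sub_pd D A = \<lparr>
     pd_ord = (\<lambda>n. Restr (pd_ord D n) (sub_carrier D A n)),
     pd_map = (\<lambda>n m. \<lambda>f\<in>fin_emb n m. restrict (pd_map D n m f) (sub_carrier D A n)),
     pd_supp = (\<lambda>n. restrict (pd_supp D n) (sub_carrier D A n)) \<rparr>"

definition sub_incl :: "predilator_data \<Rightarrow> tr set \<Rightarrow> pd_mor" where
  "sub_incl D A = (\<lambda>n. \<lambda>\<sigma>\<in>sub_carrier D A n. \<sigma>)"

text \<open>
  The value \<open>px_map P D E \<mu>\<close> is \<open>P(\<mu>)\<close> for \<open>\<mu> : D \<Rightarrow> E\<close>.
\<close>

record preptyx_data =
  px_ob :: "predilator_data \<Rightarrow> predilator_data"
  px_map :: "predilator_data \<Rightarrow> predilator_data \<Rightarrow> pd_mor \<Rightarrow> pd_mor"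
  px_supp :: "predilator_data \<Rightarrow> tr \<Rightarrow> tr set"

definition preptyx :: "preptyx_data \<Rightarrow> bool" where
  "preptyx P \<longleftrightarrow>
     (\<forall>D. predilator D \<longrightarrow> predilator (px_ob P D)) \<and>
     (\<forall>D E. predilator D \<longrightarrow> predilator E \<longrightarrow>
        (\<forall>\<mu>\<in>pd_hom D E. px_map P D E \<mu> \<in> pd_hom (px_ob P D) (px_ob P E))) \<and>
     (\<forall>D. predilator D \<longrightarrow> px_map P D D (pd_id D) = pd_id (px_ob P D)) \<and>
     (\<forall>D E F. predilator D \<longrightarrow> predilator E \<longrightarrow> predilator F \<longrightarrow>
        (\<forall>\<mu>\<in>pd_hom D E. \<forall>\<nu>\<in>pd_hom E F.
           px_map P D F (pd_comp D \<nu> \<mu>)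
             = pd_comp (px_ob P D) (px_map P E F \<nu>) (px_map P D E \<mu>))) \<and>
     (\<forall>D. predilator D \<longrightarrow> (\<forall>\<sigma>\<in>Tr (px_ob P D). px_supp P D \<sigma> \<in> Fpow (Tr D))) \<and>
     (\<forall>D E. predilator D \<longrightarrow> predilator E \<longrightarrow>
        (\<forall>\<mu>\<in>pd_hom D E. \<forall>\<sigma>\<in>Tr (px_ob P D).
           px_supp P E (Tr_map (px_map P D E \<mu>) \<sigma>) = Tr_map \<mu> ` px_supp P D \<sigma>)) \<and>
     (\<forall>D E. predilator D \<longrightarrow> predilator E \<longrightarrow>
        (\<forall>\<mu>\<in>pd_hom D E.
           {\<sigma> \<in> Tr (px_ob P E). px_supp P E \<sigma> \<subseteq> pd_rng D \<mu>}
             \<subseteq> pd_rng (px_ob P D) (px_map P D E \<mu>)))"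

definition ptyx :: "preptyx_data \<Rightarrow> bool" where
  "ptyx P \<longleftrightarrow> preptyx P \<and> (\<forall>D. dilator D \<longrightarrow> dilator (px_ob P D))"

definition segment :: "predilator_data \<Rightarrow> predilator_data \<Rightarrow> pd_mor \<Rightarrow> bool" where
  "segment D E \<nu> \<longleftrightarrow> \<nu> \<in> pd_hom D E \<and> (\<forall>n. ofilter (pd_ord E n) (\<nu> n ` pd_carrier D n))"

definition normal_preptyx :: "preptyx_data \<Rightarrow> bool" where
  "normal_preptyx P \<longleftrightarrow> preptyx P \<and>
     (\<forall>D E \<nu>. predilator D \<longrightarrow> predilator E \<longrightarrow> segment D E \<nu> \<longrightarrow>
        segment (px_ob P D) (px_ob P E) (px_map P D E \<nu>))"

definition px_supp_at :: "preptyx_data \<Rightarrow> predilator_data \<Rightarrow> nat \<Rightarrow> nat \<Rightarrow> tr set" where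
  "px_supp_at P D n \<sigma> = px_supp P D (nf_trace (px_ob P D) n \<sigma>)"

text \<open>
  The elements of \<open>X + 1\<close> are coded by natural numbers, with \<open>None\<close> in the role of the new
  maximum.
\<close>

abbreviation opt_code :: "nat option \<Rightarrow> nat" where
  "opt_code \<equiv> to_nat"

definition lo_plus1 :: "nat rel \<Rightarrow> nat rel" where
  "lo_plus1 X = {(opt_code (Some x), opt_code (Some y)) | x y. (x, y) \<in> X} \<union>
     {(opt_code (Some x), opt_code None) | x. x \<in> Field X} \<union> {(opt_code None, opt_code None)}"

text \<open>The extension of a function with domain \<open>A\<close> that sends the new maximum to \<open>t\<close>.\<close>

definition top_ext :: "nat set \<Rightarrow> (nat \<Rightarrow> 'a) \<Rightarrow> 'a \<Rightarrow> nat \<Rightarrow> 'a" where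
  "top_ext A f t = (\<lambda>s\<in>opt_code ` insert None (Some ` A).
     case from_nat s of None \<Rightarrow> t | Some x \<Rightarrow> f x)"

definition map_plus1 :: "nat set \<Rightarrow> (nat \<Rightarrow> nat) \<Rightarrow> nat \<Rightarrow> nat" where
  "map_plus1 A f = top_ext A (\<lambda>x. opt_code (Some (f x))) (opt_code None)"

definition pd_plus1 :: "predilator_data \<Rightarrow> predilator_data" where
  "pd_plus1 D = \<lparr>
     pd_ord = (\<lambda>n. lo_plus1 (pd_ord D n)),
     pd_map = (\<lambda>n m. \<lambda>f\<in>fin_emb n m. map_plus1 (pd_carrier D n) (pd_map D n m f)),
     pd_supp = (\<lambda>n. top_ext (pd_carrier D n) (pd_supp D n) {}) \<rparr>"

definition mor_plus1 :: "predilator_data \<Rightarrow> pd_mor \<Rightarrow> pd_mor" where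
  "mor_plus1 D \<nu> = (\<lambda>n. map_plus1 (pd_carrier D n) (\<nu> n))"

definition tr_ll :: "predilator_data \<Rightarrow> tr \<Rightarrow> tr \<Rightarrow> bool" where
  "tr_ll D = (\<lambda>(m, \<sigma>) (n, \<tau>). \<forall>k. \<forall>f\<in>fin_emb m k. \<forall>g\<in>fin_emb n k.
     lo_less (pd_ord D k) (pd_map D m k f \<sigma>) (pd_map D n k g \<tau>))"

definition tr_less :: "predilator_data \<Rightarrow> tr \<Rightarrow> tr \<Rightarrow> bool" where
  "tr_less D = (\<lambda>(m, \<sigma>) (n, \<tau>). (({..<m}, \<sigma>), ({..<n}, \<tau>)) \<in> ext_less D natLeq)"

definition below :: "predilator_data \<Rightarrow> tr \<Rightarrow> tr set" where
  "below D \<rho> = {\<sigma> \<in> Tr D. tr_ll D \<sigma> \<rho>}"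

definition pd_below :: "predilator_data \<Rightarrow> tr \<Rightarrow> predilator_data" where
  "pd_below D \<rho> = sub_pd D (below D \<rho>)"

definition incl_below :: "predilator_data \<Rightarrow> tr \<Rightarrow> pd_mor" where
  "incl_below D \<rho> = sub_incl D (below D \<rho>)"

definition mor_below :: "predilator_data \<Rightarrow> predilator_data \<Rightarrow> pd_mor \<Rightarrow> tr \<Rightarrow> pd_mor" where
  "mor_below D E \<nu> \<rho> = (THE \<mu>. \<mu> \<in> pd_hom (pd_below D \<rho>) (pd_below E (Tr_map \<nu> \<rho>)) \<and>
     pd_comp (pd_below D \<rho>) (incl_below E (Tr_map \<nu> \<rho>)) \<mu>
       = pd_comp (pd_below D \<rho>) \<nu> (incl_below D \<rho>))"

text \<open>
  The pairs \<open>(\<rho>, s)\<close> with \<open>s\<close> in \<open>P(D[\<rho>])(n) + 1\<close> are coded by natural numbers. The two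
  cases \<open>s = \<top>\<close> and \<open>s \<noteq> \<top>\<close> in the action of \<open>P*\<close> on morphisms are subsumed by \<open>mor_plus1\<close>.
\<close>

abbreviation pair_code :: "tr \<times> nat \<Rightarrow> nat" where
  "pair_code \<equiv> to_nat"

abbreviation pair_decode :: "nat \<Rightarrow> tr \<times> nat" where
  "pair_decode \<equiv> from_nat"

definition star_fibre :: "preptyx_data \<Rightarrow> predilator_data \<Rightarrow> tr \<Rightarrow> predilator_data" where
  "star_fibre P D \<rho> = pd_plus1 (px_ob P (pd_below D \<rho>))"

definition star_carrier :: "preptyx_data \<Rightarrow> predilator_data \<Rightarrow> nat \<Rightarrow> nat set" where
  "star_carrier P D n =
     {pair_code (\<rho>, s) | \<rho> s. \<rho> \<in> Tr D \<and> s \<in> pd_carrier (star_fibre P D \<rho>) n}"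

definition star_ob :: "preptyx_data \<Rightarrow> predilator_data \<Rightarrow> predilator_data" where
  "star_ob P D = \<lparr>
     pd_ord = (\<lambda>n. {(x, y). x \<in> star_carrier P D n \<and> y \<in> star_carrier P D n \<and>
       (case (pair_decode x, pair_decode y) of ((\<rho>, s), (\<rho>', s')) \<Rightarrow>
          tr_less D \<rho> \<rho>' \<or> \<rho> = \<rho>' \<and> (s, s') \<in> pd_ord (star_fibre P D \<rho>) n)}),
     pd_map = (\<lambda>n m. \<lambda>f\<in>fin_emb n m. \<lambda>x\<in>star_carrier P D n.
       case pair_decode x of (\<rho>, s) \<Rightarrow> pair_code (\<rho>, pd_map (star_fibre P D \<rho>) n m f s)),
     pd_supp = (\<lambda>n. \<lambda>x\<in>star_carrier P D n.
       case pair_decode x of (\<rho>, s) \<Rightarrow> pd_supp (star_fibre P D \<rho>) n s) \<rparr>"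

definition star_map ::
  "preptyx_data \<Rightarrow> predilator_data \<Rightarrow> predilator_data \<Rightarrow> pd_mor \<Rightarrow> pd_mor" where
  "star_map P D E \<nu> = (\<lambda>n. \<lambda>x\<in>star_carrier P D n. case pair_decode x of (\<rho>, s) \<Rightarrow>
     pair_code (Tr_map \<nu> \<rho>,
       mor_plus1 (px_ob P (pd_below D \<rho>))
         (px_map P (pd_below D \<rho>) (pd_below E (Tr_map \<nu> \<rho>)) (mor_below D E \<nu> \<rho>)) n s))"

definition star_supp :: "preptyx_data \<Rightarrow> predilator_data \<Rightarrow> tr \<Rightarrow> tr set" where
  "star_supp P D = (\<lambda>(n, x). case pair_decode x of (\<rho>, s) \<Rightarrow>
     (case from_nat s of
        None \<Rightarrow> {\<rho>}
      | Some \<sigma> \<Rightarrow> {\<rho>} \<union> px_supp_at P D n (px_map P (pd_below D \<rho>) D (incl_below D \<rho>) n \<sigma>)))"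

definition star :: "preptyx_data \<Rightarrow> preptyx_data" where
  "star P = \<lparr> px_ob = star_ob P, px_map = star_map P, px_supp = star_supp P \<rparr>"

end

theory Submission
  imports Defs
begin

text \<open>
  The order \<open>P\<^sup>*(D)(X)\<close> is a sum of the orders \<open>P(D[\<rho>])(X) + 1\<close>, indexed by the linear order
  \<open>Tr(D)\<close>. The fibres \<open>P(D[\<rho>]) + 1\<close> inherit all properties of predilators from \<open>P\<close>, and the
  index \<open>\<rho>\<close> is left unchanged by \<open>P\<^sup>*(D)(f)\<close>, so the sum is a predilator
  (\<open>star_predilator\<close>). For a morphism \<open>\<nu>\<close>, everything depends on the fact that \<open>\<nu>\<close> preserves
  and reflects the relation \<open>\<lless>\<close>, which makes \<open>\<nu>\<^sup>\<rho>\<close> a restriction of \<open>\<nu>\<close> whose range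
  consists of those elements below \<open>Tr(\<nu>)(\<rho>)\<close> that lie in the range of \<open>\<nu>\<close>
  (\<open>mor_below_rng\<close>). Functoriality of \<open>P\<^sup>*\<close> is then inherited from \<open>P\<close>. The support of
  \<open>(\<rho>, \<sigma>)\<close> is \<open>\<rho>\<close> together with the support of \<open>\<sigma>\<close> in \<open>P(D[\<rho>])\<close>: if it is contained in
  the range of \<open>\<nu>\<close>, then \<open>\<rho>\<close> has a preimage \<open>\<rho>\<^sub>0\<close>, and the range condition for
  \<open>P(\<nu>\<^sup>\<rho>\<^sub>0)\<close> yields a preimage of \<open>\<sigma>\<close> (\<open>star_supp_range\<close>).

  Normality holds because a segment \<open>\<nu>\<close> has everything below a value in its range. So the
  indices below \<open>Tr(\<nu>)(\<rho>)\<close> come from \<open>Tr(D)\<close>, and each \<open>\<nu>\<^sup>\<rho>\<close> is onto, which is preserved by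
  \<open>P\<close> (\<open>star_fibre_map_surj\<close>). Dilators are preserved because the extension of \<open>P\<^sup>*(D)\<close> to a
  well order is a sum of well founded orders along \<open>Tr(D)\<close>, which is well founded as a suborder
  of the extension of \<open>D\<close> to \<open>\<omega>\<close> (\<open>star_dilator\<close>). Finally, all of \<open>D\<close> lies below the trace
  element \<open>\<top>\<close> of \<open>D + 1\<close>, so that \<open>D\<close> embeds into \<open>(D + 1)[\<top>]\<close>. Now \<open>\<xi>\<^sup>D\<close> arises if \<open>P\<close>
  is applied to this embedding (\<open>star_unit\<close>).

  These arguments use that natural transformations of predilators automatically respect
  supports and hence normal forms (\<open>hom_supp\<close>, \<open>hom_nf_trace\<close>).
\<close>

section \<open>Embeddings and enumerations\<close>

lemma fin_Field [simp]: "Field (natLeq_on n) = {..<n}"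
  by (auto simp: Field_natLeq_on)

lemma fin_Linear_order [simp]: "linear_order_on {..<n} (natLeq_on n)"
  using natLeq_on_Well_order[of n] by (simp add: well_order_on_def)

lemma Linear_orderI:
  assumes "\<And>x. x \<in> Field r \<Longrightarrow> (x, x) \<in> r"
    and "\<And>x y z. (x, y) \<in> r \<Longrightarrow> (y, z) \<in> r \<Longrightarrow> (x, z) \<in> r"
    and "\<And>x y. (x, y) \<in> r \<Longrightarrow> (y, x) \<in> r \<Longrightarrow> x = y"
    and "\<And>x y. x \<in> Field r \<Longrightarrow> y \<in> Field r \<Longrightarrow> x \<noteq> y \<Longrightarrow> (x, y) \<in> r \<or> (y, x) \<in> r"
  shows "Linear_order r"
  unfolding linear_order_on_def partial_order_on_def preorder_on_def
  using assms by (auto simp: refl_on_def total_on_def Field_def intro!: transI antisymI)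

lemma
  assumes "Linear_order r"
  shows lin_refl: "x \<in> Field r \<Longrightarrow> (x, x) \<in> r"
    and lin_trans: "(x, y) \<in> r \<Longrightarrow> (y, z) \<in> r \<Longrightarrow> (x, z) \<in> r"
    and lin_antisym: "(x, y) \<in> r \<Longrightarrow> (y, x) \<in> r \<Longrightarrow> x = y"
    and lin_total: "x \<in> Field r \<Longrightarrow> y \<in> Field r \<Longrightarrow> (x, y) \<in> r \<or> (y, x) \<in> r"
proof -
  have r: "refl_on (Field r) r" "trans r" "antisym r" "total_on (Field r) r"
    using assms by (auto simp: linear_order_on_def dest: partial_order_onD)
  show "x \<in> Field r \<Longrightarrow> (x, x) \<in> r" using r(1) by (simp add: refl_on_def)
  show "(x, y) \<in> r \<Longrightarrow> (y, z) \<in> r \<Longrightarrow> (x, z) \<in> r" using r(2) by (rule transD)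
  show "(x, y) \<in> r \<Longrightarrow> (y, x) \<in> r \<Longrightarrow> x = y" using r(3) by (rule antisymD)
  show "x \<in> Field r \<Longrightarrow> y \<in> Field r \<Longrightarrow> (x, y) \<in> r \<or> (y, x) \<in> r"
    using r(1,4) by (cases "x = y") (auto simp: refl_on_def total_on_def)
qed

lemma lo_less_Field: "lo_less r x y \<Longrightarrow> x \<in> Field r \<and> y \<in> Field r"
  by (auto simp: lo_less_def Field_def)

lemma lo_less_trans:
  "Linear_order r \<Longrightarrow> lo_less r x y \<Longrightarrow> lo_less r y z \<Longrightarrow> lo_less r x z"
  unfolding lo_less_def using lin_trans lin_antisym by metis

lemma lo_less_total:
  "Linear_order r \<Longrightarrow> x \<in> Field r \<Longrightarrow> y \<in> Field r \<Longrightarrow> lo_less r x y \<or> x = y \<or> lo_less r y x"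
  unfolding lo_less_def using lin_total by metis

lemma Field_Restr_lin:
  assumes "Linear_order r" "A \<subseteq> Field r"
  shows "Field (Restr r A) = A"
proof
  show "A \<subseteq> Field (Restr r A)"
    using assms(2) lin_refl[OF assms(1)] by (blast intro: FieldI1)
qed (auto simp: Field_def)

lemma Linear_order_Restr:
  assumes "Linear_order r"
  shows "Linear_order (Restr r A)"
proof -
  have F: "x \<in> Field r \<and> x \<in> A" if "x \<in> Field (Restr r A)" for x
    using that by (auto simp: Field_def)
  show ?thesis
  proof (rule Linear_orderI)
    fix x y assume "x \<in> Field (Restr r A)" "y \<in> Field (Restr r A)" "x \<noteq> y"
    then show "(x, y) \<in> Restr r A \<or> (y, x) \<in> Restr r A"
      using F lin_total[OF assms] by auto
  qed (use F lin_refl[OF assms] lin_trans[OF assms] lin_antisym[OF assms] in auto)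
qed

lemma
  assumes "f \<in> lo_emb X Y"
  shows lo_emb_mem: "x \<in> Field X \<Longrightarrow> f x \<in> Field Y"
    and lo_emb_iff: "x \<in> Field X \<Longrightarrow> y \<in> Field X \<Longrightarrow> (f x, f y) \<in> Y \<longleftrightarrow> (x, y) \<in> X"
    and lo_emb_ext: "f \<in> extensional (Field X)"
  using assms by (auto simp: lo_emb_def PiE_iff)

lemma lo_emb_inj:
  assumes "f \<in> lo_emb X Y" "Linear_order X" "Linear_order Y"
    and "x \<in> Field X" "y \<in> Field X"
  shows "f x = f y \<longleftrightarrow> x = y"
  using assms by (metis lin_antisym lin_refl lo_emb_iff lo_emb_mem)

lemma lo_emb_less:
  assumes "f \<in> lo_emb X Y" "Linear_order X" "Linear_order Y"
    and "x \<in> Field X" "y \<in> Field X"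
  shows "lo_less Y (f x) (f y) \<longleftrightarrow> lo_less X x y"
  unfolding lo_less_def using lo_emb_inj[OF assms] lo_emb_iff[OF assms(1,4,5)] by simp

text \<open>
  Reflection of the order is automatic: if \<open>f x \<le> f y\<close> but not \<open>x \<le> y\<close>, then totality yields
  \<open>y \<le> x\<close> and hence \<open>f x = f y\<close>, against injectivity.
\<close>

lemma lo_embI:
  assumes "Linear_order X" "Linear_order Y"
    and "f \<in> extensional (Field X)"
    and "\<And>x y. (x, y) \<in> X \<Longrightarrow> (f x, f y) \<in> Y"
    and "\<And>x y. x \<in> Field X \<Longrightarrow> y \<in> Field X \<Longrightarrow> f x = f y \<Longrightarrow> x = y"
  shows "f \<in> lo_emb X Y"
proof -
  have mem: "f x \<in> Field Y" if "x \<in> Field X" for x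
    using assms(4)[OF lin_refl[OF assms(1) that]] by (rule FieldI1)
  have "(x, y) \<in> X" if "x \<in> Field X" "y \<in> Field X" "(f x, f y) \<in> Y" for x y
  proof (rule ccontr)
    assume "(x, y) \<notin> X"
    then have yx: "(y, x) \<in> X" using lin_total[OF assms(1) that(1,2)] by simp
    then have "f x = f y" using assms(4) that(3) lin_antisym[OF assms(2)] by metis
    then show False using assms(5) that \<open>(x, y) \<notin> X\<close> yx by metis
  qed
  then show ?thesis using assms(3,4) mem by (auto simp: lo_emb_def PiE_iff)
qed

lemma lo_emb_compose:
  assumes "f \<in> lo_emb X Y" "g \<in> lo_emb Y Z"
  shows "compose (Field X) g f \<in> lo_emb X Z"
  using assms by (auto simp: lo_emb_def PiE_iff compose_def)

lemma lo_emb_id: "(\<lambda>x\<in>Field X. x) \<in> lo_emb X X"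
  by (auto simp: lo_emb_def)

lemma fin_emb_iff:
  "f \<in> fin_emb n m \<longleftrightarrow>
    f \<in> extensional {..<n} \<and> (\<forall>x<n. f x < m) \<and> (\<forall>x y. x < y \<longrightarrow> y < n \<longrightarrow> f x < f y)"
  (is "?l \<longleftrightarrow> ?r")
proof
  assume l: ?l
  have "f x < f y" if "x < y" "y < n" for x y
  proof -
    have "lo_less (natLeq_on m) (f x) (f y)"
      using that by (subst lo_emb_less[OF l]) (auto simp: lo_less_def)
    then show ?thesis by (auto simp: lo_less_def)
  qed
  then show ?r using l lo_emb_mem[OF l] lo_emb_ext[OF l] by auto
next
  assume r: ?r
  then have less: "f x < f y" if "x < y" "y < n" for x y using that by blast
  show ?l
  proof (rule lo_embI)
    fix x y assume "(x, y) \<in> natLeq_on n"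
    then show "(f x, f y) \<in> natLeq_on m"
      using r less[of x y] by (cases "x = y") (auto intro: less_imp_le)
  next
    fix x y assume "x \<in> Field (natLeq_on n)" "y \<in> Field (natLeq_on n)" "f x = f y"
    then show "x = y"
      using less[of x y] less[of y x] by (cases x y rule: linorder_cases) auto
  qed (use r in simp_all)
qed

lemma fin_emb_less: "f \<in> fin_emb n m \<Longrightarrow> x < n \<Longrightarrow> f x < m"
  by (simp add: fin_emb_iff)

lemma fin_emb_inj: "f \<in> fin_emb n m \<Longrightarrow> inj_on f {..<n}"
  by (auto simp: inj_on_def lo_emb_inj)

lemma fin_emb_compose:
  assumes "f \<in> fin_emb n m" "g \<in> fin_emb m k"
  shows "compose {..<n} g f \<in> fin_emb n k"
  using lo_emb_compose[OF assms] by simp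

lemma fin_emb_id: "(\<lambda>x\<in>{..<n}. x) \<in> fin_emb n m \<longleftrightarrow> n \<le> m"
proof
  show "(\<lambda>x\<in>{..<n}. x) \<in> fin_emb n m \<Longrightarrow> n \<le> m"
    using fin_emb_less[of "\<lambda>x\<in>{..<n}. x" n m m] by (cases "m < n") auto
qed (simp add: fin_emb_iff)

text \<open>
  Strictly increasing functions satisfy \<open>x \<le> f x\<close>, and counting down from the last value
  yields the converse inequality.
\<close>

lemma fin_emb_endo:
  assumes f: "f \<in> fin_emb n n"
  shows "f = (\<lambda>x\<in>{..<n}. x)"
proof -
  have up: "x \<le> f x" if "x < n" for x
    using that
  proof (induction x)
    case (Suc x)
    then have "f x < f (Suc x)" using f by (simp add: fin_emb_iff)
    then show ?case using Suc by simp
  qed simp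
  have gap: "f x + k \<le> f (x + k)" if "x + k < n" for x k
    using that
  proof (induction k)
    case (Suc k)
    then have "f (x + k) < f (x + Suc k)" using f by (simp add: fin_emb_iff)
    then show ?case using Suc by simp
  qed simp
  have "f x = x" if "x < n" for x
  proof -
    have "f x + (n - 1 - x) \<le> f (n - 1)" using gap[of x "n - 1 - x"] that by simp
    moreover have "f (n - 1) < n" using fin_emb_less[OF f] that by simp
    ultimately show ?thesis using up[OF that] that by linarith
  qed
  then show ?thesis using lo_emb_ext[OF f] by (auto simp: extensional_def restrict_def)
qed

text \<open>
  The factor is \<open>h\<close> followed by the inverse of \<open>e\<close>. This one construction yields the uniqueness
  of enumerations, where the factor is an endomorphism of a finite order and hence trivial, as
  well as the induced maps \<open>|f|\<close> between cardinalities.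
\<close>

lemma lo_emb_factor:
  assumes r: "Linear_order r" and s: "Linear_order s" and X: "Linear_order X"
    and h: "h \<in> lo_emb r X" and e: "e \<in> lo_emb s X" and sub: "h ` Field r \<subseteq> e ` Field s"
  obtains g where "g \<in> lo_emb r s" "compose (Field r) e g = h"
proof
  let ?g = "\<lambda>x\<in>Field r. inv_into (Field s) e (h x)"
  have g: "?g x \<in> Field s" "e (?g x) = h x" if "x \<in> Field r" for x
    using sub that by (auto intro!: inv_into_into f_inv_into_f)
  show "?g \<in> lo_emb r s"
  proof (rule lo_embI[OF r s])
    fix x y assume xy: "(x, y) \<in> r"
    then have F: "x \<in> Field r" "y \<in> Field r" by (auto simp: Field_def)
    then have "(e (?g x), e (?g y)) \<in> X" using g xy lo_emb_iff[OF h] by simp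
    then show "(?g x, ?g y) \<in> s" using lo_emb_iff[OF e] g F by metis
  next
    fix x y assume F: "x \<in> Field r" "y \<in> Field r" and "?g x = ?g y"
    then have "h x = h y" using g by metis
    then show "x = y" using F lo_emb_inj[OF h r X] by simp
  qed auto
  show "compose (Field r) e ?g = h"
    using g lo_emb_ext[OF h] by (auto simp: compose_def extensional_def fun_eq_iff)
qed

lemma enum_unique:
  assumes X: "Linear_order X"
    and f: "f \<in> lo_emb (natLeq_on n) X" and g: "g \<in> lo_emb (natLeq_on n) X"
    and eq: "f ` {..<n} \<subseteq> g ` {..<n}"
  shows "f = g"
proof -
  obtain h where h: "h \<in> fin_emb n n" "compose {..<n} g h = f"
    using lo_emb_factor[OF _ _ X f g] eq by auto
  have "compose {..<n} g (\<lambda>x\<in>{..<n}. x) = g"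
    using lo_emb_ext[OF g] by (auto simp: compose_def extensional_def fun_eq_iff)
  then show ?thesis using h(2) unfolding fin_emb_endo[OF h(1)] by simp
qed

text \<open>The enumeration inverts the function that counts the predecessors.\<close>

lemma enum_exists:
  assumes X: "Linear_order X" and fin: "finite (Field X)"
  shows "\<exists>f \<in> lo_emb (natLeq_on (lo_card X)) X. f ` {..<lo_card X} = Field X"
proof -
  define rk where "rk x = card {y \<in> Field X. lo_less X y x}" for x
  have mono: "rk x < rk y" if xy: "lo_less X x y" for x y
    unfolding rk_def
  proof (rule psubset_card_mono)
    have "{z \<in> Field X. lo_less X z x} \<subseteq> {z \<in> Field X. lo_less X z y}"
      using lo_less_trans[OF X _ xy] by blast
    moreover have "x \<in> {z \<in> Field X. lo_less X z y} - {z \<in> Field X. lo_less X z x}"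
      using xy lo_less_Field[OF xy] by (simp add: lo_less_def)
    ultimately show "{z \<in> Field X. lo_less X z x} \<subset> {z \<in> Field X. lo_less X z y}"
      by blast
  qed (use fin in simp)
  have iff: "lo_less X x y \<longleftrightarrow> rk x < rk y" and rk_eq: "rk x = rk y \<Longrightarrow> x = y"
    if "x \<in> Field X" "y \<in> Field X" for x y
    using lo_less_total[OF X that] mono[of x y] mono[of y x] by auto
  have "rk x < lo_card X" if "x \<in> Field X" for x
    unfolding rk_def by (rule psubset_card_mono[OF fin]) (use that in \<open>auto simp: lo_less_def\<close>)
  then have "rk ` Field X \<subseteq> {..<lo_card X}" by blast
  moreover have "inj_on rk (Field X)" using rk_eq by (rule inj_onI)
  ultimately have img: "rk ` Field X = {..<lo_card X}"
    by (intro card_subset_eq) (simp_all add: card_image)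
  define f where "f = (\<lambda>i\<in>{..<lo_card X}. inv_into (Field X) rk i)"
  have f: "f i \<in> Field X" "rk (f i) = i" if "i < lo_card X" for i
    using that img unfolding f_def by (auto intro!: inv_into_into f_inv_into_f)
  have "f \<in> lo_emb (natLeq_on (lo_card X)) X"
  proof (rule lo_embI[OF _ X])
    fix i j assume "(i, j) \<in> natLeq_on (lo_card X)"
    then have "lo_less X (f i) (f j) \<or> f i = f j \<and> f i \<in> Field X"
      using iff[of "f i" "f j"] f[of i] f[of j] by (cases "i = j") auto
    then show "(f i, f j) \<in> X" using lin_refl[OF X] by (auto simp: lo_less_def)
  next
    fix i j assume "i \<in> Field (natLeq_on (lo_card X))" "j \<in> Field (natLeq_on (lo_card X))"
      "f i = f j"
    then have "i < lo_card X" "j < lo_card X" and "rk (f i) = rk (f j)" by simp_all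
    then show "i = j" using f(2) by metis
  next
    show "f \<in> extensional (Field (natLeq_on (lo_card X)))" unfolding f_def by simp
  qed simp
  moreover have "f ` {..<lo_card X} = Field X"
  proof
    show "Field X \<subseteq> f ` {..<lo_card X}"
    proof
      fix x assume x: "x \<in> Field X"
      then have r: "rk x < lo_card X" using img by auto
      have "f (rk x) = x" using rk_eq[OF f(1)[OF r] x] f(2)[OF r] by simp
      then show "x \<in> f ` {..<lo_card X}" using r by (metis imageI lessThan_iff)
    qed
  qed (use f in auto)
  ultimately show ?thesis by blast
qed

lemma lo_en_eq:
  assumes "Linear_order X" "f \<in> lo_emb (natLeq_on (lo_card X)) X" "f ` {..<lo_card X} = Field X"
  shows "lo_en X = f"
  unfolding lo_en_def
proof (rule the_equality)
  fix g assume "g \<in> lo_emb (natLeq_on (lo_card X)) X \<and> g ` {..<lo_card X} = Field X"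
  then show "g = f" using enum_unique[OF assms(1) _ assms(2)] assms(3) by simp
qed (use assms in simp)

lemma lo_en_props:
  assumes "Linear_order X" "finite (Field X)"
  shows "lo_en X \<in> lo_emb (natLeq_on (lo_card X)) X" "lo_en X ` {..<lo_card X} = Field X"
proof -
  obtain f where "f \<in> lo_emb (natLeq_on (lo_card X)) X" "f ` {..<lo_card X} = Field X"
    using enum_exists[OF assms] by blast
  moreover from this have "lo_en X = f" by (rule lo_en_eq[OF assms(1)])
  ultimately show "lo_en X \<in> lo_emb (natLeq_on (lo_card X)) X"
    "lo_en X ` {..<lo_card X} = Field X" by simp_all
qed

lemma lo_abs_emb:
  assumes r: "Linear_order r" "finite (Field r)" and s: "Linear_order s" "finite (Field s)"
    and f: "f \<in> lo_emb r s"
  shows "lo_abs r s f \<in> fin_emb (lo_card r) (lo_card s)"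
    and "compose {..<lo_card r} (lo_en s) (lo_abs r s f) = compose {..<lo_card r} f (lo_en r)"
proof -
  note en = lo_en_props[OF r] lo_en_props[OF s]
  have h: "compose {..<lo_card r} f (lo_en r) \<in> lo_emb (natLeq_on (lo_card r)) s"
    using lo_emb_compose[OF en(1) f] by simp
  have "compose {..<lo_card r} f (lo_en r) ` {..<lo_card r} \<subseteq> lo_en s ` {..<lo_card s}"
    using lo_emb_mem[OF h] en(4) by auto
  then obtain g where g: "g \<in> fin_emb (lo_card r) (lo_card s)"
    "compose {..<lo_card r} (lo_en s) g = compose {..<lo_card r} f (lo_en r)"
    using lo_emb_factor[OF _ _ s(1) h en(3)] by auto
  have uniq: "g' = g" if g': "g' \<in> fin_emb (lo_card r) (lo_card s)"
    "compose {..<lo_card r} (lo_en s) g' = compose {..<lo_card r} f (lo_en r)" for g'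
  proof (rule extensionalityI)
    fix x assume x: "x \<in> {..<lo_card r}"
    have "lo_en s (g' x) = lo_en s (g x)"
      using x fun_cong[OF trans[OF g'(2) g(2)[symmetric]], of x] by (simp add: compose_def)
    then show "g' x = g x"
      using x fin_emb_less[OF g(1)] fin_emb_less[OF g'(1)] lo_emb_inj[OF en(3) _ s(1)] by simp
  qed (use lo_emb_ext[OF g(1)] lo_emb_ext[OF g'(1)] in simp_all)
  have "lo_abs r s f = g" unfolding lo_abs_def using g uniq by (intro the_equality) blast+
  then show "lo_abs r s f \<in> fin_emb (lo_card r) (lo_card s)"
    "compose {..<lo_card r} (lo_en s) (lo_abs r s f) = compose {..<lo_card r} f (lo_en r)"
    using g by simp_all
qed

lemma lo_abs_incl:
  assumes X: "Linear_order X" and a: "finite a" "a \<subseteq> Field X" and b: "finite b" "b \<subseteq> Field X"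
    and ab: "a \<subseteq> b"
  shows "lo_abs (Restr X a) (Restr X b) (\<lambda>x\<in>a. x) \<in> fin_emb (card a) (card b)"
proof -
  have F: "Field (Restr X a) = a" "Field (Restr X b) = b"
    using Field_Restr_lin[OF X] a b by auto
  have "(\<lambda>x\<in>a. x) \<in> lo_emb (Restr X a) (Restr X b)"
    using ab by (auto simp: lo_emb_def F)
  from lo_abs_emb(1)[OF _ _ _ _ this] show ?thesis
    using a b Linear_order_Restr[OF X, of a] Linear_order_Restr[OF X, of b]
    unfolding F by blast
qed

lemma lo_abs_segment:
  assumes "m \<le> k"
  shows "lo_abs (Restr natLeq {..<m}) (Restr natLeq {..<k}) (\<lambda>x\<in>{..<m}. x) = (\<lambda>x\<in>{..<m}. x)"
proof -
  have R: "Restr natLeq {..<n} = natLeq_on n" for n by (auto simp: natLeq_def)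
  have e: "lo_en (natLeq_on n) = (\<lambda>x\<in>{..<n}. x)" for n
    by (rule lo_en_eq) (auto simp: fin_emb_id)
  let ?i = "\<lambda>x\<in>{..<m}. x"
  have i: "?i \<in> fin_emb m k" using assms fin_emb_id by simp
  define g where "g = lo_abs (natLeq_on m) (natLeq_on k) ?i"
  have g: "g \<in> fin_emb m k"
    and c: "compose {..<m} (lo_en (natLeq_on k)) g = compose {..<m} ?i (lo_en (natLeq_on m))"
    using lo_abs_emb[OF _ _ _ _ i] by (simp_all add: g_def)
  have "g = ?i"
  proof (rule extensionalityI[of _ "{..<m}"])
    fix x assume "x \<in> {..<m}"
    then show "g x = ?i x"
      using fun_cong[OF c, of x] fin_emb_less[OF g] by (simp add: e compose_def)
  qed (use lo_emb_ext[OF g] in simp_all)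
  then have "lo_abs (natLeq_on m) (natLeq_on k) ?i = ?i" unfolding g_def .
  then show ?thesis unfolding R .
qed

section \<open>Predilators and normal forms\<close>

lemma predilatorI:
  assumes "\<And>n. Linear_order (pd_ord D n)"
    and "\<And>n m. pd_map D n m \<in> extensional (fin_emb n m)"
    and "\<And>n m f. f \<in> fin_emb n m \<Longrightarrow> pd_map D n m f \<in> lo_emb (pd_ord D n) (pd_ord D m)"
    and "\<And>n \<sigma>. \<sigma> \<in> pd_carrier D n \<Longrightarrow> pd_map D n n (\<lambda>x\<in>{..<n}. x) \<sigma> = \<sigma>"
    and "\<And>n m k f g \<sigma>. f \<in> fin_emb n m \<Longrightarrow> g \<in> fin_emb m k \<Longrightarrow> \<sigma> \<in> pd_carrier D n \<Longrightarrow>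
      pd_map D n k (compose {..<n} g f) \<sigma> = pd_map D m k g (pd_map D n m f \<sigma>)"
    and "\<And>n m f g \<sigma>. f \<in> fin_emb n m \<Longrightarrow> g \<in> fin_emb n m \<Longrightarrow> (\<And>x. x < n \<Longrightarrow> f x \<le> g x) \<Longrightarrow>
      \<sigma> \<in> pd_carrier D n \<Longrightarrow> (pd_map D n m f \<sigma>, pd_map D n m g \<sigma>) \<in> pd_ord D m"
    and "\<And>n. pd_supp D n \<in> extensional (pd_carrier D n)"
    and "\<And>n \<sigma>. \<sigma> \<in> pd_carrier D n \<Longrightarrow> pd_supp D n \<sigma> \<subseteq> {..<n}"
    and "\<And>n m f \<sigma>. f \<in> fin_emb n m \<Longrightarrow> \<sigma> \<in> pd_carrier D n \<Longrightarrow>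
      pd_supp D m (pd_map D n m f \<sigma>) = f ` pd_supp D n \<sigma>"
    and "\<And>n m f \<sigma>. f \<in> fin_emb n m \<Longrightarrow> \<sigma> \<in> pd_carrier D m \<Longrightarrow>
      pd_supp D m \<sigma> \<subseteq> f ` {..<n} \<Longrightarrow> \<sigma> \<in> pd_map D n m f ` pd_carrier D n"
  shows "predilator D"
proof -
  have id: "pd_map D n n (\<lambda>x\<in>{..<n}. x) = (\<lambda>\<sigma>\<in>pd_carrier D n. \<sigma>)" for n
  proof (rule extensionalityI[of _ "pd_carrier D n"])
    show "pd_map D n n (\<lambda>x\<in>{..<n}. x) \<in> extensional (pd_carrier D n)"
      using lo_emb_ext[OF assms(3)] by (simp add: fin_emb_id)
  qed (simp_all add: assms(4))
  have comp: "pd_map D n k (compose {..<n} g f)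
      = compose (pd_carrier D n) (pd_map D m k g) (pd_map D n m f)"
    if "f \<in> fin_emb n m" "g \<in> fin_emb m k" for n m k f g
  proof (rule extensionalityI[of _ "pd_carrier D n"])
    show "pd_map D n k (compose {..<n} g f) \<in> extensional (pd_carrier D n)"
      using lo_emb_ext[OF assms(3)] fin_emb_compose[OF that] by simp
  qed (use that assms(5) in \<open>simp_all add: compose_def\<close>)
  have mono: "(pd_map D n m f \<sigma>, pd_map D n m g \<sigma>) \<in> pd_ord D m"
    if "f \<in> fin_emb n m" "g \<in> fin_emb n m" "\<forall>x<n. f x \<le> g x" "\<sigma> \<in> pd_carrier D n" for n m f g \<sigma>
    using assms(6) that by simp
  have range: "{\<sigma> \<in> pd_carrier D m. pd_supp D m \<sigma> \<subseteq> f ` {..<n}} \<subseteq> pd_map D n m f ` pd_carrier D n"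
    if "f \<in> fin_emb n m" for n m f
    using assms(10)[OF that] by auto
  have supp: "pd_supp D n \<in> pd_carrier D n \<rightarrow>\<^sub>E Fpow {..<n}" for n
    using assms(7) finite_subset[OF assms(8)] assms(8) by (simp add: PiE_iff Fpow_def)
  have map: "pd_map D n m \<in> fin_emb n m \<rightarrow>\<^sub>E lo_emb (pd_ord D n) (pd_ord D m)" for n m
    using assms(2,3) by (simp add: PiE_iff)
  show ?thesis
    unfolding predilator_def
    by (intro conjI allI ballI impI; rule assms(1) map id comp mono supp assms(9) range;
        assumption)
qed

lemma
  assumes D: "predilator D"
  shows pd_lin: "Linear_order (pd_ord D n)"
    and pd_map_emb: "f \<in> fin_emb n m \<Longrightarrow> pd_map D n m f \<in> lo_emb (pd_ord D n) (pd_ord D m)"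
    and pd_map_id: "\<sigma> \<in> pd_carrier D n \<Longrightarrow> pd_map D n n (\<lambda>x\<in>{..<n}. x) \<sigma> = \<sigma>"
    and pd_map_comp: "f \<in> fin_emb n m \<Longrightarrow> g \<in> fin_emb m k \<Longrightarrow> \<sigma> \<in> pd_carrier D n \<Longrightarrow>
      pd_map D n k (compose {..<n} g f) \<sigma> = pd_map D m k g (pd_map D n m f \<sigma>)"
    and pd_map_mono: "f \<in> fin_emb n m \<Longrightarrow> g \<in> fin_emb n m \<Longrightarrow> (\<And>x. x < n \<Longrightarrow> f x \<le> g x) \<Longrightarrow>
      \<sigma> \<in> pd_carrier D n \<Longrightarrow> (pd_map D n m f \<sigma>, pd_map D n m g \<sigma>) \<in> pd_ord D m"
    and pd_supp_sub: "\<sigma> \<in> pd_carrier D n \<Longrightarrow> pd_supp D n \<sigma> \<subseteq> {..<n}"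
    and pd_supp_map: "f \<in> fin_emb n m \<Longrightarrow> \<sigma> \<in> pd_carrier D n \<Longrightarrow>
      pd_supp D m (pd_map D n m f \<sigma>) = f ` pd_supp D n \<sigma>"
    and pd_supp_range: "f \<in> fin_emb n m \<Longrightarrow> \<sigma> \<in> pd_carrier D m \<Longrightarrow>
      pd_supp D m \<sigma> \<subseteq> f ` {..<n} \<Longrightarrow> \<sigma> \<in> pd_map D n m f ` pd_carrier D n"
proof -
  note ax1 = D[unfolded predilator_def]
  note ax2 = ax1[THEN conjunct2] note ax3 = ax2[THEN conjunct2]
  note ax4 = ax3[THEN conjunct2] note ax5 = ax4[THEN conjunct2]
  note ax6 = ax5[THEN conjunct2] note ax7 = ax6[THEN conjunct2]
  have map: "pd_map D n m \<in> fin_emb n m \<rightarrow>\<^sub>E lo_emb (pd_ord D n) (pd_ord D m)" for n m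
    using ax2[THEN conjunct1] by (elim allE)
  have supp: "pd_supp D n \<in> pd_carrier D n \<rightarrow>\<^sub>E Fpow {..<n}" for n
    using ax6[THEN conjunct1] by (elim allE)
  show "Linear_order (pd_ord D n)" using ax1[THEN conjunct1] by (elim allE)
  show "f \<in> fin_emb n m \<Longrightarrow> pd_map D n m f \<in> lo_emb (pd_ord D n) (pd_ord D m)"
    using map by (rule PiE_mem)
  show "\<sigma> \<in> pd_carrier D n \<Longrightarrow> pd_map D n n (\<lambda>x\<in>{..<n}. x) \<sigma> = \<sigma>"
    using ax3[THEN conjunct1] by simp
  show "f \<in> fin_emb n m \<Longrightarrow> g \<in> fin_emb m k \<Longrightarrow> \<sigma> \<in> pd_carrier D n \<Longrightarrow>
      pd_map D n k (compose {..<n} g f) \<sigma> = pd_map D m k g (pd_map D n m f \<sigma>)"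
    using ax4[THEN conjunct1] by (simp add: compose_def)
  show "f \<in> fin_emb n m \<Longrightarrow> g \<in> fin_emb n m \<Longrightarrow> (\<And>x. x < n \<Longrightarrow> f x \<le> g x) \<Longrightarrow>
      \<sigma> \<in> pd_carrier D n \<Longrightarrow> (pd_map D n m f \<sigma>, pd_map D n m g \<sigma>) \<in> pd_ord D m"
    using ax5[THEN conjunct1] by simp
  show "\<sigma> \<in> pd_carrier D n \<Longrightarrow> pd_supp D n \<sigma> \<subseteq> {..<n}"
    using PiE_mem[OF supp] by (simp add: Fpow_def)
  show "f \<in> fin_emb n m \<Longrightarrow> \<sigma> \<in> pd_carrier D n \<Longrightarrow>
      pd_supp D m (pd_map D n m f \<sigma>) = f ` pd_supp D n \<sigma>"
    using ax7[THEN conjunct1] by simp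
  show "f \<in> fin_emb n m \<Longrightarrow> \<sigma> \<in> pd_carrier D m \<Longrightarrow>
      pd_supp D m \<sigma> \<subseteq> f ` {..<n} \<Longrightarrow> \<sigma> \<in> pd_map D n m f ` pd_carrier D n"
    using ax7[THEN conjunct2] by blast
qed

lemma pd_map_mem:
  "predilator D \<Longrightarrow> f \<in> fin_emb n m \<Longrightarrow> \<sigma> \<in> pd_carrier D n \<Longrightarrow>
    pd_map D n m f \<sigma> \<in> pd_carrier D m"
  by (rule lo_emb_mem[OF pd_map_emb])

lemma pd_map_inj:
  "predilator D \<Longrightarrow> f \<in> fin_emb n m \<Longrightarrow> \<sigma> \<in> pd_carrier D n \<Longrightarrow> \<tau> \<in> pd_carrier D n \<Longrightarrow>
    pd_map D n m f \<sigma> = pd_map D n m f \<tau> \<longleftrightarrow> \<sigma> = \<tau>"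
  by (rule lo_emb_inj[OF pd_map_emb pd_lin pd_lin])

lemma pd_map_less:
  "predilator D \<Longrightarrow> f \<in> fin_emb n m \<Longrightarrow> \<sigma> \<in> pd_carrier D n \<Longrightarrow> \<tau> \<in> pd_carrier D n \<Longrightarrow>
    lo_less (pd_ord D m) (pd_map D n m f \<sigma>) (pd_map D n m f \<tau>) \<longleftrightarrow> lo_less (pd_ord D n) \<sigma> \<tau>"
  by (rule lo_emb_less[OF pd_map_emb pd_lin pd_lin])

lemma Tr_iff: "(n, \<sigma>) \<in> Tr D \<longleftrightarrow> \<sigma> \<in> pd_carrier D n \<and> pd_supp D n \<sigma> = {..<n}"
  by (simp add: Tr_def)

lemma fin_enum:
  assumes a: "a \<subseteq> {..<n}"
  shows "lo_en (Restr (natLeq_on n) a) \<in> fin_emb (card a) n"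
    and "lo_en (Restr (natLeq_on n) a) ` {..<card a} = a"
proof -
  have lin: "Linear_order (natLeq_on n)" by simp
  have F: "Field (Restr (natLeq_on n) a) = a"
    using Field_Restr_lin[OF lin] a by simp
  have fin: "finite (Field (Restr (natLeq_on n) a))"
    using a unfolding F by (rule finite_subset) simp
  note en = lo_en_props[OF Linear_order_Restr[OF lin] fin, unfolded F]
  show "lo_en (Restr (natLeq_on n) a) ` {..<card a} = a" by (rule en(2))
  show "lo_en (Restr (natLeq_on n) a) \<in> fin_emb (card a) n"
  proof (rule lo_embI)
    fix x y assume "(x, y) \<in> natLeq_on (card a)"
    then have "(lo_en (Restr (natLeq_on n) a) x, lo_en (Restr (natLeq_on n) a) y)
        \<in> Restr (natLeq_on n) a"
      using lo_emb_iff[OF en(1)] by simp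
    then show "(lo_en (Restr (natLeq_on n) a) x, lo_en (Restr (natLeq_on n) a) y) \<in> natLeq_on n"
      by blast
  next
    fix x y assume "x \<in> Field (natLeq_on (card a))" "y \<in> Field (natLeq_on (card a))"
      "lo_en (Restr (natLeq_on n) a) x = lo_en (Restr (natLeq_on n) a) y"
    then show "x = y"
      using lo_emb_inj[OF en(1) _ Linear_order_Restr[OF lin]] by simp
  qed (use lo_emb_ext[OF en(1)] in simp_all)
qed

lemma fin_enum_range:
  assumes f: "f \<in> fin_emb m n"
  shows "lo_en (Restr (natLeq_on n) (f ` {..<m})) = f" "card (f ` {..<m}) = m"
proof -
  show c: "card (f ` {..<m}) = m" using card_image[OF fin_emb_inj[OF f]] by simp
  have sub: "f ` {..<m} \<subseteq> {..<n}" using fin_emb_less[OF f] by auto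
  show "lo_en (Restr (natLeq_on n) (f ` {..<m})) = f"
    using enum_unique[OF _ fin_enum(1)[OF sub, unfolded c] f] fin_enum(2)[OF sub, unfolded c]
    by simp
qed

text \<open>
  A set and its enumeration determine each other, so a normal form amounts to a trace
  element together with an embedding of its arity.
\<close>

lemma normal_form_map:
  assumes D: "predilator D" and f: "f \<in> fin_emb m n" and \<tau>: "(m, \<tau>) \<in> Tr D"
  shows "normal_form D n (pd_map D m n f \<tau>) = (f ` {..<m}, \<tau>)"
  unfolding normal_form_def
proof (rule the_equality)
  have sub: "f ` {..<m} \<subseteq> {..<n}" using fin_emb_less[OF f] by auto
  then show "case (f ` {..<m}, \<tau>) of (a, \<sigma>\<^sub>0) \<Rightarrow> a \<in> Fpow {..<n} \<and> (card a, \<sigma>\<^sub>0) \<in> Tr D \<and>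
      pd_map D m n f \<tau> = pd_map D (card a) n (lo_en (Restr (natLeq_on n) a)) \<sigma>\<^sub>0"
    using \<tau> by (simp add: Fpow_def fin_enum_range[OF f])
  fix p
  assume p: "case p of (a, \<sigma>\<^sub>0) \<Rightarrow> a \<in> Fpow {..<n} \<and> (card a, \<sigma>\<^sub>0) \<in> Tr D \<and>
      pd_map D m n f \<tau> = pd_map D (card a) n (lo_en (Restr (natLeq_on n) a)) \<sigma>\<^sub>0"
  obtain a \<sigma> where pa: "p = (a, \<sigma>)" by (cases p)
  have a: "a \<subseteq> {..<n}" and \<sigma>: "(card a, \<sigma>) \<in> Tr D"
    and eq: "pd_map D m n f \<tau> = pd_map D (card a) n (lo_en (Restr (natLeq_on n) a)) \<sigma>"
    using p by (simp_all add: pa Fpow_def)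
  have "pd_supp D n (pd_map D m n f \<tau>) = f ` {..<m}"
    using pd_supp_map[OF D f] \<tau> by (simp add: Tr_iff)
  moreover have "pd_supp D n (pd_map D m n f \<tau>) = a"
    unfolding eq using pd_supp_map[OF D fin_enum(1)[OF a]] \<sigma> fin_enum(2)[OF a]
    by (simp add: Tr_iff)
  ultimately have fa: "a = f ` {..<m}" by simp
  then have "pd_map D m n f \<tau> = pd_map D m n f \<sigma>"
    using eq by (simp add: fin_enum_range[OF f])
  moreover have "\<sigma> \<in> pd_carrier D m" "\<tau> \<in> pd_carrier D m"
    using \<sigma> \<tau> fin_enum_range(2)[OF f] by (simp_all add: fa Tr_iff)
  ultimately have "\<tau> = \<sigma>" using pd_map_inj[OF D f] by simp
  then show "p = (f ` {..<m}, \<tau>)" using pa fa by simp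
qed

lemma nf_trace_map:
  assumes "predilator D" "f \<in> fin_emb m n" "(m, \<tau>) \<in> Tr D"
  shows "nf_trace D n (pd_map D m n f \<tau>) = (m, \<tau>)"
  by (simp add: nf_trace_def normal_form_map[OF assms] fin_enum_range[OF assms(2)])

lemma normal_form_exists:
  assumes D: "predilator D" and \<sigma>: "\<sigma> \<in> pd_carrier D n"
  obtains m f \<tau> where "f \<in> fin_emb m n" "(m, \<tau>) \<in> Tr D" "\<sigma> = pd_map D m n f \<tau>"
proof -
  let ?a = "pd_supp D n \<sigma>"
  have a: "?a \<subseteq> {..<n}" using pd_supp_sub[OF D \<sigma>] .
  note en = fin_enum[OF a]
  obtain \<tau> where \<tau>: "\<tau> \<in> pd_carrier D (card ?a)"
    "\<sigma> = pd_map D (card ?a) n (lo_en (Restr (natLeq_on n) ?a)) \<tau>"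
    using pd_supp_range[OF D en(1) \<sigma>] en(2) by auto
  have "lo_en (Restr (natLeq_on n) ?a) ` pd_supp D (card ?a) \<tau>
      = lo_en (Restr (natLeq_on n) ?a) ` {..<card ?a}"
    using pd_supp_map[OF D en(1) \<tau>(1)] \<tau>(2) en(2) by simp
  then have "pd_supp D (card ?a) \<tau> = {..<card ?a}"
    using inj_on_image_eq_iff[OF fin_emb_inj[OF en(1)] pd_supp_sub[OF D \<tau>(1)]] by blast
  then show thesis using that[OF en(1) _ \<tau>(2)] \<tau>(1) by (simp add: Tr_iff)
qed

lemma nf_trace_mem:
  assumes D: "predilator D" and \<sigma>: "\<sigma> \<in> pd_carrier D n"
  shows "nf_trace D n \<sigma> \<in> Tr D"
proof -
  obtain m f \<tau> where f: "f \<in> fin_emb m n" and \<tau>: "(m, \<tau>) \<in> Tr D" and eq: "\<sigma> = pd_map D m n f \<tau>"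
    using normal_form_exists[OF D \<sigma>] .
  then show ?thesis using nf_trace_map[OF D f \<tau>] by simp
qed

lemma nf_trace_Tr:
  assumes D: "predilator D" and \<sigma>: "(n, \<sigma>) \<in> Tr D"
  shows "nf_trace D n \<sigma> = (n, \<sigma>)"
proof -
  have "(\<lambda>x\<in>{..<n}. x) \<in> fin_emb n n" by (simp add: fin_emb_id)
  from nf_trace_map[OF D this \<sigma>] show ?thesis
    using pd_map_id[OF D] \<sigma> by (simp add: Tr_iff)
qed

lemma nf_trace_natural:
  assumes D: "predilator D" and f: "f \<in> fin_emb n m" and \<sigma>: "\<sigma> \<in> pd_carrier D n"
  shows "nf_trace D m (pd_map D n m f \<sigma>) = nf_trace D n \<sigma>"
proof -
  obtain k g \<tau> where g: "g \<in> fin_emb k n" and \<tau>: "(k, \<tau>) \<in> Tr D" and eq: "\<sigma> = pd_map D k n g \<tau>"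
    using normal_form_exists[OF D \<sigma>] .
  have "pd_map D n m f \<sigma> = pd_map D k m (compose {..<k} f g) \<tau>"
    using pd_map_comp[OF D g f] \<tau> eq by (simp add: Tr_iff)
  then show ?thesis
    using nf_trace_map[OF D fin_emb_compose[OF g f] \<tau>] nf_trace_map[OF D g \<tau>] eq by simp
qed

section \<open>Morphisms of predilators\<close>

lemma pd_homI:
  assumes "\<And>n. \<mu> n \<in> lo_emb (pd_ord D n) (pd_ord E n)"
    and "\<And>n m f \<sigma>. f \<in> fin_emb n m \<Longrightarrow> \<sigma> \<in> pd_carrier D n \<Longrightarrow>
      \<mu> m (pd_map D n m f \<sigma>) = pd_map E n m f (\<mu> n \<sigma>)"
  shows "\<mu> \<in> pd_hom D E"
  using assms by (auto simp: pd_hom_def compose_def fun_eq_iff)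

lemma
  assumes "\<mu> \<in> pd_hom D E"
  shows hom_emb: "\<mu> n \<in> lo_emb (pd_ord D n) (pd_ord E n)"
    and hom_nat: "f \<in> fin_emb n m \<Longrightarrow> \<sigma> \<in> pd_carrier D n \<Longrightarrow>
      \<mu> m (pd_map D n m f \<sigma>) = pd_map E n m f (\<mu> n \<sigma>)"
proof -
  show "\<mu> n \<in> lo_emb (pd_ord D n) (pd_ord E n)" using assms by (simp add: pd_hom_def)
  assume f: "f \<in> fin_emb n m" and \<sigma>: "\<sigma> \<in> pd_carrier D n"
  have "compose (pd_carrier D n) (\<mu> m) (pd_map D n m f)
      = compose (pd_carrier D n) (pd_map E n m f) (\<mu> n)"
    using assms f by (simp add: pd_hom_def)
  from fun_cong[OF this, of \<sigma>] show "\<mu> m (pd_map D n m f \<sigma>) = pd_map E n m f (\<mu> n \<sigma>)"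
    using \<sigma> by (simp add: compose_def)
qed

lemma hom_mem: "\<mu> \<in> pd_hom D E \<Longrightarrow> \<sigma> \<in> pd_carrier D n \<Longrightarrow> \<mu> n \<sigma> \<in> pd_carrier E n"
  by (rule lo_emb_mem[OF hom_emb])

lemma hom_ext: "\<mu> \<in> pd_hom D E \<Longrightarrow> \<mu> n \<in> extensional (pd_carrier D n)"
  by (rule lo_emb_ext[OF hom_emb])

lemma hom_eqI:
  assumes "\<mu> \<in> pd_hom D E" "\<nu> \<in> pd_hom D F"
    and "\<And>n \<sigma>. \<sigma> \<in> pd_carrier D n \<Longrightarrow> \<mu> n \<sigma> = \<nu> n \<sigma>"
  shows "\<mu> = \<nu>"
  by (rule ext, rule extensionalityI[OF hom_ext[OF assms(1)] hom_ext[OF assms(2)]])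
    (rule assms(3))

lemma hom_id: "pd_id D \<in> pd_hom D D"
  if "predilator D"
  using pd_map_mem[OF that] lo_emb_id by (intro pd_homI) (simp_all add: pd_id_def)

lemma hom_comp:
  assumes "\<mu> \<in> pd_hom D E" "\<nu> \<in> pd_hom E F" "predilator D"
  shows "pd_comp D \<nu> \<mu> \<in> pd_hom D F"
proof (rule pd_homI)
  show "pd_comp D \<nu> \<mu> n \<in> lo_emb (pd_ord D n) (pd_ord F n)" for n
    unfolding pd_comp_def using lo_emb_compose[OF hom_emb[OF assms(1)] hom_emb[OF assms(2)]] .
  show "pd_comp D \<nu> \<mu> m (pd_map D n m f \<sigma>) = pd_map F n m f (pd_comp D \<nu> \<mu> n \<sigma>)"
    if "f \<in> fin_emb n m" "\<sigma> \<in> pd_carrier D n" for n m f \<sigma>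
    using that pd_map_mem[OF assms(3)] hom_mem[OF assms(1)] hom_nat[OF assms(1)]
      hom_nat[OF assms(2)]
    by (simp add: pd_comp_def compose_def)
qed

lemma pd_comp_apply: "\<sigma> \<in> pd_carrier D n \<Longrightarrow> pd_comp D \<nu> \<mu> n \<sigma> = \<nu> n (\<mu> n \<sigma>)"
  by (simp add: pd_comp_def compose_def)

lemma hom_inj:
  "predilator D \<Longrightarrow> predilator E \<Longrightarrow> \<mu> \<in> pd_hom D E \<Longrightarrow> \<sigma> \<in> pd_carrier D n \<Longrightarrow>
    \<tau> \<in> pd_carrier D n \<Longrightarrow> \<mu> n \<sigma> = \<mu> n \<tau> \<longleftrightarrow> \<sigma> = \<tau>"
  by (rule lo_emb_inj[OF hom_emb pd_lin pd_lin])

lemma hom_less: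
  "predilator D \<Longrightarrow> predilator E \<Longrightarrow> \<mu> \<in> pd_hom D E \<Longrightarrow> \<sigma> \<in> pd_carrier D n \<Longrightarrow>
    \<tau> \<in> pd_carrier D n \<Longrightarrow> lo_less (pd_ord E n) (\<mu> n \<sigma>) (\<mu> n \<tau>) \<longleftrightarrow> lo_less (pd_ord D n) \<sigma> \<tau>"
  by (rule lo_emb_less[OF hom_emb pd_lin pd_lin])

text \<open>
  Supports can be recovered from the functor: \<open>i\<close> lies in the support of \<open>\<sigma>\<close> precisely if
  the two embeddings of \<open>n\<close> into \<open>n + 1\<close> that differ in \<open>i\<close> only act differently on \<open>\<sigma>\<close>.
  Hence natural transformations respect supports.
\<close>

lemma hom_supp:
  assumes D: "predilator D" and E: "predilator E" and \<mu>: "\<mu> \<in> pd_hom D E"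
    and \<sigma>: "\<sigma> \<in> pd_carrier D n"
  shows "pd_supp E n (\<mu> n \<sigma>) = pd_supp D n \<sigma>"
proof
  show "pd_supp E n (\<mu> n \<sigma>) \<subseteq> pd_supp D n \<sigma>"
  proof -
    obtain m f \<tau> where f: "f \<in> fin_emb m n" and \<tau>: "(m, \<tau>) \<in> Tr D" and eq: "\<sigma> = pd_map D m n f \<tau>"
      using normal_form_exists[OF D \<sigma>] .
    have \<tau>': "\<tau> \<in> pd_carrier D m" "pd_supp D m \<tau> = {..<m}" using \<tau> by (simp_all add: Tr_iff)
    have "pd_supp E n (\<mu> n \<sigma>) = f ` pd_supp E m (\<mu> m \<tau>)"
      using pd_supp_map[OF E f hom_mem[OF \<mu> \<tau>'(1)]] hom_nat[OF \<mu> f \<tau>'(1)] eq by simp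
    also have "\<dots> \<subseteq> f ` {..<m}" using pd_supp_sub[OF E hom_mem[OF \<mu> \<tau>'(1)]] by blast
    also have "\<dots> = pd_supp D n \<sigma>" using pd_supp_map[OF D f \<tau>'(1)] \<tau>'(2) eq by simp
    finally show ?thesis .
  qed
  show "pd_supp D n \<sigma> \<subseteq> pd_supp E n (\<mu> n \<sigma>)"
  proof (rule subsetI, rule ccontr)
    fix i assume i: "i \<in> pd_supp D n \<sigma>" "i \<notin> pd_supp E n (\<mu> n \<sigma>)"
    define f where "f = (\<lambda>x\<in>{..<n}. if x < i then x else Suc x)"
    define g where "g = (\<lambda>x\<in>{..<n}. if x \<le> i then x else Suc x)"
    have f: "f \<in> fin_emb n (Suc n)" and g: "g \<in> fin_emb n (Suc n)"
      by (auto simp: fin_emb_iff f_def g_def)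
    have fg: "f x = g x" if "x \<noteq> i" for x using that by (simp add: f_def g_def)
    obtain m e \<tau> where e: "e \<in> fin_emb m n" and \<tau>: "(m, \<tau>) \<in> Tr E"
      and eq: "\<mu> n \<sigma> = pd_map E m n e \<tau>"
      using normal_form_exists[OF E hom_mem[OF \<mu> \<sigma>]] .
    have \<tau>': "\<tau> \<in> pd_carrier E m" "pd_supp E m \<tau> = {..<m}" using \<tau> by (simp_all add: Tr_iff)
    have "i \<notin> e ` {..<m}" using i(2) pd_supp_map[OF E e \<tau>'(1)] \<tau>'(2) eq by simp
    then have "e x \<noteq> i" if "x < m" for x using that by blast
    then have "compose {..<m} f e = compose {..<m} g e"
      by (auto simp: compose_def fun_eq_iff fg)
    then have "pd_map E n (Suc n) f (\<mu> n \<sigma>) = pd_map E n (Suc n) g (\<mu> n \<sigma>)"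
      using pd_map_comp[OF E e f \<tau>'(1)] pd_map_comp[OF E e g \<tau>'(1)] eq by simp
    then have "\<mu> (Suc n) (pd_map D n (Suc n) f \<sigma>) = \<mu> (Suc n) (pd_map D n (Suc n) g \<sigma>)"
      using hom_nat[OF \<mu> _ \<sigma>] f g by simp
    then have "pd_map D n (Suc n) f \<sigma> = pd_map D n (Suc n) g \<sigma>"
      using hom_inj[OF D E \<mu>] pd_map_mem[OF D _ \<sigma>] f g by simp
    then have "f ` pd_supp D n \<sigma> = g ` pd_supp D n \<sigma>"
      using pd_supp_map[OF D f \<sigma>] pd_supp_map[OF D g \<sigma>] by simp
    moreover have "i < n" using i(1) pd_supp_sub[OF D \<sigma>] by auto
    then have "i \<in> g ` pd_supp D n \<sigma>" using i(1) by (auto simp: g_def intro!: image_eqI[of _ _ i])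
    moreover have "i \<notin> f ` pd_supp D n \<sigma>"
      using pd_supp_sub[OF D \<sigma>] by (auto simp: f_def split: if_splits)
    ultimately show False by simp
  qed
qed

lemma Tr_map_pair [simp]: "Tr_map \<mu> (n, \<sigma>) = (n, \<mu> n \<sigma>)"
  by (simp add: Tr_map_def)

lemma
  assumes D: "predilator D" and E: "predilator E" and \<mu>: "\<mu> \<in> pd_hom D E"
  shows Tr_map_mem: "\<rho> \<in> Tr D \<Longrightarrow> Tr_map \<mu> \<rho> \<in> Tr E"
    and hom_Tr_iff: "\<sigma> \<in> pd_carrier D n \<Longrightarrow> (n, \<mu> n \<sigma>) \<in> Tr E \<longleftrightarrow> (n, \<sigma>) \<in> Tr D"
    and Tr_map_inj: "\<rho> \<in> Tr D \<Longrightarrow> \<rho>' \<in> Tr D \<Longrightarrow> Tr_map \<mu> \<rho> = Tr_map \<mu> \<rho>' \<longleftrightarrow> \<rho> = \<rho>'"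
proof -
  show iff: "\<sigma> \<in> pd_carrier D n \<Longrightarrow> (n, \<mu> n \<sigma>) \<in> Tr E \<longleftrightarrow> (n, \<sigma>) \<in> Tr D" for n \<sigma>
    using hom_supp[OF D E \<mu>] hom_mem[OF \<mu>] by (simp add: Tr_iff)
  show "\<rho> \<in> Tr D \<Longrightarrow> Tr_map \<mu> \<rho> \<in> Tr E"
    using iff by (cases \<rho>) (simp add: Tr_iff)
  show "\<rho> \<in> Tr D \<Longrightarrow> \<rho>' \<in> Tr D \<Longrightarrow> Tr_map \<mu> \<rho> = Tr_map \<mu> \<rho>' \<longleftrightarrow> \<rho> = \<rho>'"
    using hom_inj[OF D E \<mu>] by (cases \<rho>; cases \<rho>') (auto simp: Tr_iff)
qed

lemma hom_nf_trace:
  assumes D: "predilator D" and E: "predilator E" and \<mu>: "\<mu> \<in> pd_hom D E"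
    and \<sigma>: "\<sigma> \<in> pd_carrier D n"
  shows "nf_trace E n (\<mu> n \<sigma>) = Tr_map \<mu> (nf_trace D n \<sigma>)"
proof -
  obtain m f \<tau> where f: "f \<in> fin_emb m n" and \<tau>: "(m, \<tau>) \<in> Tr D" and eq: "\<sigma> = pd_map D m n f \<tau>"
    using normal_form_exists[OF D \<sigma>] .
  have "\<mu> n \<sigma> = pd_map E m n f (\<mu> m \<tau>)" using hom_nat[OF \<mu> f] \<tau> eq by (simp add: Tr_iff)
  moreover have "(m, \<mu> m \<tau>) \<in> Tr E" using Tr_map_mem[OF D E \<mu> \<tau>] by simp
  ultimately show ?thesis using nf_trace_map[OF E f] nf_trace_map[OF D f \<tau>] eq by simp
qed

lemma hom_range_reflect:
  assumes D: "predilator D" and E: "predilator E" and \<mu>: "\<mu> \<in> pd_hom D E"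
    and f: "f \<in> fin_emb n m" and \<sigma>: "\<sigma> \<in> pd_carrier E n"
    and r: "pd_map E n m f \<sigma> \<in> \<mu> m ` pd_carrier D m"
  shows "\<sigma> \<in> \<mu> n ` pd_carrier D n"
proof -
  obtain x where x: "x \<in> pd_carrier D m" "pd_map E n m f \<sigma> = \<mu> m x" using r by auto
  have "pd_supp D m x = f ` pd_supp E n \<sigma>"
    using hom_supp[OF D E \<mu> x(1)] x(2) pd_supp_map[OF E f \<sigma>] by simp
  then have "x \<in> pd_map D n m f ` pd_carrier D n"
    using pd_supp_range[OF D f x(1)] pd_supp_sub[OF E \<sigma>] by blast
  then obtain y where y: "y \<in> pd_carrier D n" "x = pd_map D n m f y" by auto
  have "pd_map E n m f \<sigma> = pd_map E n m f (\<mu> n y)"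
    using x(2) y hom_nat[OF \<mu> f y(1)] by simp
  then have "\<sigma> = \<mu> n y" using pd_map_inj[OF E f \<sigma> hom_mem[OF \<mu> y(1)]] by simp
  then show ?thesis using y(1) by simp
qed

lemma hom_surj:
  assumes D: "predilator D" and E: "predilator E" and \<mu>: "\<mu> \<in> pd_hom D E"
    and r: "Tr E \<subseteq> pd_rng D \<mu>"
  shows "\<mu> n ` pd_carrier D n = pd_carrier E n"
proof
  show "\<mu> n ` pd_carrier D n \<subseteq> pd_carrier E n" using hom_mem[OF \<mu>] by auto
  show "pd_carrier E n \<subseteq> \<mu> n ` pd_carrier D n"
  proof
    fix \<sigma> assume "\<sigma> \<in> pd_carrier E n"
    then obtain m f \<tau> where f: "f \<in> fin_emb m n" and \<tau>: "(m, \<tau>) \<in> Tr E"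
      and eq: "\<sigma> = pd_map E m n f \<tau>"
      using normal_form_exists[OF E] by blast
    obtain \<tau>' where \<tau>': "(m, \<tau>') \<in> Tr D" "\<tau> = \<mu> m \<tau>'"
      using r \<tau> by (auto simp: pd_rng_def)
    then have "\<sigma> = \<mu> n (pd_map D m n f \<tau>')" using hom_nat[OF \<mu> f] eq by (simp add: Tr_iff)
    moreover have "pd_map D m n f \<tau>' \<in> pd_carrier D n"
      using pd_map_mem[OF D f] \<tau>'(1) by (simp add: Tr_iff)
    ultimately show "\<sigma> \<in> \<mu> n ` pd_carrier D n" by simp
  qed
qed

section \<open>Predilators given by sets of trace elements\<close>

lemma sub_carrier_sub: "sub_carrier D A n \<subseteq> pd_carrier D n"
  by (auto simp: sub_carrier_def)

lemma sub_pd_Field: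
  assumes "predilator D"
  shows "pd_carrier (sub_pd D A) n = sub_carrier D A n"
  using Field_Restr_lin[OF pd_lin[OF assms] sub_carrier_sub] by (simp add: sub_pd_def)

lemma sub_pd_ord:
  "(\<sigma>, \<tau>) \<in> pd_ord (sub_pd D A) n \<longleftrightarrow>
    (\<sigma>, \<tau>) \<in> pd_ord D n \<and> \<sigma> \<in> sub_carrier D A n \<and> \<tau> \<in> sub_carrier D A n"
  by (auto simp: sub_pd_def)

lemma sub_pd_map:
  "f \<in> fin_emb n m \<Longrightarrow> \<sigma> \<in> sub_carrier D A n \<Longrightarrow>
    pd_map (sub_pd D A) n m f \<sigma> = pd_map D n m f \<sigma>"
  by (simp add: sub_pd_def)

lemma sub_pd_supp:
  "\<sigma> \<in> sub_carrier D A n \<Longrightarrow> pd_supp (sub_pd D A) n \<sigma> = pd_supp D n \<sigma>"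
  by (simp add: sub_pd_def)

lemma sub_carrier_map_iff:
  assumes "predilator D" "f \<in> fin_emb n m" "\<sigma> \<in> pd_carrier D n"
  shows "pd_map D n m f \<sigma> \<in> sub_carrier D A m \<longleftrightarrow> \<sigma> \<in> sub_carrier D A n"
  using assms pd_map_mem nf_trace_natural by (simp add: sub_carrier_def)

lemma sub_predilator:
  assumes D: "predilator D"
  shows "predilator (sub_pd D A)"
proof -
  have C: "\<sigma> \<in> pd_carrier D n" if "\<sigma> \<in> sub_carrier D A n" for \<sigma> n
    using that sub_carrier_sub by blast
  have M: "pd_map D n m f \<sigma> \<in> sub_carrier D A m"
    if "f \<in> fin_emb n m" "\<sigma> \<in> sub_carrier D A n" for n m f \<sigma>
    using that sub_carrier_map_iff[OF D that(1) C[OF that(2)]] by simp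
  have lin: "Linear_order (pd_ord (sub_pd D A) n)" for n
    using Linear_order_Restr[OF pd_lin[OF D]] by (simp add: sub_pd_def)
  show ?thesis
  proof (rule predilatorI)
    show "pd_map (sub_pd D A) n m \<in> extensional (fin_emb n m)" for n m
      by (simp add: sub_pd_def)
    show "pd_map (sub_pd D A) n m f \<in> lo_emb (pd_ord (sub_pd D A) n) (pd_ord (sub_pd D A) m)"
      if f: "f \<in> fin_emb n m" for n m f
    proof (rule lo_embI[OF lin lin], unfold sub_pd_Field[OF D])
      show "pd_map (sub_pd D A) n m f \<in> extensional (sub_carrier D A n)"
        using f by (simp add: sub_pd_def)
    next
      fix x y assume xy: "(x, y) \<in> pd_ord (sub_pd D A) n"
      then show "(pd_map (sub_pd D A) n m f x, pd_map (sub_pd D A) n m f y)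
          \<in> pd_ord (sub_pd D A) m"
        using M[OF f] C lo_emb_iff[OF pd_map_emb[OF D f]] by (simp add: sub_pd_ord sub_pd_map[OF f])
    next
      fix x y assume "x \<in> sub_carrier D A n" "y \<in> sub_carrier D A n"
        "pd_map (sub_pd D A) n m f x = pd_map (sub_pd D A) n m f y"
      then show "x = y" using C pd_map_inj[OF D f] by (simp add: sub_pd_map[OF f])
    qed
    show "\<sigma> \<in> pd_map (sub_pd D A) n m f ` pd_carrier (sub_pd D A) n"
      if f: "f \<in> fin_emb n m" and s: "\<sigma> \<in> pd_carrier (sub_pd D A) m"
        and i: "pd_supp (sub_pd D A) m \<sigma> \<subseteq> f ` {..<n}" for n m f \<sigma>
    proof -
      have s': "\<sigma> \<in> sub_carrier D A m" using s by (simp add: sub_pd_Field[OF D])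
      obtain \<tau> where \<tau>: "\<tau> \<in> pd_carrier D n" "\<sigma> = pd_map D n m f \<tau>"
        using pd_supp_range[OF D f C[OF s']] i sub_pd_supp[OF s'] by auto
      then have "\<tau> \<in> sub_carrier D A n" using s' sub_carrier_map_iff[OF D f] by simp
      then show ?thesis using \<tau>(2) by (auto simp: sub_pd_Field[OF D] sub_pd_map[OF f])
    qed
  next
    fix n m k f g \<sigma>
    assume f: "f \<in> fin_emb n m" and g: "g \<in> fin_emb m k" and "\<sigma> \<in> pd_carrier (sub_pd D A) n"
    then have \<sigma>: "\<sigma> \<in> sub_carrier D A n" by (simp add: sub_pd_Field[OF D])
    show "pd_map (sub_pd D A) n k (compose {..<n} g f) \<sigma> =
        pd_map (sub_pd D A) m k g (pd_map (sub_pd D A) n m f \<sigma>)"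
      using pd_map_comp[OF D f g C[OF \<sigma>]] M[OF f \<sigma>] \<sigma>
      by (simp add: sub_pd_map[OF f] sub_pd_map[OF g] sub_pd_map[OF fin_emb_compose[OF f g]])
  next
    fix n m f g \<sigma>
    assume f: "f \<in> fin_emb n m" and g: "g \<in> fin_emb n m" and le: "\<And>x. x < n \<Longrightarrow> f x \<le> g x"
      and "\<sigma> \<in> pd_carrier (sub_pd D A) n"
    then have \<sigma>: "\<sigma> \<in> sub_carrier D A n" by (simp add: sub_pd_Field[OF D])
    show "(pd_map (sub_pd D A) n m f \<sigma>, pd_map (sub_pd D A) n m g \<sigma>) \<in> pd_ord (sub_pd D A) m"
      using pd_map_mono[OF D f g le C[OF \<sigma>]] M[OF f \<sigma>] M[OF g \<sigma>] \<sigma>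
      by (simp add: sub_pd_map[OF f] sub_pd_map[OF g] sub_pd_ord)
  qed (use C M lin in \<open>simp_all add: sub_pd_Field[OF D] sub_pd_map sub_pd_supp fin_emb_id
        pd_map_id[OF D] pd_supp_sub[OF D] pd_supp_map[OF D]\<close>, simp add: sub_pd_def)
qed

lemma Tr_sub_pd:
  assumes D: "predilator D"
  shows "Tr (sub_pd D A) = Tr D \<inter> A"
proof -
  have "(n, \<sigma>) \<in> Tr (sub_pd D A) \<longleftrightarrow> (n, \<sigma>) \<in> Tr D \<inter> A" for n \<sigma>
  proof (cases "(n, \<sigma>) \<in> Tr D")
    case True
    then show ?thesis
      using nf_trace_Tr[OF D True] sub_pd_supp[of \<sigma> D A n]
      by (auto simp: Tr_iff sub_pd_Field[OF D] sub_carrier_def)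
  next
    case False
    then show ?thesis
      using sub_carrier_sub[of D A n] sub_pd_supp[of \<sigma> D A n]
      by (auto simp: Tr_iff sub_pd_Field[OF D])
  qed
  then show ?thesis by auto
qed

lemma sub_incl_apply: "\<sigma> \<in> sub_carrier D A n \<Longrightarrow> sub_incl D A n \<sigma> = \<sigma>"
  by (simp add: sub_incl_def)

lemma sub_incl_hom:
  assumes D: "predilator D"
  shows "sub_incl D A \<in> pd_hom (sub_pd D A) D"
proof (rule pd_homI)
  show "sub_incl D A n \<in> lo_emb (pd_ord (sub_pd D A) n) (pd_ord D n)" for n
  proof (rule lo_embI[OF pd_lin[OF sub_predilator[OF D]] pd_lin[OF D]], unfold sub_pd_Field[OF D])
  qed (auto simp: sub_incl_def sub_pd_ord)
  show "sub_incl D A m (pd_map (sub_pd D A) n m f \<sigma>) = pd_map D n m f (sub_incl D A n \<sigma>)"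
    if f: "f \<in> fin_emb n m" and "\<sigma> \<in> pd_carrier (sub_pd D A) n" for n m f \<sigma>
  proof -
    have \<sigma>: "\<sigma> \<in> sub_carrier D A n" using that by (simp add: sub_pd_Field[OF D])
    then have "pd_map D n m f \<sigma> \<in> sub_carrier D A m"
      using sub_carrier_map_iff[OF D f] sub_carrier_sub by blast
    then show ?thesis using \<sigma> by (simp add: sub_pd_map[OF f] sub_incl_apply)
  qed
qed

text \<open>
  Morphisms commute with normal forms, so the values on trace elements decide whether all
  values lie in \<open>E[B]\<close>. Both \<open>\<nu>\<^sup>\<rho>\<close> and the embedding of \<open>D\<close> into \<open>(D + 1)[\<top>]\<close> arise in this way.
\<close>

lemma hom_into_sub:
  assumes D: "predilator D" and E: "predilator E" and \<nu>: "\<nu> \<in> pd_hom D E"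
    and B: "\<And>\<tau>. \<tau> \<in> Tr D \<Longrightarrow> Tr_map \<nu> \<tau> \<in> B"
  shows "\<nu> \<in> pd_hom D (sub_pd E B)"
proof -
  have mem: "\<nu> n \<sigma> \<in> sub_carrier E B n" if "\<sigma> \<in> pd_carrier D n" for n \<sigma>
    using hom_nf_trace[OF D E \<nu> that] hom_mem[OF \<nu> that] B[OF nf_trace_mem[OF D that]]
    by (simp add: sub_carrier_def)
  show ?thesis
  proof (rule pd_homI)
    show "\<nu> n \<in> lo_emb (pd_ord D n) (pd_ord (sub_pd E B) n)" for n
    proof (rule lo_embI[OF pd_lin[OF D] pd_lin[OF sub_predilator[OF E]]])
      fix x y assume xy: "(x, y) \<in> pd_ord D n"
      then have F: "x \<in> pd_carrier D n" "y \<in> pd_carrier D n" by (auto simp: Field_def)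
      show "(\<nu> n x, \<nu> n y) \<in> pd_ord (sub_pd E B) n"
        using xy mem F lo_emb_iff[OF hom_emb[OF \<nu>] F] by (simp add: sub_pd_ord)
    qed (use hom_inj[OF D E \<nu>] hom_ext[OF \<nu>] in simp_all)
    show "\<nu> m (pd_map D n m f \<sigma>) = pd_map (sub_pd E B) n m f (\<nu> n \<sigma>)"
      if "f \<in> fin_emb n m" "\<sigma> \<in> pd_carrier D n" for n m f \<sigma>
      using hom_nat[OF \<nu> that] sub_pd_map[OF that(1) mem[OF that(2)]] by simp
  qed
qed

section \<open>Two orders on the trace\<close>

lemma tr_ll_Tr_map:
  assumes D: "predilator D" and E: "predilator E" and \<nu>: "\<nu> \<in> pd_hom D E"
    and \<sigma>: "\<sigma> \<in> Tr D" and \<tau>: "\<tau> \<in> Tr D"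
  shows "tr_ll E (Tr_map \<nu> \<sigma>) (Tr_map \<nu> \<tau>) \<longleftrightarrow> tr_ll D \<sigma> \<tau>"
proof -
  obtain m s n t where st: "\<sigma> = (m, s)" "\<tau> = (n, t)" by (cases \<sigma>; cases \<tau>)
  have s: "s \<in> pd_carrier D m" "t \<in> pd_carrier D n" using \<sigma> \<tau> by (simp_all add: st Tr_iff)
  have "lo_less (pd_ord E k) (pd_map E m k f (\<nu> m s)) (pd_map E n k g (\<nu> n t)) \<longleftrightarrow>
      lo_less (pd_ord D k) (pd_map D m k f s) (pd_map D n k g t)"
    if "f \<in> fin_emb m k" "g \<in> fin_emb n k" for k f g
    using hom_less[OF D E \<nu> pd_map_mem[OF D that(1) s(1)] pd_map_mem[OF D that(2) s(2)]]
      hom_nat[OF \<nu> that(1) s(1)] hom_nat[OF \<nu> that(2) s(2)] by simp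
  then show ?thesis by (simp add: st tr_ll_def)
qed

text \<open>
  The definition amounts to a comparison in \<open>D(max m n)\<close>, and inclusions of finite orders
  induce embeddings. The freedom in \<open>k\<close> makes it possible to compare three elements at once.
\<close>

lemma tr_less_iff:
  assumes D: "predilator D" and m: "m \<le> k" and n: "n \<le> k"
  shows "tr_less D (m, \<sigma>) (n, \<tau>) \<longleftrightarrow> (m, \<sigma>) \<in> Tr D \<and> (n, \<tau>) \<in> Tr D \<and>
    lo_less (pd_ord D k) (pd_map D m k (\<lambda>x\<in>{..<m}. x) \<sigma>) (pd_map D n k (\<lambda>x\<in>{..<n}. x) \<tau>)"
proof (cases "(m, \<sigma>) \<in> Tr D \<and> (n, \<tau>) \<in> Tr D")
  case True
  let ?l = "max m n"
  have F: "Field natLeq = UNIV" by (auto simp: natLeq_def Field_def)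
  have U: "{..<m} \<union> {..<n} = {..<?l}" by auto
  have l: "(\<lambda>x\<in>{..<?l}. x) \<in> fin_emb ?l k" using m n by (simp add: fin_emb_id)
  have shift: "pd_map D i k (\<lambda>x\<in>{..<i}. x) \<rho>
      = pd_map D ?l k (\<lambda>x\<in>{..<?l}. x) (pd_map D i ?l (\<lambda>x\<in>{..<i}. x) \<rho>)"
    and mem: "pd_map D i ?l (\<lambda>x\<in>{..<i}. x) \<rho> \<in> pd_carrier D ?l"
    if "i \<le> ?l" "(i, \<rho>) \<in> Tr D" for i \<rho>
  proof -
    have i: "(\<lambda>x\<in>{..<i}. x) \<in> fin_emb i ?l" using that by (simp add: fin_emb_id)
    have \<rho>: "\<rho> \<in> pd_carrier D i" using that by (simp add: Tr_iff)
    have "compose {..<i} (\<lambda>x\<in>{..<?l}. x) (\<lambda>x\<in>{..<i}. x) = (\<lambda>x\<in>{..<i}. x)"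
      using that by (auto simp: compose_def fun_eq_iff)
    then show "pd_map D i k (\<lambda>x\<in>{..<i}. x) \<rho>
        = pd_map D ?l k (\<lambda>x\<in>{..<?l}. x) (pd_map D i ?l (\<lambda>x\<in>{..<i}. x) \<rho>)"
      using pd_map_comp[OF D i l \<rho>] by simp
    show "pd_map D i ?l (\<lambda>x\<in>{..<i}. x) \<rho> \<in> pd_carrier D ?l" using pd_map_mem[OF D i \<rho>] .
  qed
  have "tr_less D (m, \<sigma>) (n, \<tau>) \<longleftrightarrow>
      lo_less (pd_ord D ?l) (pd_map D m ?l (\<lambda>x\<in>{..<m}. x) \<sigma>) (pd_map D n ?l (\<lambda>x\<in>{..<n}. x) \<tau>)"
    using True by (simp add: tr_less_def ext_less_def ext_carrier_def Fpow_def F U lo_abs_segment)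
  also have "\<dots> \<longleftrightarrow>
      lo_less (pd_ord D k) (pd_map D m k (\<lambda>x\<in>{..<m}. x) \<sigma>) (pd_map D n k (\<lambda>x\<in>{..<n}. x) \<tau>)"
    using True shift[of m \<sigma>] shift[of n \<tau>] pd_map_less[OF D l mem mem, of m \<sigma> n \<tau>] by simp
  finally show ?thesis using True by simp
next
  case False
  then show ?thesis by (auto simp: tr_less_def ext_less_def ext_carrier_def)
qed

lemma tr_less_irrefl:
  assumes D: "predilator D"
  shows "\<not> tr_less D \<rho> \<rho>"
  by (cases \<rho>) (simp add: tr_less_iff[OF D order_refl order_refl] lo_less_def)

lemma tr_less_trans:
  assumes D: "predilator D" and "tr_less D \<rho> \<rho>'" "tr_less D \<rho>' \<rho>''"
  shows "tr_less D \<rho> \<rho>''"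
proof -
  obtain l r m s n t where e: "\<rho> = (l, r)" "\<rho>' = (m, s)" "\<rho>'' = (n, t)"
    by (cases \<rho>; cases \<rho>'; cases \<rho>'')
  let ?k = "max l (max m n)"
  have k: "l \<le> ?k" "m \<le> ?k" "n \<le> ?k" by auto
  show ?thesis
    using assms(2,3) lo_less_trans[OF pd_lin[OF D]] unfolding e
    by (auto simp only: tr_less_iff[OF D k(1,2)] tr_less_iff[OF D k(2,3)] tr_less_iff[OF D k(1,3)])
qed

lemma tr_less_total:
  assumes D: "predilator D" and "\<rho> \<in> Tr D" "\<rho>' \<in> Tr D"
  shows "tr_less D \<rho> \<rho>' \<or> \<rho> = \<rho>' \<or> tr_less D \<rho>' \<rho>"
proof -
  obtain m s n t where e: "\<rho> = (m, s)" "\<rho>' = (n, t)" by (cases \<rho>; cases \<rho>')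
  let ?k = "max m n"
  let ?s = "pd_map D m ?k (\<lambda>x\<in>{..<m}. x) s" and ?t = "pd_map D n ?k (\<lambda>x\<in>{..<n}. x) t"
  have i: "(\<lambda>x\<in>{..<m}. x) \<in> fin_emb m ?k" and j: "(\<lambda>x\<in>{..<n}. x) \<in> fin_emb n ?k"
    by (simp_all add: fin_emb_id)
  have st: "s \<in> pd_carrier D m" "pd_supp D m s = {..<m}"
    "t \<in> pd_carrier D n" "pd_supp D n t = {..<n}" using assms by (simp_all add: e Tr_iff)
  consider "lo_less (pd_ord D ?k) ?s ?t" | "?s = ?t" | "lo_less (pd_ord D ?k) ?t ?s"
    using lo_less_total[OF pd_lin[OF D] pd_map_mem[OF D i st(1)] pd_map_mem[OF D j st(3)]] by blast
  then show ?thesis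
  proof cases
    case 2
    (* elements with the same value have the same support, which is the arity in both cases *)
    have "{..<m} = {..<n}"
      using pd_supp_map[OF D i st(1)] pd_supp_map[OF D j st(3)] st 2 by simp
    then have "m = n" by simp
    with 2 have "s = t" using pd_map_id[OF D] st by simp
    with \<open>m = n\<close> show ?thesis by (simp add: e)
  qed (use assms in \<open>simp_all add: e tr_less_iff[OF D, where k = ?k]\<close>)
qed

lemma tr_less_Tr_map:
  assumes D: "predilator D" and E: "predilator E" and \<nu>: "\<nu> \<in> pd_hom D E"
    and \<rho>: "\<rho> \<in> Tr D" and \<rho>': "\<rho>' \<in> Tr D"
  shows "tr_less E (Tr_map \<nu> \<rho>) (Tr_map \<nu> \<rho>') \<longleftrightarrow> tr_less D \<rho> \<rho>'"
proof -
  obtain m s n t where e: "\<rho> = (m, s)" "\<rho>' = (n, t)" by (cases \<rho>; cases \<rho>')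
  let ?k = "max m n"
  have i: "(\<lambda>x\<in>{..<m}. x) \<in> fin_emb m ?k" and j: "(\<lambda>x\<in>{..<n}. x) \<in> fin_emb n ?k"
    by (simp_all add: fin_emb_id)
  have st: "s \<in> pd_carrier D m" "t \<in> pd_carrier D n" using assms by (simp_all add: e Tr_iff)
  show ?thesis
    using \<rho> \<rho>' Tr_map_mem[OF D E \<nu> \<rho>] Tr_map_mem[OF D E \<nu> \<rho>']
      hom_less[OF D E \<nu> pd_map_mem[OF D i st(1)] pd_map_mem[OF D j st(2)]]
      hom_nat[OF \<nu> i st(1)] hom_nat[OF \<nu> j st(2)]
    by (simp add: e tr_less_iff[OF D max.cobounded1 max.cobounded2]
        tr_less_iff[OF E max.cobounded1 max.cobounded2])
qed

section \<open>The predilators below a trace element\<close>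

lemma
  assumes D: "predilator D"
  shows below_predilator: "predilator (pd_below D \<rho>)"
    and Tr_below: "Tr (pd_below D \<rho>) = below D \<rho>"
    and incl_below_hom: "incl_below D \<rho> \<in> pd_hom (pd_below D \<rho>) D"
    and incl_below_apply: "\<sigma> \<in> pd_carrier (pd_below D \<rho>) n \<Longrightarrow> incl_below D \<rho> n \<sigma> = \<sigma>"
    and below_carrier: "\<sigma> \<in> pd_carrier (pd_below D \<rho>) n \<Longrightarrow> \<sigma> \<in> pd_carrier D n"
  using sub_carrier_sub[of D "below D \<rho>" n]
  by (auto simp: pd_below_def incl_below_def sub_predilator[OF D] Tr_sub_pd[OF D] below_def
      sub_incl_hom[OF D] sub_pd_Field[OF D] sub_incl_apply)

text \<open>
  As \<open>\<iota>[E,Tr(\<nu>)(\<rho>)]\<close> does not change values, the defining equation forces \<open>\<nu>\<^sup>\<rho>\<close> to be the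
  restriction of \<open>\<nu>\<close>. The latter has values in \<open>E[Tr(\<nu>)(\<rho>)]\<close> since \<open>\<nu>\<close> preserves \<open>\<lless>\<close>.
\<close>

lemma
  assumes D: "predilator D" and E: "predilator E" and \<nu>: "\<nu> \<in> pd_hom D E" and \<rho>: "\<rho> \<in> Tr D"
  shows mor_below_hom: "mor_below D E \<nu> \<rho> \<in> pd_hom (pd_below D \<rho>) (pd_below E (Tr_map \<nu> \<rho>))"
    and mor_below_apply: "\<sigma> \<in> pd_carrier (pd_below D \<rho>) n \<Longrightarrow> mor_below D E \<nu> \<rho> n \<sigma> = \<nu> n \<sigma>"
proof -
  let ?D = "pd_below D \<rho>" and ?E = "pd_below E (Tr_map \<nu> \<rho>)"
  let ?\<nu> = "pd_comp ?D \<nu> (incl_below D \<rho>)"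
  have pD: "predilator ?D" by (rule below_predilator[OF D])
  have app: "?\<nu> n \<sigma> = \<nu> n \<sigma>" if "\<sigma> \<in> pd_carrier ?D n" for n \<sigma>
    using that by (simp add: pd_comp_apply incl_below_apply[OF D])
  have hE: "?\<nu> \<in> pd_hom ?D E" by (rule hom_comp[OF incl_below_hom[OF D] \<nu> pD])
  have h: "?\<nu> \<in> pd_hom ?D ?E"
    unfolding pd_below_def[of E]
  proof (rule hom_into_sub[OF pD E hE])
    fix \<tau> assume \<tau>: "\<tau> \<in> Tr ?D"
    then have "Tr_map ?\<nu> \<tau> = Tr_map \<nu> \<tau>" by (cases \<tau>) (simp add: app Tr_iff)
    moreover have "\<tau> \<in> Tr D" "tr_ll D \<tau> \<rho>" using \<tau> by (simp_all add: Tr_below[OF D] below_def)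
    ultimately show "Tr_map ?\<nu> \<tau> \<in> below E (Tr_map \<nu> \<rho>)"
      using tr_ll_Tr_map[OF D E \<nu> _ \<rho>] Tr_map_mem[OF D E \<nu>] by (simp add: below_def)
  qed
  have comp: "pd_comp ?D (incl_below E (Tr_map \<nu> \<rho>)) \<mu> = \<mu>" if "\<mu> \<in> pd_hom ?D ?E" for \<mu>
    by (rule hom_eqI[OF hom_comp[OF that incl_below_hom[OF E] pD] that])
      (simp add: pd_comp_apply incl_below_apply[OF E] hom_mem[OF that])
  have eq: "mor_below D E \<nu> \<rho> = ?\<nu>"
    unfolding mor_below_def
  proof (rule the_equality)
    fix \<mu> assume \<mu>: "\<mu> \<in> pd_hom ?D ?E \<and> pd_comp ?D (incl_below E (Tr_map \<nu> \<rho>)) \<mu> = ?\<nu>"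
    then show "\<mu> = ?\<nu>" using comp[of \<mu>] by simp
  qed (use h comp[OF h] in simp)
  show "mor_below D E \<nu> \<rho> \<in> pd_hom ?D ?E" using h eq by simp
  show "\<sigma> \<in> pd_carrier ?D n \<Longrightarrow> mor_below D E \<nu> \<rho> n \<sigma> = \<nu> n \<sigma>" using app eq by simp
qed

section \<open>Adding a new maximum\<close>

lemma to_nat_eq [simp]: "(to_nat x = to_nat y) = (x = y)"
  by (simp add: inj_eq)

lemma lo_plus1_simps [simp]:
  "(opt_code (Some x), opt_code (Some y)) \<in> lo_plus1 X \<longleftrightarrow> (x, y) \<in> X"
  "(opt_code (Some x), opt_code None) \<in> lo_plus1 X \<longleftrightarrow> x \<in> Field X"
  "(opt_code None, opt_code (Some y)) \<in> lo_plus1 X \<longleftrightarrow> False"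
  "(opt_code None, opt_code None) \<in> lo_plus1 X"
  by (auto simp: lo_plus1_def)

lemma Field_lo_plus1: "Field (lo_plus1 X) = opt_code ` insert None (Some ` Field X)"
proof
  show "Field (lo_plus1 X) \<subseteq> opt_code ` insert None (Some ` Field X)"
    by (auto simp: lo_plus1_def Field_def)
  have "opt_code (Some x) \<in> Field (lo_plus1 X)" if "x \<in> Field X" for x
    using that by (intro FieldI1[of _ "opt_code None"]) simp
  moreover have "opt_code None \<in> Field (lo_plus1 X)"
    by (intro FieldI1[of _ "opt_code None"]) simp
  ultimately show "opt_code ` insert None (Some ` Field X) \<subseteq> Field (lo_plus1 X)" by auto
qed

lemma Field_lo_plus1_iff [simp]:
  "opt_code None \<in> Field (lo_plus1 X)"
  "opt_code (Some x) \<in> Field (lo_plus1 X) \<longleftrightarrow> x \<in> Field X"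
  by (auto simp: Field_lo_plus1)

lemma Field_lo_plus1E:
  assumes "s \<in> Field (lo_plus1 X)"
  obtains "s = opt_code None" | x where "s = opt_code (Some x)" "x \<in> Field X"
  using assms by (auto simp: Field_lo_plus1)

lemma lo_plus1_lin:
  assumes X: "Linear_order X"
  shows "Linear_order (lo_plus1 X)"
proof (rule Linear_orderI)
  fix s t u
  show "s \<in> Field (lo_plus1 X) \<Longrightarrow> (s, s) \<in> lo_plus1 X"
    using lin_refl[OF X] by (auto elim!: Field_lo_plus1E)
  show "(s, t) \<in> lo_plus1 X \<Longrightarrow> (t, s) \<in> lo_plus1 X \<Longrightarrow> s = t"
    using lin_antisym[OF X] by (auto simp: lo_plus1_def)
  show "s \<in> Field (lo_plus1 X) \<Longrightarrow> t \<in> Field (lo_plus1 X) \<Longrightarrow> s \<noteq> t \<Longrightarrow>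
      (s, t) \<in> lo_plus1 X \<or> (t, s) \<in> lo_plus1 X"
    by (elim Field_lo_plus1E) (use lin_total[OF X] in simp_all)
  show "(s, t) \<in> lo_plus1 X \<Longrightarrow> (t, u) \<in> lo_plus1 X \<Longrightarrow> (s, u) \<in> lo_plus1 X"
    using lin_trans[OF X] by (auto simp: lo_plus1_def intro: FieldI1)
qed

lemma top_ext_simps [simp]:
  "top_ext A f t (opt_code None) = t"
  "x \<in> A \<Longrightarrow> top_ext A f t (opt_code (Some x)) = f x"
  by (auto simp: top_ext_def)

lemma map_plus1_simps [simp]:
  "map_plus1 A f (opt_code None) = opt_code None"
  "x \<in> A \<Longrightarrow> map_plus1 A f (opt_code (Some x)) = opt_code (Some (f x))"
  by (simp_all add: map_plus1_def)

lemma map_plus1_emb: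
  assumes X: "Linear_order X" and Y: "Linear_order Y" and f: "f \<in> lo_emb X Y"
  shows "map_plus1 (Field X) f \<in> lo_emb (lo_plus1 X) (lo_plus1 Y)"
proof (rule lo_embI[OF lo_plus1_lin[OF X] lo_plus1_lin[OF Y]])
  show "map_plus1 (Field X) f \<in> extensional (Field (lo_plus1 X))"
    by (simp add: Field_lo_plus1 map_plus1_def top_ext_def)
  fix s t
  show "(map_plus1 (Field X) f s, map_plus1 (Field X) f t) \<in> lo_plus1 Y" if "(s, t) \<in> lo_plus1 X"
    using FieldI1[OF that] FieldI2[OF that] that lo_emb_iff[OF f] lo_emb_mem[OF f]
    by (auto elim!: Field_lo_plus1E)
  show "s = t" if "s \<in> Field (lo_plus1 X)" "t \<in> Field (lo_plus1 X)"
    "map_plus1 (Field X) f s = map_plus1 (Field X) f t"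
    using that lo_emb_inj[OF f X Y] by (auto elim!: Field_lo_plus1E)
qed

lemma pd_plus1_ord [simp]: "pd_ord (pd_plus1 D) n = lo_plus1 (pd_ord D n)"
  by (simp add: pd_plus1_def)

lemma pd_plus1_map [simp]:
  "f \<in> fin_emb n m \<Longrightarrow> pd_map (pd_plus1 D) n m f = map_plus1 (pd_carrier D n) (pd_map D n m f)"
  by (simp add: pd_plus1_def)

lemma pd_plus1_supp [simp]: "pd_supp (pd_plus1 D) n = top_ext (pd_carrier D n) (pd_supp D n) {}"
  by (simp add: pd_plus1_def)

lemma plus1_predilator:
  assumes D: "predilator D"
  shows "predilator (pd_plus1 D)"
proof (rule predilatorI)
  show "pd_map (pd_plus1 D) n m \<in> extensional (fin_emb n m)" for n m
    by (simp add: pd_plus1_def)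
  show "pd_supp (pd_plus1 D) n \<in> extensional (pd_carrier (pd_plus1 D) n)" for n
    by (simp add: Field_lo_plus1 top_ext_def)
  show "Linear_order (pd_ord (pd_plus1 D) n)" for n
    using lo_plus1_lin[OF pd_lin[OF D]] by simp
  show "pd_map (pd_plus1 D) n m f \<in> lo_emb (pd_ord (pd_plus1 D) n) (pd_ord (pd_plus1 D) m)"
    if "f \<in> fin_emb n m" for n m f
    using map_plus1_emb[OF pd_lin[OF D] pd_lin[OF D] pd_map_emb[OF D that]] that by simp
  show "pd_map (pd_plus1 D) n n (\<lambda>x\<in>{..<n}. x) \<sigma> = \<sigma>"
    if "\<sigma> \<in> pd_carrier (pd_plus1 D) n" for n \<sigma>
    using that by (auto elim!: Field_lo_plus1E simp: fin_emb_id pd_map_id[OF D])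
  show "pd_map (pd_plus1 D) n k (compose {..<n} g f) \<sigma>
      = pd_map (pd_plus1 D) m k g (pd_map (pd_plus1 D) n m f \<sigma>)"
    if "f \<in> fin_emb n m" "g \<in> fin_emb m k" "\<sigma> \<in> pd_carrier (pd_plus1 D) n" for n m k f g \<sigma>
    using that fin_emb_compose[OF that(1,2)]
    by (auto elim!: Field_lo_plus1E simp: pd_map_mem[OF D] pd_map_comp[OF D])
  show "(pd_map (pd_plus1 D) n m f \<sigma>, pd_map (pd_plus1 D) n m g \<sigma>) \<in> pd_ord (pd_plus1 D) m"
    if "f \<in> fin_emb n m" "g \<in> fin_emb n m" "\<And>x. x < n \<Longrightarrow> f x \<le> g x"
      "\<sigma> \<in> pd_carrier (pd_plus1 D) n" for n m f g \<sigma>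
    using that pd_map_mono[OF D that(1,2,3)] by (auto elim!: Field_lo_plus1E)
  show "pd_supp (pd_plus1 D) n \<sigma> \<subseteq> {..<n}" if "\<sigma> \<in> pd_carrier (pd_plus1 D) n" for n \<sigma>
    using that pd_supp_sub[OF D] by (fastforce elim!: Field_lo_plus1E)
  show "pd_supp (pd_plus1 D) m (pd_map (pd_plus1 D) n m f \<sigma>) = f ` pd_supp (pd_plus1 D) n \<sigma>"
    if "f \<in> fin_emb n m" "\<sigma> \<in> pd_carrier (pd_plus1 D) n" for n m f \<sigma>
    using that by (auto elim!: Field_lo_plus1E simp: pd_supp_map[OF D] pd_map_mem[OF D])
  show "\<sigma> \<in> pd_map (pd_plus1 D) n m f ` pd_carrier (pd_plus1 D) n"
    if f: "f \<in> fin_emb n m" and \<sigma>: "\<sigma> \<in> pd_carrier (pd_plus1 D) m"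
      and sub: "pd_supp (pd_plus1 D) m \<sigma> \<subseteq> f ` {..<n}" for n m f \<sigma>
  proof (cases rule: Field_lo_plus1E[OF \<sigma>[unfolded pd_plus1_ord]])
    case 1
    then show ?thesis using f by (intro image_eqI[of _ _ "opt_code None"]) simp_all
  next
    case (2 x)
    then obtain y where "y \<in> pd_carrier D n" "x = pd_map D n m f y"
      using pd_supp_range[OF D f, of x] sub by auto
    then show ?thesis using f 2 by (intro image_eqI[of _ _ "opt_code (Some y)"]) simp_all
  qed
qed

lemma mor_plus1_simps [simp]:
  "mor_plus1 D \<mu> n (opt_code None) = opt_code None"
  "\<sigma> \<in> pd_carrier D n \<Longrightarrow> mor_plus1 D \<mu> n (opt_code (Some \<sigma>)) = opt_code (Some (\<mu> n \<sigma>))"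
  by (simp_all add: mor_plus1_def)

lemma mor_plus1_hom:
  assumes D: "predilator D" and E: "predilator E" and \<mu>: "\<mu> \<in> pd_hom D E"
  shows "mor_plus1 D \<mu> \<in> pd_hom (pd_plus1 D) (pd_plus1 E)"
proof (rule pd_homI)
  show "mor_plus1 D \<mu> n \<in> lo_emb (pd_ord (pd_plus1 D) n) (pd_ord (pd_plus1 E) n)" for n
    using map_plus1_emb[OF pd_lin[OF D] pd_lin[OF E] hom_emb[OF \<mu>]] by (simp add: mor_plus1_def)
  show "mor_plus1 D \<mu> m (pd_map (pd_plus1 D) n m f \<sigma>)
      = pd_map (pd_plus1 E) n m f (mor_plus1 D \<mu> n \<sigma>)"
    if "f \<in> fin_emb n m" "\<sigma> \<in> pd_carrier (pd_plus1 D) n" for n m f \<sigma>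
    using that by (auto elim!: Field_lo_plus1E
        simp: hom_mem[OF \<mu>] pd_map_mem[OF D] hom_nat[OF \<mu>])
qed

definition plus1_incl :: "predilator_data \<Rightarrow> pd_mor" where
  "plus1_incl D = (\<lambda>n. \<lambda>\<sigma>\<in>pd_carrier D n. opt_code (Some \<sigma>))"

lemma plus1_incl_apply [simp]: "\<sigma> \<in> pd_carrier D n \<Longrightarrow> plus1_incl D n \<sigma> = opt_code (Some \<sigma>)"
  by (simp add: plus1_incl_def)

lemma plus1_incl_hom:
  assumes D: "predilator D"
  shows "plus1_incl D \<in> pd_hom D (pd_plus1 D)"
proof (rule pd_homI)
  show "plus1_incl D n \<in> lo_emb (pd_ord D n) (pd_ord (pd_plus1 D) n)" for n
  proof (rule lo_embI[OF pd_lin[OF D] pd_lin[OF plus1_predilator[OF D]]])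
    fix x y assume "(x, y) \<in> pd_ord D n"
    moreover from this have "x \<in> pd_carrier D n" "y \<in> pd_carrier D n"
      by (rule FieldI1, rule FieldI2)
    ultimately show "(plus1_incl D n x, plus1_incl D n y) \<in> pd_ord (pd_plus1 D) n" by simp
  qed (simp_all add: plus1_incl_def)
  show "plus1_incl D m (pd_map D n m f \<sigma>) = pd_map (pd_plus1 D) n m f (plus1_incl D n \<sigma>)"
    if "f \<in> fin_emb n m" "\<sigma> \<in> pd_carrier D n" for n m f \<sigma>
    using that by (simp add: pd_map_mem[OF D])
qed

lemma Tr_plus1_simps [simp]:
  "(n, opt_code None) \<in> Tr (pd_plus1 D) \<longleftrightarrow> n = 0"
  "(n, opt_code (Some \<sigma>)) \<in> Tr (pd_plus1 D) \<longleftrightarrow> (n, \<sigma>) \<in> Tr D"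
proof -
  have "({} = {..<n}) = (n = 0)" by (metis lessThan_0 lessThan_eq_iff)
  then show "(n, opt_code None) \<in> Tr (pd_plus1 D) \<longleftrightarrow> n = 0" by (simp add: Tr_iff)
  show "(n, opt_code (Some \<sigma>)) \<in> Tr (pd_plus1 D) \<longleftrightarrow> (n, \<sigma>) \<in> Tr D"
    by (cases "\<sigma> \<in> pd_carrier D n") (simp_all add: Tr_iff)
qed

section \<open>Preptykes\<close>

lemma
  assumes P: "preptyx P" and D: "predilator D"
  shows px_predilator: "predilator (px_ob P D)"
    and px_hom: "predilator E \<Longrightarrow> \<mu> \<in> pd_hom D E \<Longrightarrow>
      px_map P D E \<mu> \<in> pd_hom (px_ob P D) (px_ob P E)"
    and px_id: "px_map P D D (pd_id D) = pd_id (px_ob P D)"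
    and px_comp: "predilator E \<Longrightarrow> predilator F \<Longrightarrow> \<mu> \<in> pd_hom D E \<Longrightarrow> \<nu> \<in> pd_hom E F \<Longrightarrow>
      px_map P D F (pd_comp D \<nu> \<mu>) = pd_comp (px_ob P D) (px_map P E F \<nu>) (px_map P D E \<mu>)"
    and px_supp_mem: "\<sigma> \<in> Tr (px_ob P D) \<Longrightarrow> px_supp P D \<sigma> \<in> Fpow (Tr D)"
    and px_supp_nat: "predilator E \<Longrightarrow> \<mu> \<in> pd_hom D E \<Longrightarrow> \<sigma> \<in> Tr (px_ob P D) \<Longrightarrow>
      px_supp P E (Tr_map (px_map P D E \<mu>) \<sigma>) = Tr_map \<mu> ` px_supp P D \<sigma>"
    and px_supp_range: "predilator E \<Longrightarrow> \<mu> \<in> pd_hom D E \<Longrightarrow> \<tau> \<in> Tr (px_ob P E) \<Longrightarrow>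
      px_supp P E \<tau> \<subseteq> pd_rng D \<mu> \<Longrightarrow> \<tau> \<in> pd_rng (px_ob P D) (px_map P D E \<mu>)"
proof -
  note ax1 = P[unfolded preptyx_def]
  note ax2 = ax1[THEN conjunct2] note ax3 = ax2[THEN conjunct2]
  note ax4 = ax3[THEN conjunct2] note ax5 = ax4[THEN conjunct2]
  note ax6 = ax5[THEN conjunct2]
  show "predilator (px_ob P D)" using ax1[THEN conjunct1] D by simp
  show "predilator E \<Longrightarrow> \<mu> \<in> pd_hom D E \<Longrightarrow> px_map P D E \<mu> \<in> pd_hom (px_ob P D) (px_ob P E)"
    using ax2[THEN conjunct1] D by simp
  show "px_map P D D (pd_id D) = pd_id (px_ob P D)" using ax3[THEN conjunct1] D by simp
  show "predilator E \<Longrightarrow> predilator F \<Longrightarrow> \<mu> \<in> pd_hom D E \<Longrightarrow> \<nu> \<in> pd_hom E F \<Longrightarrow>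
      px_map P D F (pd_comp D \<nu> \<mu>) = pd_comp (px_ob P D) (px_map P E F \<nu>) (px_map P D E \<mu>)"
    using ax4[THEN conjunct1] D by blast
  show "\<sigma> \<in> Tr (px_ob P D) \<Longrightarrow> px_supp P D \<sigma> \<in> Fpow (Tr D)"
    using ax5[THEN conjunct1] D by blast
  show "predilator E \<Longrightarrow> \<mu> \<in> pd_hom D E \<Longrightarrow> \<sigma> \<in> Tr (px_ob P D) \<Longrightarrow>
      px_supp P E (Tr_map (px_map P D E \<mu>) \<sigma>) = Tr_map \<mu> ` px_supp P D \<sigma>"
    using ax6[THEN conjunct1] D by blast
  show "predilator E \<Longrightarrow> \<mu> \<in> pd_hom D E \<Longrightarrow> \<tau> \<in> Tr (px_ob P E) \<Longrightarrow>
      px_supp P E \<tau> \<subseteq> pd_rng D \<mu> \<Longrightarrow> \<tau> \<in> pd_rng (px_ob P D) (px_map P D E \<mu>)"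
    using ax6[THEN conjunct2] D by blast
qed

lemma px_supp_sub:
  "preptyx P \<Longrightarrow> predilator D \<Longrightarrow> \<sigma> \<in> Tr (px_ob P D) \<Longrightarrow> px_supp P D \<sigma> \<subseteq> Tr D"
  using px_supp_mem by (auto simp: Fpow_def)

lemma preptyxI:
  assumes "\<And>D. predilator D \<Longrightarrow> predilator (px_ob P D)"
    and "\<And>D E \<mu>. predilator D \<Longrightarrow> predilator E \<Longrightarrow> \<mu> \<in> pd_hom D E \<Longrightarrow>
      px_map P D E \<mu> \<in> pd_hom (px_ob P D) (px_ob P E)"
    and "\<And>D. predilator D \<Longrightarrow> px_map P D D (pd_id D) = pd_id (px_ob P D)"
    and "\<And>D E F \<mu> \<nu>. predilator D \<Longrightarrow> predilator E \<Longrightarrow> predilator F \<Longrightarrow>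
      \<mu> \<in> pd_hom D E \<Longrightarrow> \<nu> \<in> pd_hom E F \<Longrightarrow>
      px_map P D F (pd_comp D \<nu> \<mu>) = pd_comp (px_ob P D) (px_map P E F \<nu>) (px_map P D E \<mu>)"
    and "\<And>D \<sigma>. predilator D \<Longrightarrow> \<sigma> \<in> Tr (px_ob P D) \<Longrightarrow> px_supp P D \<sigma> \<in> Fpow (Tr D)"
    and "\<And>D E \<mu> \<sigma>. predilator D \<Longrightarrow> predilator E \<Longrightarrow> \<mu> \<in> pd_hom D E \<Longrightarrow>
      \<sigma> \<in> Tr (px_ob P D) \<Longrightarrow>
      px_supp P E (Tr_map (px_map P D E \<mu>) \<sigma>) = Tr_map \<mu> ` px_supp P D \<sigma>"
    and "\<And>D E \<mu> \<tau>. predilator D \<Longrightarrow> predilator E \<Longrightarrow> \<mu> \<in> pd_hom D E \<Longrightarrow>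
      \<tau> \<in> Tr (px_ob P E) \<Longrightarrow> px_supp P E \<tau> \<subseteq> pd_rng D \<mu> \<Longrightarrow>
      \<tau> \<in> pd_rng (px_ob P D) (px_map P D E \<mu>)"
  shows "preptyx P"
proof -
  have range: "{\<sigma> \<in> Tr (px_ob P E). px_supp P E \<sigma> \<subseteq> pd_rng D \<mu>}
      \<subseteq> pd_rng (px_ob P D) (px_map P D E \<mu>)"
    if "predilator D" "predilator E" "\<mu> \<in> pd_hom D E" for D E \<mu>
    using assms(7)[OF that] by auto
  show ?thesis
    unfolding preptyx_def
    by (intro conjI allI ballI impI; rule assms(1-6) range; assumption)
qed

text \<open>
  If all trace elements of \<open>E\<close> are in the range of \<open>\<mu>\<close>, then so are all supports, and the range
  condition of the preptyx applies to each trace element of \<open>P(E)\<close>.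
\<close>

lemma px_map_surj:
  assumes P: "preptyx P" and D: "predilator D" and E: "predilator E" and \<mu>: "\<mu> \<in> pd_hom D E"
    and r: "Tr E \<subseteq> pd_rng D \<mu>"
  shows "px_map P D E \<mu> n ` pd_carrier (px_ob P D) n = pd_carrier (px_ob P E) n"
proof (rule hom_surj[OF px_predilator[OF P D] px_predilator[OF P E] px_hom[OF P D E \<mu>]])
  show "Tr (px_ob P E) \<subseteq> pd_rng (px_ob P D) (px_map P D E \<mu>)"
    using px_supp_range[OF P D E \<mu>] px_supp_sub[OF P E] r by blast
qed

lemma pd_id_apply: "\<sigma> \<in> pd_carrier D n \<Longrightarrow> pd_id D n \<sigma> = \<sigma>"
  by (simp add: pd_id_def)

lemma Tr_map_id: "\<rho> \<in> Tr D \<Longrightarrow> Tr_map (pd_id D) \<rho> = \<rho>"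
  by (cases \<rho>) (simp add: Tr_iff pd_id_apply)

lemma Tr_map_comp: "\<rho> \<in> Tr D \<Longrightarrow> Tr_map (pd_comp D \<nu> \<mu>) \<rho> = Tr_map \<nu> (Tr_map \<mu> \<rho>)"
  by (cases \<rho>) (simp add: Tr_iff pd_comp_apply)

lemma Tr_map_cong:
  assumes "\<rho> \<in> Tr D" "\<And>n \<sigma>. \<sigma> \<in> pd_carrier D n \<Longrightarrow> \<mu> n \<sigma> = \<nu> n \<sigma>"
  shows "Tr_map \<mu> \<rho> = Tr_map \<nu> \<rho>"
  using assms by (cases \<rho>) (simp add: Tr_iff)

section \<open>The predilators \<open>P\<^sup>*(D)\<close>\<close>

lemma star_carrier_iff [simp]:
  "pair_code (\<rho>, s) \<in> star_carrier P D n \<longleftrightarrow>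
    \<rho> \<in> Tr D \<and> s \<in> pd_carrier (star_fibre P D \<rho>) n"
  unfolding star_carrier_def mem_Collect_eq to_nat_eq prod.inject by blast

lemma star_carrierE:
  assumes "x \<in> star_carrier P D n"
  obtains \<rho> s where "x = pair_code (\<rho>, s)" "\<rho> \<in> Tr D" "s \<in> pd_carrier (star_fibre P D \<rho>) n"
  using assms unfolding star_carrier_def mem_Collect_eq by blast

lemma star_ord_iff:
  "(pair_code (\<rho>, s), pair_code (\<rho>', s')) \<in> pd_ord (star_ob P D) n \<longleftrightarrow>
    pair_code (\<rho>, s) \<in> star_carrier P D n \<and> pair_code (\<rho>', s') \<in> star_carrier P D n \<and>
    (tr_less D \<rho> \<rho>' \<or> \<rho> = \<rho>' \<and> (s, s') \<in> pd_ord (star_fibre P D \<rho>) n)"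
  by (simp add: star_ob_def del: star_carrier_iff)

lemma star_ord_sub: "pd_ord (star_ob P D) n \<subseteq> star_carrier P D n \<times> star_carrier P D n"
  by (auto simp: star_ob_def)

lemma star_pd_map:
  "f \<in> fin_emb n m \<Longrightarrow> pair_code (\<rho>, s) \<in> star_carrier P D n \<Longrightarrow>
    pd_map (star_ob P D) n m f (pair_code (\<rho>, s))
      = pair_code (\<rho>, pd_map (star_fibre P D \<rho>) n m f s)"
  by (simp add: star_ob_def del: star_carrier_iff)

lemma star_pd_supp:
  "pair_code (\<rho>, s) \<in> star_carrier P D n \<Longrightarrow>
    pd_supp (star_ob P D) n (pair_code (\<rho>, s)) = pd_supp (star_fibre P D \<rho>) n s"
  by (simp add: star_ob_def del: star_carrier_iff)

lemma star_fibre_predilator: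
  assumes "preptyx P" "predilator D"
  shows "predilator (star_fibre P D \<rho>)"
  unfolding star_fibre_def
  by (intro plus1_predilator px_predilator[OF assms(1)] below_predilator assms(2))

lemma
  assumes P: "preptyx P" and D: "predilator D"
  shows star_lin: "Linear_order (pd_ord (star_ob P D) n)"
    and star_Field: "pd_carrier (star_ob P D) n = star_carrier P D n"
proof -
  note F = star_fibre_predilator[OF P D]
  let ?r = "pd_ord (star_ob P D) n"
  have refl: "(x, x) \<in> ?r" if "x \<in> star_carrier P D n" for x
    using that lin_refl[OF pd_lin[OF F]] by (elim star_carrierE) (simp add: star_ord_iff)
  show Field: "Field ?r = star_carrier P D n"
  proof
    show "Field ?r \<subseteq> star_carrier P D n"
      using star_ord_sub[of P D n] by (auto simp: Field_def)
    show "star_carrier P D n \<subseteq> Field ?r" using refl by (blast intro: FieldI1)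
  qed
  show "Linear_order ?r"
  proof (rule Linear_orderI, unfold Field)
    show "(x, x) \<in> ?r" if "x \<in> star_carrier P D n" for x using refl that .
  next
    fix x y z assume xy: "(x, y) \<in> ?r" and yz: "(y, z) \<in> ?r"
    have C: "x \<in> star_carrier P D n" "y \<in> star_carrier P D n" "z \<in> star_carrier P D n"
      using xy yz star_ord_sub[of P D n] by auto
    obtain \<rho> s \<rho>' s' \<rho>'' s'' where
      e: "x = pair_code (\<rho>, s)" "y = pair_code (\<rho>', s')" "z = pair_code (\<rho>'', s'')"
      using C by (elim star_carrierE)
    show "(x, z) \<in> ?r"
      using xy yz tr_less_trans[OF D] lin_trans[OF pd_lin[OF F]] unfolding e star_ord_iff by blast
  next
    fix x y assume xy: "(x, y) \<in> ?r" and yx: "(y, x) \<in> ?r"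
    have C: "x \<in> star_carrier P D n" "y \<in> star_carrier P D n"
      using xy star_ord_sub[of P D n] by auto
    obtain \<rho> s \<rho>' s' where e: "x = pair_code (\<rho>, s)" "y = pair_code (\<rho>', s')"
      using C by (elim star_carrierE)
    have "\<rho> = \<rho>' \<and> s = s'"
      using xy yx tr_less_trans[OF D] tr_less_irrefl[OF D] lin_antisym[OF pd_lin[OF F]]
      unfolding e star_ord_iff by blast
    then show "x = y" by (simp add: e)
  next
    fix x y assume x: "x \<in> star_carrier P D n" and y: "y \<in> star_carrier P D n"
    obtain \<rho> s where \<rho>: "x = pair_code (\<rho>, s)" "\<rho> \<in> Tr D" "s \<in> pd_carrier (star_fibre P D \<rho>) n"
      using x by (rule star_carrierE)
    obtain \<rho>' s' where \<rho>': "y = pair_code (\<rho>', s')" "\<rho>' \<in> Tr D"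
      "s' \<in> pd_carrier (star_fibre P D \<rho>') n"
      using y by (rule star_carrierE)
    show "(x, y) \<in> ?r \<or> (y, x) \<in> ?r"
      using tr_less_total[OF D \<rho>(2) \<rho>'(2)] lin_total[OF pd_lin[OF F], of s \<rho> n s'] \<rho> \<rho>'
      by (cases "\<rho> = \<rho>'") (auto simp: star_ord_iff)
  qed
qed

lemma star_predilator:
  assumes P: "preptyx P" and D: "predilator D"
  shows "predilator (star_ob P D)"
proof -
  note F = star_fibre_predilator[OF P D]
  note car = star_Field[OF P D]
  have M: "pair_code (\<rho>, pd_map (star_fibre P D \<rho>) n m f s) \<in> star_carrier P D m"
    if "f \<in> fin_emb n m" "pair_code (\<rho>, s) \<in> star_carrier P D n" for n m f \<rho> s
    using that pd_map_mem[OF F] by simp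
  show ?thesis
  proof (rule predilatorI, unfold car)
    show "linear_order_on (star_carrier P D n) (pd_ord (star_ob P D) n)" for n
      using star_lin[OF P D] unfolding car .
    show "pd_map (star_ob P D) n m \<in> extensional (fin_emb n m)" for n m
      by (simp add: star_ob_def)
    show "pd_supp (star_ob P D) n \<in> extensional (star_carrier P D n)" for n
      by (simp add: star_ob_def)
    show "pd_map (star_ob P D) n m f \<in> lo_emb (pd_ord (star_ob P D) n) (pd_ord (star_ob P D) m)"
      if f: "f \<in> fin_emb n m" for n m f
    proof (rule lo_embI[OF star_lin[OF P D] star_lin[OF P D]], unfold car)
      show "pd_map (star_ob P D) n m f \<in> extensional (star_carrier P D n)"
        using f by (simp add: star_ob_def)
    next
      fix x y assume xy: "(x, y) \<in> pd_ord (star_ob P D) n"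
      then have C: "x \<in> star_carrier P D n" "y \<in> star_carrier P D n"
        using star_ord_sub[of P D n] by auto
      then show "(pd_map (star_ob P D) n m f x, pd_map (star_ob P D) n m f y)
          \<in> pd_ord (star_ob P D) m"
        using xy lo_emb_iff[OF pd_map_emb[OF F f]] pd_map_mem[OF F f]
        by (elim star_carrierE) (simp add: star_ord_iff star_pd_map[OF f], blast)
    next
      fix x y assume "x \<in> star_carrier P D n" "y \<in> star_carrier P D n"
        "pd_map (star_ob P D) n m f x = pd_map (star_ob P D) n m f y"
      then show "x = y"
        using pd_map_inj[OF F f] by (elim star_carrierE) (simp add: star_pd_map[OF f])
    qed
    show "pd_map (star_ob P D) n n (\<lambda>x\<in>{..<n}. x) x = x" if "x \<in> star_carrier P D n" for n x
      using that by (elim star_carrierE) (simp add: star_pd_map fin_emb_id pd_map_id[OF F])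
    show "pd_map (star_ob P D) n k (compose {..<n} g f) x
        = pd_map (star_ob P D) m k g (pd_map (star_ob P D) n m f x)"
      if f: "f \<in> fin_emb n m" and g: "g \<in> fin_emb m k" and "x \<in> star_carrier P D n" for n m k f g x
      using that(3) fin_emb_compose[OF f g]
      by (elim star_carrierE) (simp add: star_pd_map f g pd_map_mem[OF F f] pd_map_comp[OF F f g])
    show "(pd_map (star_ob P D) n m f x, pd_map (star_ob P D) n m g x) \<in> pd_ord (star_ob P D) m"
      if f: "f \<in> fin_emb n m" and g: "g \<in> fin_emb n m" and le: "\<And>x. x < n \<Longrightarrow> f x \<le> g x"
        and "x \<in> star_carrier P D n" for n m f g x
      using that(4) pd_map_mono[OF F f g le]
      by (elim star_carrierE) (simp add: star_pd_map f g pd_map_mem[OF F f] pd_map_mem[OF F g] star_ord_iff)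
    show "pd_supp (star_ob P D) n x \<subseteq> {..<n}" if x: "x \<in> star_carrier P D n" for n x
    proof -
      obtain \<rho> s where "x = pair_code (\<rho>, s)" "\<rho> \<in> Tr D" "s \<in> pd_carrier (star_fibre P D \<rho>) n"
        using x by (rule star_carrierE)
      then show ?thesis using pd_supp_sub[OF F] by (simp add: star_pd_supp)
    qed
    show "pd_supp (star_ob P D) m (pd_map (star_ob P D) n m f x) = f ` pd_supp (star_ob P D) n x"
      if f: "f \<in> fin_emb n m" and x: "x \<in> star_carrier P D n" for n m f x
    proof -
      obtain \<rho> s where "x = pair_code (\<rho>, s)" "\<rho> \<in> Tr D" "s \<in> pd_carrier (star_fibre P D \<rho>) n"
        using x by (rule star_carrierE)
      then show ?thesis
        using pd_supp_map[OF F f] pd_map_mem[OF F f] by (simp add: star_pd_map[OF f] star_pd_supp)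
    qed
    show "x \<in> pd_map (star_ob P D) n m f ` star_carrier P D n"
      if f: "f \<in> fin_emb n m" and x: "x \<in> star_carrier P D m"
        and sub: "pd_supp (star_ob P D) m x \<subseteq> f ` {..<n}" for n m f x
    proof -
      obtain \<rho> s where \<rho>: "x = pair_code (\<rho>, s)" "\<rho> \<in> Tr D" "s \<in> pd_carrier (star_fibre P D \<rho>) m"
        using x by (rule star_carrierE)
      then have "s \<in> pd_map (star_fibre P D \<rho>) n m f ` pd_carrier (star_fibre P D \<rho>) n"
        using pd_supp_range[OF F f \<rho>(3)] sub by (simp add: star_pd_supp)
      then obtain t where t: "t \<in> pd_carrier (star_fibre P D \<rho>) n"
        "s = pd_map (star_fibre P D \<rho>) n m f t"
        by blast
      then have "x = pd_map (star_ob P D) n m f (pair_code (\<rho>, t))"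
        using \<rho> by (simp add: star_pd_map[OF f])
      then show ?thesis using \<rho>(2) t(1) by (intro image_eqI[of _ _ "pair_code (\<rho>, t)"]) simp_all
    qed
  qed
qed

definition star_in :: "preptyx_data \<Rightarrow> predilator_data \<Rightarrow> tr \<Rightarrow> pd_mor" where
  "star_in P D \<rho> = (\<lambda>n. \<lambda>s\<in>pd_carrier (star_fibre P D \<rho>) n. pair_code (\<rho>, s))"

lemma star_in_apply:
  "s \<in> pd_carrier (star_fibre P D \<rho>) n \<Longrightarrow> star_in P D \<rho> n s = pair_code (\<rho>, s)"
  by (simp add: star_in_def)

lemma star_in_hom:
  assumes P: "preptyx P" and D: "predilator D" and \<rho>: "\<rho> \<in> Tr D"
  shows "star_in P D \<rho> \<in> pd_hom (star_fibre P D \<rho>) (star_ob P D)"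
proof -
  note F = star_fibre_predilator[OF P D]
  show ?thesis
  proof (rule pd_homI)
    show "star_in P D \<rho> n \<in> lo_emb (pd_ord (star_fibre P D \<rho>) n) (pd_ord (star_ob P D) n)" for n
    proof (rule lo_embI[OF pd_lin[OF F] star_lin[OF P D]])
      fix s t assume st: "(s, t) \<in> pd_ord (star_fibre P D \<rho>) n"
      then show "(star_in P D \<rho> n s, star_in P D \<rho> n t) \<in> pd_ord (star_ob P D) n"
        using \<rho> FieldI1[OF st] FieldI2[OF st] by (simp add: star_in_apply star_ord_iff)
    qed (simp_all add: star_in_def)
    show "star_in P D \<rho> m (pd_map (star_fibre P D \<rho>) n m f s)
        = pd_map (star_ob P D) n m f (star_in P D \<rho> n s)"
      if "f \<in> fin_emb n m" "s \<in> pd_carrier (star_fibre P D \<rho>) n" for n m f s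
      using that \<rho> by (simp add: star_in_apply star_pd_map pd_map_mem[OF F])
  qed
qed

lemma star_Tr_iff:
  assumes P: "preptyx P" and D: "predilator D"
  shows "(n, pair_code (\<rho>, s)) \<in> Tr (star_ob P D) \<longleftrightarrow> \<rho> \<in> Tr D \<and> (n, s) \<in> Tr (star_fibre P D \<rho>)"
proof (cases "pair_code (\<rho>, s) \<in> star_carrier P D n")
  case True
  then show ?thesis
    using star_pd_supp[OF True] by (simp add: Tr_iff star_Field[OF P D])
next
  case False
  then show ?thesis unfolding Tr_iff star_Field[OF P D] star_carrier_iff by blast
qed

text \<open>
  Elements \<open>(\<rho>, \<top>)\<close> have empty support and hence arity zero. Elsewhere, questions about
  \<open>P\<^sup>*\<close> are reduced to trace elements of \<open>P(D[\<rho>])\<close>, to which the axioms on \<open>P\<close> apply.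
\<close>

lemma star_TrE:
  assumes P: "preptyx P" and D: "predilator D" and x: "p \<in> Tr (star_ob P D)"
  obtains \<rho> where "p = (0, pair_code (\<rho>, opt_code None))" "\<rho> \<in> Tr D"
  | n \<rho> \<sigma> where "p = (n, pair_code (\<rho>, opt_code (Some \<sigma>)))" "\<rho> \<in> Tr D"
    "(n, \<sigma>) \<in> Tr (px_ob P (pd_below D \<rho>))"
proof -
  obtain n y where p: "p = (n, y)" by (cases p)
  have "y \<in> star_carrier P D n" using x by (simp add: p Tr_iff star_Field[OF P D])
  then obtain \<rho> s where y: "y = pair_code (\<rho>, s)" "\<rho> \<in> Tr D" and s: "s \<in> pd_carrier (star_fibre P D \<rho>) n"
    by (rule star_carrierE)
  have tr: "(n, s) \<in> Tr (star_fibre P D \<rho>)" using x y by (simp add: p star_Tr_iff[OF P D])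
  from s[unfolded star_fibre_def pd_plus1_ord] show thesis
  proof (cases rule: Field_lo_plus1E)
    case 1
    then show thesis using that(1) tr y p by (simp add: star_fibre_def)
  next
    case (2 \<sigma>)
    then show thesis using that(2) tr y p by (simp add: star_fibre_def)
  qed
qed

section \<open>The functor \<open>P\<^sup>*\<close>\<close>

definition star_fibre_map ::
  "preptyx_data \<Rightarrow> predilator_data \<Rightarrow> predilator_data \<Rightarrow> pd_mor \<Rightarrow> tr \<Rightarrow> pd_mor" where
  "star_fibre_map P D E \<nu> \<rho> = mor_plus1 (px_ob P (pd_below D \<rho>))
     (px_map P (pd_below D \<rho>) (pd_below E (Tr_map \<nu> \<rho>)) (mor_below D E \<nu> \<rho>))"

lemma star_map_apply:
  "pair_code (\<rho>, s) \<in> star_carrier P D n \<Longrightarrow>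
    star_map P D E \<nu> n (pair_code (\<rho>, s)) = pair_code (Tr_map \<nu> \<rho>, star_fibre_map P D E \<nu> \<rho> n s)"
  by (simp add: star_map_def star_fibre_map_def del: star_carrier_iff)

lemma px_mor_below_hom:
  assumes P: "preptyx P" and D: "predilator D" and E: "predilator E" and \<nu>: "\<nu> \<in> pd_hom D E"
    and \<rho>: "\<rho> \<in> Tr D"
  shows "px_map P (pd_below D \<rho>) (pd_below E (Tr_map \<nu> \<rho>)) (mor_below D E \<nu> \<rho>)
    \<in> pd_hom (px_ob P (pd_below D \<rho>)) (px_ob P (pd_below E (Tr_map \<nu> \<rho>)))"
  by (rule px_hom[OF P below_predilator[OF D] below_predilator[OF E] mor_below_hom[OF D E \<nu> \<rho>]])

lemma star_fibre_map_hom: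
  assumes P: "preptyx P" and D: "predilator D" and E: "predilator E" and \<nu>: "\<nu> \<in> pd_hom D E"
    and \<rho>: "\<rho> \<in> Tr D"
  shows "star_fibre_map P D E \<nu> \<rho>
    \<in> pd_hom (star_fibre P D \<rho>) (star_fibre P E (Tr_map \<nu> \<rho>))"
  unfolding star_fibre_map_def star_fibre_def
  by (intro mor_plus1_hom px_predilator[OF P] below_predilator D E px_mor_below_hom P \<nu> \<rho>)

lemma star_map_hom:
  assumes P: "preptyx P" and D: "predilator D" and E: "predilator E" and \<nu>: "\<nu> \<in> pd_hom D E"
  shows "star_map P D E \<nu> \<in> pd_hom (star_ob P D) (star_ob P E)"
proof -
  note carD = star_Field[OF P D]
  note FD = star_fibre_predilator[OF P D] and FE = star_fibre_predilator[OF P E]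
  note h = star_fibre_map_hom[OF P D E \<nu>]
  note T = Tr_map_mem[OF D E \<nu>]
  show ?thesis
  proof (rule pd_homI, unfold carD)
    show "star_map P D E \<nu> n \<in> lo_emb (pd_ord (star_ob P D) n) (pd_ord (star_ob P E) n)" for n
    proof (rule lo_embI[OF star_lin[OF P D] star_lin[OF P E]], unfold carD)
      show "star_map P D E \<nu> n \<in> extensional (star_carrier P D n)" by (simp add: star_map_def)
    next
      fix x y assume xy: "(x, y) \<in> pd_ord (star_ob P D) n"
      then have "x \<in> star_carrier P D n" "y \<in> star_carrier P D n"
        using star_ord_sub[of P D n] by auto
      then show "(star_map P D E \<nu> n x, star_map P D E \<nu> n y) \<in> pd_ord (star_ob P E) n"
        using xy lo_emb_iff[OF hom_emb[OF h]]
        by (elim star_carrierE) (simp add: star_map_apply star_ord_iff T hom_mem[OF h]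
            tr_less_Tr_map[OF D E \<nu>], blast)
    next
      fix x y assume "x \<in> star_carrier P D n" "y \<in> star_carrier P D n"
        "star_map P D E \<nu> n x = star_map P D E \<nu> n y"
      then show "x = y"
        by (elim star_carrierE) (simp add: star_map_apply Tr_map_inj[OF D E \<nu>] hom_inj[OF FD FE h])
    qed
    show "star_map P D E \<nu> m (pd_map (star_ob P D) n m f x)
        = pd_map (star_ob P E) n m f (star_map P D E \<nu> n x)"
      if f: "f \<in> fin_emb n m" and x: "x \<in> star_carrier P D n" for n m f x
      using x by (elim star_carrierE) (simp add: star_map_apply star_pd_map[OF f] T hom_mem[OF h]
          pd_map_mem[OF FD f] hom_nat[OF h] f)
  qed
qed

lemma mor_below_id:
  assumes D: "predilator D" and \<rho>: "\<rho> \<in> Tr D"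
  shows "mor_below D D (pd_id D) \<rho> = pd_id (pd_below D \<rho>)"
proof (rule hom_eqI[OF mor_below_hom[OF D D hom_id[OF D] \<rho>] hom_id[OF below_predilator[OF D]]])
  fix n \<sigma> assume \<sigma>: "\<sigma> \<in> pd_carrier (pd_below D \<rho>) n"
  show "mor_below D D (pd_id D) \<rho> n \<sigma> = pd_id (pd_below D \<rho>) n \<sigma>"
    using \<sigma> below_carrier[OF D \<sigma>] mor_below_apply[OF D D hom_id[OF D] \<rho> \<sigma>]
    by (simp add: pd_id_apply)
qed

lemma mor_below_comp:
  assumes D: "predilator D" and E: "predilator E" and F: "predilator F"
    and \<mu>: "\<mu> \<in> pd_hom D E" and \<nu>: "\<nu> \<in> pd_hom E F" and \<rho>: "\<rho> \<in> Tr D"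
  shows "mor_below D F (pd_comp D \<nu> \<mu>) \<rho>
    = pd_comp (pd_below D \<rho>) (mor_below E F \<nu> (Tr_map \<mu> \<rho>)) (mor_below D E \<mu> \<rho>)"
proof -
  note \<nu>\<mu> = hom_comp[OF \<mu> \<nu> D]
  note \<rho>' = Tr_map_mem[OF D E \<mu> \<rho>]
  note h\<mu> = mor_below_hom[OF D E \<mu> \<rho>] and h\<nu> = mor_below_hom[OF E F \<nu> \<rho>']
  show ?thesis
  proof (rule hom_eqI[OF mor_below_hom[OF D F \<nu>\<mu> \<rho>] hom_comp[OF h\<mu> h\<nu> below_predilator[OF D]]])
    fix n \<sigma> assume \<sigma>: "\<sigma> \<in> pd_carrier (pd_below D \<rho>) n"
    show "mor_below D F (pd_comp D \<nu> \<mu>) \<rho> n \<sigma>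
        = pd_comp (pd_below D \<rho>) (mor_below E F \<nu> (Tr_map \<mu> \<rho>)) (mor_below D E \<mu> \<rho>) n \<sigma>"
      using mor_below_apply[OF D F \<nu>\<mu> \<rho> \<sigma>] mor_below_apply[OF D E \<mu> \<rho> \<sigma>]
        mor_below_apply[OF E F \<nu> \<rho>' hom_mem[OF h\<mu> \<sigma>]] \<sigma> below_carrier[OF D \<sigma>]
      by (simp add: pd_comp_apply)
  qed
qed

lemma mor_plus1_id:
  "s \<in> pd_carrier (pd_plus1 D) n \<Longrightarrow> mor_plus1 D (pd_id D) n s = s"
  by (auto elim!: Field_lo_plus1E simp: pd_id_apply)

lemma mor_plus1_comp:
  assumes "\<mu> \<in> pd_hom D E" "s \<in> pd_carrier (pd_plus1 D) n"
  shows "mor_plus1 D (pd_comp D \<nu> \<mu>) n s = mor_plus1 E \<nu> n (mor_plus1 D \<mu> n s)"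
  using assms(2) by (auto elim!: Field_lo_plus1E simp: pd_comp_apply hom_mem[OF assms(1)])

lemma star_map_id:
  assumes P: "preptyx P" and D: "predilator D"
  shows "star_map P D D (pd_id D) = pd_id (star_ob P D)"
proof (rule hom_eqI[OF star_map_hom[OF P D D hom_id[OF D]] hom_id[OF star_predilator[OF P D]]])
  fix n x assume x: "x \<in> pd_carrier (star_ob P D) n"
  then obtain \<rho> s where e: "x = pair_code (\<rho>, s)" and \<rho>: "\<rho> \<in> Tr D"
    and s: "s \<in> pd_carrier (star_fibre P D \<rho>) n"
    unfolding star_Field[OF P D] by (rule star_carrierE)
  have "star_fibre_map P D D (pd_id D) \<rho> n s = s"
    using mor_plus1_id[OF s[unfolded star_fibre_def]]
    by (simp add: star_fibre_map_def Tr_map_id[OF \<rho>] mor_below_id[OF D \<rho>]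
        px_id[OF P below_predilator[OF D]])
  then show "star_map P D D (pd_id D) n x = pd_id (star_ob P D) n x"
    using x \<rho> s e by (simp add: star_map_apply Tr_map_id pd_id_apply)
qed

lemma star_map_comp:
  assumes P: "preptyx P" and D: "predilator D" and E: "predilator E" and F: "predilator F"
    and \<mu>: "\<mu> \<in> pd_hom D E" and \<nu>: "\<nu> \<in> pd_hom E F"
  shows "star_map P D F (pd_comp D \<nu> \<mu>)
    = pd_comp (star_ob P D) (star_map P E F \<nu>) (star_map P D E \<mu>)"
proof -
  note \<nu>\<mu> = hom_comp[OF \<mu> \<nu> D]
  show ?thesis
  proof (rule hom_eqI[OF star_map_hom[OF P D F \<nu>\<mu>]
        hom_comp[OF star_map_hom[OF P D E \<mu>] star_map_hom[OF P E F \<nu>] star_predilator[OF P D]]])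
    fix n x assume x: "x \<in> pd_carrier (star_ob P D) n"
    then obtain \<rho> s where e: "x = pair_code (\<rho>, s)" and \<rho>: "\<rho> \<in> Tr D"
      and s: "s \<in> pd_carrier (star_fibre P D \<rho>) n"
      unfolding star_Field[OF P D] by (rule star_carrierE)
    note \<rho>' = Tr_map_mem[OF D E \<mu> \<rho>]
    note b = below_predilator[OF D, of \<rho>] below_predilator[OF E, of "Tr_map \<mu> \<rho>"]
      below_predilator[OF F, of "Tr_map \<nu> (Tr_map \<mu> \<rho>)"]
    have "px_map P (pd_below D \<rho>) (pd_below F (Tr_map \<nu> (Tr_map \<mu> \<rho>)))
          (mor_below D F (pd_comp D \<nu> \<mu>) \<rho>)
        = pd_comp (px_ob P (pd_below D \<rho>))
          (px_map P (pd_below E (Tr_map \<mu> \<rho>)) (pd_below F (Tr_map \<nu> (Tr_map \<mu> \<rho>)))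
            (mor_below E F \<nu> (Tr_map \<mu> \<rho>)))
          (px_map P (pd_below D \<rho>) (pd_below E (Tr_map \<mu> \<rho>)) (mor_below D E \<mu> \<rho>))"
      unfolding mor_below_comp[OF D E F \<mu> \<nu> \<rho>]
      by (rule px_comp[OF P b(1,2,3) mor_below_hom[OF D E \<mu> \<rho>] mor_below_hom[OF E F \<nu> \<rho>']])
    then have "star_fibre_map P D F (pd_comp D \<nu> \<mu>) \<rho> n s
        = star_fibre_map P E F \<nu> (Tr_map \<mu> \<rho>) n (star_fibre_map P D E \<mu> \<rho> n s)"
      using mor_plus1_comp[OF px_mor_below_hom[OF P D E \<mu> \<rho>] s[unfolded star_fibre_def]]
      by (simp add: star_fibre_map_def Tr_map_comp[OF \<rho>])
    then show "star_map P D F (pd_comp D \<nu> \<mu>) n x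
        = pd_comp (star_ob P D) (star_map P E F \<nu>) (star_map P D E \<mu>) n x"
      using x \<rho> \<rho>' s e hom_mem[OF star_fibre_map_hom[OF P D E \<mu> \<rho>] s]
      by (simp add: pd_comp_apply star_map_apply Tr_map_comp)
  qed
qed

text \<open>
  On trace elements, the supports of \<open>P\<^sup>*\<close> can be computed in the fibre: since \<open>\<iota>[D,\<rho>]\<close> is an
  inclusion, naturality of the supports of \<open>P\<close> makes the detour via \<open>P(D)\<close> invisible.
\<close>

lemma
  assumes P: "preptyx P" and D: "predilator D"
  shows star_supp_None: "star_supp P D (n, pair_code (\<rho>, opt_code None)) = {\<rho>}"
    and star_supp_Some: "(n, \<sigma>) \<in> Tr (px_ob P (pd_below D \<rho>)) \<Longrightarrow>
      star_supp P D (n, pair_code (\<rho>, opt_code (Some \<sigma>)))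
        = insert \<rho> (px_supp P (pd_below D \<rho>) (n, \<sigma>))"
proof -
  show "star_supp P D (n, pair_code (\<rho>, opt_code None)) = {\<rho>}" by (simp add: star_supp_def)
  assume \<sigma>: "(n, \<sigma>) \<in> Tr (px_ob P (pd_below D \<rho>))"
  let ?i = "px_map P (pd_below D \<rho>) D (incl_below D \<rho>)"
  note B = below_predilator[OF D, of \<rho>] and \<iota> = incl_below_hom[OF D, of \<rho>]
  have "Tr_map ?i (n, \<sigma>) \<in> Tr (px_ob P D)"
    by (rule Tr_map_mem[OF px_predilator[OF P B] px_predilator[OF P D] px_hom[OF P B D \<iota>] \<sigma>])
  then have "px_supp_at P D n (?i n \<sigma>) = px_supp P D (Tr_map ?i (n, \<sigma>))"
    using nf_trace_Tr[OF px_predilator[OF P D]] by (simp add: px_supp_at_def)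
  also have "\<dots> = Tr_map (incl_below D \<rho>) ` px_supp P (pd_below D \<rho>) (n, \<sigma>)"
    by (rule px_supp_nat[OF P B D \<iota> \<sigma>])
  also have "\<dots> = Tr_map (pd_id (pd_below D \<rho>)) ` px_supp P (pd_below D \<rho>) (n, \<sigma>)"
    by (intro image_cong refl Tr_map_cong[OF subsetD[OF px_supp_sub[OF P B \<sigma>]]])
      (simp_all add: incl_below_apply[OF D] pd_id_apply)
  also have "\<dots> = px_supp P (pd_below D \<rho>) (n, \<sigma>)"
    using px_supp_sub[OF P B \<sigma>] Tr_map_id[of _ "pd_below D \<rho>"] by force
  finally show "star_supp P D (n, pair_code (\<rho>, opt_code (Some \<sigma>)))
      = insert \<rho> (px_supp P (pd_below D \<rho>) (n, \<sigma>))"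
    by (simp add: star_supp_def)
qed

lemma star_supp_nat:
  assumes P: "preptyx P" and D: "predilator D" and E: "predilator E" and \<nu>: "\<nu> \<in> pd_hom D E"
    and p: "p \<in> Tr (star_ob P D)"
  shows "star_supp P E (Tr_map (star_map P D E \<nu>) p) = Tr_map \<nu> ` star_supp P D p"
  using P D p
proof (cases rule: star_TrE)
  case (1 \<rho>)
  then show ?thesis
    by (simp add: star_map_apply star_fibre_def star_fibre_map_def star_supp_None[OF P D]
        star_supp_None[OF P E])
next
  case (2 n \<rho> \<sigma>)
  let ?h = "px_map P (pd_below D \<rho>) (pd_below E (Tr_map \<nu> \<rho>)) (mor_below D E \<nu> \<rho>)"
  note B = below_predilator[OF D, of \<rho>] and C = below_predilator[OF E, of "Tr_map \<nu> \<rho>"]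
  note h = px_mor_below_hom[OF P D E \<nu> 2(2)]
  have \<sigma>: "\<sigma> \<in> pd_carrier (px_ob P (pd_below D \<rho>)) n" using 2(3) by (simp add: Tr_iff)
  have tr: "(n, ?h n \<sigma>) \<in> Tr (px_ob P (pd_below E (Tr_map \<nu> \<rho>)))"
    using Tr_map_mem[OF px_predilator[OF P B] px_predilator[OF P C] h 2(3)] by simp
  have "px_supp P (pd_below E (Tr_map \<nu> \<rho>)) (n, ?h n \<sigma>)
      = Tr_map (mor_below D E \<nu> \<rho>) ` px_supp P (pd_below D \<rho>) (n, \<sigma>)"
    using px_supp_nat[OF P B C mor_below_hom[OF D E \<nu> 2(2)] 2(3)] by simp
  also have "\<dots> = Tr_map \<nu> ` px_supp P (pd_below D \<rho>) (n, \<sigma>)"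
    by (intro image_cong refl Tr_map_cong[OF subsetD[OF px_supp_sub[OF P B 2(3)]]])
      (simp_all add: mor_below_apply[OF D E \<nu> 2(2)])
  finally show ?thesis
    using 2 \<sigma> by (simp add: star_map_apply star_fibre_def star_fibre_map_def
        star_supp_Some[OF P D 2(3)] star_supp_Some[OF P E tr])
qed

lemma star_supp_mem:
  assumes P: "preptyx P" and D: "predilator D" and p: "p \<in> Tr (star_ob P D)"
  shows "star_supp P D p \<in> Fpow (Tr D)"
  using P D p
proof (cases rule: star_TrE)
  case (1 \<rho>)
  then show ?thesis by (simp add: star_supp_None[OF P D] Fpow_def)
next
  case (2 n \<rho> \<sigma>)
  have "px_supp P (pd_below D \<rho>) (n, \<sigma>) \<in> Fpow (below D \<rho>)"
    using px_supp_mem[OF P below_predilator[OF D] 2(3)] by (simp add: Tr_below[OF D])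
  then show ?thesis
    using 2(1,2) by (auto simp: star_supp_Some[OF P D 2(3)] Fpow_def below_def)
qed

text \<open>
  Since \<open>\<nu>\<close> reflects \<open>\<lless>\<close>, an element below \<open>Tr(\<nu>)(\<rho>)\<close> that comes from \<open>Tr(D)\<close> comes from
  below \<open>\<rho>\<close>. This serves for the range condition and, later, for normality.
\<close>

lemma mor_below_rng:
  assumes D: "predilator D" and E: "predilator E" and \<nu>: "\<nu> \<in> pd_hom D E" and \<rho>: "\<rho> \<in> Tr D"
  shows "pd_rng (pd_below D \<rho>) (mor_below D E \<nu> \<rho>)
    = Tr (pd_below E (Tr_map \<nu> \<rho>)) \<inter> pd_rng D \<nu>"
proof -
  have "pd_rng (pd_below D \<rho>) (mor_below D E \<nu> \<rho>) = Tr_map \<nu> ` Tr (pd_below D \<rho>)"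
    unfolding pd_rng_def
    by (intro image_cong refl, rule Tr_map_cong, assumption)
      (simp add: mor_below_apply[OF D E \<nu> \<rho>])
  also have "\<dots> = Tr_map \<nu> ` {\<tau> \<in> Tr D. Tr_map \<nu> \<tau> \<in> below E (Tr_map \<nu> \<rho>)}"
    using tr_ll_Tr_map[OF D E \<nu> _ \<rho>] Tr_map_mem[OF D E \<nu>]
    by (intro arg_cong[where f = "image (Tr_map \<nu>)"]) (auto simp: Tr_below[OF D] below_def)
  finally show ?thesis by (auto simp: pd_rng_def Tr_below[OF E])
qed

lemma star_supp_range:
  assumes P: "preptyx P" and D: "predilator D" and E: "predilator E" and \<nu>: "\<nu> \<in> pd_hom D E"
    and p: "p \<in> Tr (star_ob P E)" and sub: "star_supp P E p \<subseteq> pd_rng D \<nu>"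
  shows "p \<in> pd_rng (star_ob P D) (star_map P D E \<nu>)"
  using P E p
proof (cases rule: star_TrE)
  case (1 \<rho>')
  then obtain \<rho> where \<rho>: "\<rho> \<in> Tr D" "\<rho>' = Tr_map \<nu> \<rho>"
    using sub by (auto simp: star_supp_None[OF P E] pd_rng_def)
  have "(0, pair_code (\<rho>, opt_code None)) \<in> Tr (star_ob P D)"
    using \<rho>(1) by (simp add: star_Tr_iff[OF P D] star_fibre_def)
  moreover have "Tr_map (star_map P D E \<nu>) (0, pair_code (\<rho>, opt_code None)) = p"
    using \<rho> 1(1) by (simp add: star_map_apply star_fibre_def star_fibre_map_def)
  ultimately show ?thesis unfolding pd_rng_def by blast
next
  case (2 n \<rho>' \<sigma>)
  have s: "\<rho>' \<in> pd_rng D \<nu>" "px_supp P (pd_below E \<rho>') (n, \<sigma>) \<subseteq> pd_rng D \<nu>"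
    using sub by (simp_all add: 2(1) star_supp_Some[OF P E 2(3)])
  then obtain \<rho> where \<rho>: "\<rho> \<in> Tr D" "\<rho>' = Tr_map \<nu> \<rho>" by (auto simp: pd_rng_def)
  note B = below_predilator[OF D, of \<rho>] and C = below_predilator[OF E, of \<rho>']
  let ?h = "px_map P (pd_below D \<rho>) (pd_below E \<rho>') (mor_below D E \<nu> \<rho>)"
  have "px_supp P (pd_below E \<rho>') (n, \<sigma>) \<subseteq> pd_rng (pd_below D \<rho>) (mor_below D E \<nu> \<rho>)"
    using s(2) px_supp_sub[OF P C 2(3)] by (simp add: mor_below_rng[OF D E \<nu> \<rho>(1)] \<rho>(2))
  from px_supp_range[OF P B C _ 2(3) this] obtain \<sigma>\<^sub>0 where
    \<sigma>\<^sub>0: "(n, \<sigma>\<^sub>0) \<in> Tr (px_ob P (pd_below D \<rho>))" "\<sigma> = ?h n \<sigma>\<^sub>0"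
    using mor_below_hom[OF D E \<nu> \<rho>(1)] by (auto simp: pd_rng_def \<rho>(2))
  have "(n, pair_code (\<rho>, opt_code (Some \<sigma>\<^sub>0))) \<in> Tr (star_ob P D)"
    using \<rho>(1) \<sigma>\<^sub>0(1) by (simp add: star_Tr_iff[OF P D] star_fibre_def)
  moreover have "Tr_map (star_map P D E \<nu>) (n, pair_code (\<rho>, opt_code (Some \<sigma>\<^sub>0))) = p"
    using \<rho> 2(1) \<sigma>\<^sub>0 by (simp add: star_map_apply star_fibre_def star_fibre_map_def Tr_iff)
  ultimately show ?thesis unfolding pd_rng_def by blast
qed

theorem star_preptyx:
  assumes P: "preptyx P"
  shows "preptyx (star P)"
  by (rule preptyxI)
    (simp_all add: star_def star_predilator[OF P] star_map_hom[OF P] star_map_id[OF P]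
      star_map_comp[OF P] star_supp_mem[OF P] star_supp_nat[OF P] star_supp_range[OF P])

section \<open>Normality\<close>

lemma segmentI:
  assumes "\<nu> \<in> pd_hom D E"
    and "\<And>n \<sigma> \<tau>. \<sigma> \<in> pd_carrier D n \<Longrightarrow> (\<tau>, \<nu> n \<sigma>) \<in> pd_ord E n \<Longrightarrow> \<tau> \<in> \<nu> n ` pd_carrier D n"
  shows "segment D E \<nu>"
  using assms hom_mem[OF assms(1)] by (auto simp: segment_def ofilter_def under_def)

lemma segment_hom: "segment D E \<nu> \<Longrightarrow> \<nu> \<in> pd_hom D E"
  by (simp add: segment_def)

lemma segment_less:
  assumes "segment D E \<nu>" "\<sigma> \<in> pd_carrier D n" "lo_less (pd_ord E n) \<tau> (\<nu> n \<sigma>)"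
  shows "\<tau> \<in> \<nu> n ` pd_carrier D n"
  using assms unfolding segment_def ofilter_def under_def lo_less_def by blast

text \<open>
  Let \<open>\<nu>\<close> be a segment. If some \<open>E(f)(\<tau>)\<close> lies below some \<open>E(g)(\<nu>(\<rho>)) = \<nu>(D(g)(\<rho>))\<close>, then it
  lies in the range of \<open>\<nu>\<close>, and hence so does \<open>\<tau>\<close>. Both orders on the trace yield such a
  situation.
\<close>

lemma segment_trace:
  assumes D: "predilator D" and E: "predilator E" and \<nu>: "segment D E \<nu>"
    and \<rho>: "(n, \<rho>) \<in> Tr D" and \<tau>: "(m, \<tau>) \<in> Tr E"
    and f: "f \<in> fin_emb m k" and g: "g \<in> fin_emb n k"
    and less: "lo_less (pd_ord E k) (pd_map E m k f \<tau>) (pd_map E n k g (\<nu> n \<rho>))"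
  shows "(m, \<tau>) \<in> pd_rng D \<nu>"
proof -
  note h = segment_hom[OF \<nu>]
  have \<rho>': "\<rho> \<in> pd_carrier D n" and \<tau>': "\<tau> \<in> pd_carrier E m" using \<rho> \<tau> by (simp_all add: Tr_iff)
  have "pd_map E m k f \<tau> \<in> \<nu> k ` pd_carrier D k"
    using segment_less[OF \<nu> pd_map_mem[OF D g \<rho>']] less hom_nat[OF h g \<rho>'] by simp
  from hom_range_reflect[OF D E h f \<tau>' this] obtain \<sigma>
    where \<sigma>: "\<sigma> \<in> pd_carrier D m" "\<tau> = \<nu> m \<sigma>" by blast
  then have "(m, \<sigma>) \<in> Tr D" using hom_Tr_iff[OF D E h] \<tau> by simp
  then show ?thesis using \<sigma>(2) by (auto simp: pd_rng_def intro!: image_eqI[of _ _ "(m, \<sigma>)"])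
qed

lemma segment_tr_less:
  assumes D: "predilator D" and E: "predilator E" and \<nu>: "segment D E \<nu>"
    and \<rho>: "\<rho> \<in> Tr D" and less: "tr_less E \<tau> (Tr_map \<nu> \<rho>)"
  shows "\<tau> \<in> pd_rng D \<nu>"
proof -
  obtain n r m t where e: "\<rho> = (n, r)" "\<tau> = (m, t)" by (cases \<rho>; cases \<tau>)
  let ?k = "max m n"
  have i: "(\<lambda>x\<in>{..<m}. x) \<in> fin_emb m ?k" and j: "(\<lambda>x\<in>{..<n}. x) \<in> fin_emb n ?k"
    by (simp_all add: fin_emb_id)
  have "(m, t) \<in> Tr E"
    and "lo_less (pd_ord E ?k) (pd_map E m ?k (\<lambda>x\<in>{..<m}. x) t)
      (pd_map E n ?k (\<lambda>x\<in>{..<n}. x) (\<nu> n r))"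
    using less by (simp_all add: e tr_less_iff[OF E, where k = ?k])
  then show ?thesis
    using segment_trace[OF D E \<nu> \<rho>[unfolded e(1)] _ i j] unfolding e(2) by simp
qed

lemma segment_below:
  assumes D: "predilator D" and E: "predilator E" and \<nu>: "segment D E \<nu>" and \<rho>: "\<rho> \<in> Tr D"
  shows "below E (Tr_map \<nu> \<rho>) \<subseteq> pd_rng D \<nu>"
proof
  fix \<tau> assume \<tau>: "\<tau> \<in> below E (Tr_map \<nu> \<rho>)"
  obtain n r m t where e: "\<rho> = (n, r)" "\<tau> = (m, t)" by (cases \<rho>; cases \<tau>)
  let ?k = "max m n"
  have i: "(\<lambda>x\<in>{..<m}. x) \<in> fin_emb m ?k" and j: "(\<lambda>x\<in>{..<n}. x) \<in> fin_emb n ?k"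
    by (simp_all add: fin_emb_id)
  have "(m, t) \<in> Tr E" using \<tau> by (simp add: e below_def)
  moreover have "lo_less (pd_ord E ?k) (pd_map E m ?k (\<lambda>x\<in>{..<m}. x) t)
      (pd_map E n ?k (\<lambda>x\<in>{..<n}. x) (\<nu> n r))"
    using \<tau> i j unfolding e below_def tr_ll_def by simp
  ultimately show "\<tau> \<in> pd_rng D \<nu>"
    using segment_trace[OF D E \<nu> \<rho>[unfolded e(1)] _ i j] unfolding e(2) by simp
qed

text \<open>
  By the previous lemma, \<open>\<nu>\<^sup>\<rho>\<close> is onto, and any preptyx preserves this property. This is how
  \<open>P\<^sup>*\<close> becomes normal while \<open>P\<close> is arbitrary.
\<close>

lemma star_fibre_map_surj:
  assumes P: "preptyx P" and D: "predilator D" and E: "predilator E" and \<nu>: "segment D E \<nu>"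
    and \<rho>: "\<rho> \<in> Tr D"
  shows "star_fibre_map P D E \<nu> \<rho> n ` pd_carrier (star_fibre P D \<rho>) n
    = pd_carrier (star_fibre P E (Tr_map \<nu> \<rho>)) n"
proof
  note h = segment_hom[OF \<nu>]
  let ?A = "px_ob P (pd_below D \<rho>)" and ?B = "px_ob P (pd_below E (Tr_map \<nu> \<rho>))"
  let ?h = "px_map P (pd_below D \<rho>) (pd_below E (Tr_map \<nu> \<rho>)) (mor_below D E \<nu> \<rho>)"
  show "star_fibre_map P D E \<nu> \<rho> n ` pd_carrier (star_fibre P D \<rho>) n
      \<subseteq> pd_carrier (star_fibre P E (Tr_map \<nu> \<rho>)) n"
    using hom_mem[OF star_fibre_map_hom[OF P D E h \<rho>]] by auto
  have "Tr (pd_below E (Tr_map \<nu> \<rho>)) \<subseteq> pd_rng (pd_below D \<rho>) (mor_below D E \<nu> \<rho>)"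
    using segment_below[OF D E \<nu> \<rho>] by (simp add: mor_below_rng[OF D E h \<rho>] Tr_below[OF E])
  from px_map_surj[OF P below_predilator[OF D] below_predilator[OF E] mor_below_hom[OF D E h \<rho>] this]
  have surj: "?h n ` pd_carrier ?A n = pd_carrier ?B n" .
  show "pd_carrier (star_fibre P E (Tr_map \<nu> \<rho>)) n
      \<subseteq> star_fibre_map P D E \<nu> \<rho> n ` pd_carrier (star_fibre P D \<rho>) n"
  proof
    fix t assume "t \<in> pd_carrier (star_fibre P E (Tr_map \<nu> \<rho>)) n"
    then show "t \<in> star_fibre_map P D E \<nu> \<rho> n ` pd_carrier (star_fibre P D \<rho>) n"
      unfolding star_fibre_def star_fibre_map_def pd_plus1_ord
    proof (cases rule: Field_lo_plus1E)
      case 1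
      then show "t \<in> mor_plus1 ?A ?h n ` Field (lo_plus1 (pd_ord ?A n))"
        by (intro image_eqI[of _ _ "opt_code None"]) simp_all
    next
      case (2 x)
      then obtain y where "y \<in> pd_carrier ?A n" "x = ?h n y" using surj by blast
      then show "t \<in> mor_plus1 ?A ?h n ` Field (lo_plus1 (pd_ord ?A n))"
        using 2 by (intro image_eqI[of _ _ "opt_code (Some y)"]) simp_all
    qed
  qed
qed

lemma star_map_segment:
  assumes P: "preptyx P" and D: "predilator D" and E: "predilator E" and \<nu>: "segment D E \<nu>"
  shows "segment (star_ob P D) (star_ob P E) (star_map P D E \<nu>)"
proof (rule segmentI[OF star_map_hom[OF P D E segment_hom[OF \<nu>]]])
  fix n x y
  assume "x \<in> pd_carrier (star_ob P D) n" and le: "(y, star_map P D E \<nu> n x) \<in> pd_ord (star_ob P E) n"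
  then obtain \<rho> s where x: "x = pair_code (\<rho>, s)" "\<rho> \<in> Tr D" "s \<in> pd_carrier (star_fibre P D \<rho>) n"
    unfolding star_Field[OF P D] by (elim star_carrierE)
  have "y \<in> star_carrier P E n" using le star_ord_sub[of P E n] by auto
  then obtain \<rho>' t where y: "y = pair_code (\<rho>', t)" "\<rho>' \<in> Tr E" "t \<in> pd_carrier (star_fibre P E \<rho>') n"
    by (elim star_carrierE)
  have "tr_less E \<rho>' (Tr_map \<nu> \<rho>) \<or> \<rho>' = Tr_map \<nu> \<rho>"
    using le x y by (auto simp: star_map_apply star_ord_iff simp del: split_paired_All)
  then have "\<rho>' \<in> pd_rng D \<nu>"
    using segment_tr_less[OF D E \<nu> x(2), of \<rho>'] x(2) by (auto simp: pd_rng_def)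
  then obtain \<rho>\<^sub>0 where \<rho>\<^sub>0: "\<rho>\<^sub>0 \<in> Tr D" "\<rho>' = Tr_map \<nu> \<rho>\<^sub>0" unfolding pd_rng_def by blast
  have "t \<in> star_fibre_map P D E \<nu> \<rho>\<^sub>0 n ` pd_carrier (star_fibre P D \<rho>\<^sub>0) n"
    using star_fibre_map_surj[OF P D E \<nu> \<rho>\<^sub>0(1)] y(3) \<rho>\<^sub>0(2) by simp
  then obtain s\<^sub>0 where "s\<^sub>0 \<in> pd_carrier (star_fibre P D \<rho>\<^sub>0) n" "t = star_fibre_map P D E \<nu> \<rho>\<^sub>0 n s\<^sub>0"
    by blast
  then show "y \<in> star_map P D E \<nu> n ` pd_carrier (star_ob P D) n"
    using y(1) \<rho>\<^sub>0 unfolding star_Field[OF P D]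
    by (intro image_eqI[of _ _ "pair_code (\<rho>\<^sub>0, s\<^sub>0)"]) (simp_all add: star_map_apply)
qed

section \<open>Preservation of dilators\<close>

lemma dilator_wf: "dilator D \<Longrightarrow> Well_order X \<Longrightarrow> wf (ext_less D X)"
  by (simp add: dilator_def)

text \<open>
  The functions on cardinalities in the definition of the extension are embeddings, so that the
  laws of predilators apply to them.
\<close>

lemma ext_lessE:
  assumes X: "Linear_order X" and less: "((a, \<sigma>), (b, \<tau>)) \<in> ext_less D X"
  obtains f g where "f \<in> fin_emb (card a) (card (a \<union> b))" "g \<in> fin_emb (card b) (card (a \<union> b))"
    "f = lo_abs (Restr X a) (Restr X (a \<union> b)) (\<lambda>x\<in>a. x)"
    "g = lo_abs (Restr X b) (Restr X (a \<union> b)) (\<lambda>x\<in>b. x)"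
    "(a, \<sigma>) \<in> ext_carrier D X" "(b, \<tau>) \<in> ext_carrier D X"
    "lo_less (pd_ord D (card (a \<union> b))) (pd_map D (card a) (card (a \<union> b)) f \<sigma>)
      (pd_map D (card b) (card (a \<union> b)) g \<tau>)"
proof -
  have c: "(a, \<sigma>) \<in> ext_carrier D X" "(b, \<tau>) \<in> ext_carrier D X"
    using less by (simp_all add: ext_less_def)
  then have "finite a" "a \<subseteq> Field X" "finite b" "b \<subseteq> Field X"
    by (simp_all add: ext_carrier_def Fpow_def)
  then have "lo_abs (Restr X a) (Restr X (a \<union> b)) (\<lambda>x\<in>a. x) \<in> fin_emb (card a) (card (a \<union> b))"
    "lo_abs (Restr X b) (Restr X (a \<union> b)) (\<lambda>x\<in>b. x) \<in> fin_emb (card b) (card (a \<union> b))"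
    by (intro lo_abs_incl[OF X]; simp)+
  then show thesis using that c less by (simp add: ext_less_def)
qed

lemma ext_lessI:
  assumes "(a, \<sigma>) \<in> ext_carrier D X" "(b, \<tau>) \<in> ext_carrier D X"
    and "lo_less (pd_ord D (card (a \<union> b)))
       (pd_map D (card a) (card (a \<union> b)) (lo_abs (Restr X a) (Restr X (a \<union> b)) (\<lambda>x\<in>a. x)) \<sigma>)
       (pd_map D (card b) (card (a \<union> b)) (lo_abs (Restr X b) (Restr X (a \<union> b)) (\<lambda>x\<in>b. x)) \<tau>)"
  shows "((a, \<sigma>), (b, \<tau>)) \<in> ext_less D X"
  using assms by (simp add: ext_less_def)

lemma Well_Linear: "Well_order X \<Longrightarrow> Linear_order X"
  by (simp add: well_order_on_def)

lemma sub_dilator: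
  assumes dil: "dilator D"
  shows "dilator (sub_pd D A)"
  unfolding dilator_def
proof (intro conjI allI impI)
  have D: "predilator D" using dil by (simp add: dilator_def)
  show "predilator (sub_pd D A)" by (rule sub_predilator[OF D])
  fix X :: "nat rel" assume X: "Well_order X"
  have "ext_less (sub_pd D A) X \<subseteq> ext_less D X"
  proof (rule subrelI)
    fix p q assume pq: "(p, q) \<in> ext_less (sub_pd D A) X"
    obtain a s b t where e: "p = (a, s)" "q = (b, t)" by (cases p; cases q)
    from Well_Linear[OF X] pq[unfolded e] show "(p, q) \<in> ext_less D X"
    proof (cases rule: ext_lessE)
      case (1 f g)
      have "s \<in> sub_carrier D A (card a)" "t \<in> sub_carrier D A (card b)"
        using 1(5,6) by (simp_all add: ext_carrier_def Tr_iff sub_pd_Field[OF D])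
      then have "lo_less (pd_ord D (card (a \<union> b))) (pd_map D (card a) (card (a \<union> b)) f s)
          (pd_map D (card b) (card (a \<union> b)) g t)"
        using 1(7) by (simp add: sub_pd_map 1(1,2) lo_less_def sub_pd_ord)
      moreover have "(a, s) \<in> ext_carrier D X" "(b, t) \<in> ext_carrier D X"
        using 1(5,6) by (simp_all add: ext_carrier_def Tr_sub_pd[OF D])
      ultimately show ?thesis unfolding e 1(3,4) by (intro ext_lessI)
    qed
  qed
  then show "wf (ext_less (sub_pd D A) X)" by (rule wf_subset[OF dilator_wf[OF dil X]])
qed

text \<open>
  The new maximum of \<open>D + 1\<close> has empty support, so it only adds one element at the top of the
  extension to any linear order.
\<close>

lemma plus1_dilator:
  assumes dil: "dilator D"
  shows "dilator (pd_plus1 D)"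
  unfolding dilator_def
proof (intro conjI allI impI)
  have D: "predilator D" using dil by (simp add: dilator_def)
  show "predilator (pd_plus1 D)" by (rule plus1_predilator[OF D])
  fix X :: "nat rel" assume X: "Well_order X"
  define r :: "nat set \<times> nat \<Rightarrow> nat \<times> nat set \<times> nat" where
    "r = (\<lambda>(a, s). case from_nat s of None \<Rightarrow> (1, a, s) | Some \<sigma> \<Rightarrow> (0, a, \<sigma>))"
  have "ext_less (pd_plus1 D) X \<subseteq> inv_image (less_than <*lex*> ext_less D X) r"
  proof (rule subrelI)
    fix p q assume pq: "(p, q) \<in> ext_less (pd_plus1 D) X"
    obtain a s b t where e: "p = (a, s)" "q = (b, t)" by (cases p; cases q)
    from Well_Linear[OF X] pq[unfolded e]
    show "(p, q) \<in> inv_image (less_than <*lex*> ext_less D X) r"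
    proof (cases rule: ext_lessE)
      case (1 f g)
      have st: "s \<in> Field (lo_plus1 (pd_ord D (card a)))" "t \<in> Field (lo_plus1 (pd_ord D (card b)))"
        using 1(5,6) by (simp_all add: ext_carrier_def Tr_iff)
      have less: "lo_less (lo_plus1 (pd_ord D (card (a \<union> b))))
          (map_plus1 (pd_carrier D (card a)) (pd_map D (card a) (card (a \<union> b)) f) s)
          (map_plus1 (pd_carrier D (card b)) (pd_map D (card b) (card (a \<union> b)) g) t)"
        using 1(7) by (simp add: 1(1,2))
      from st(1) show ?thesis
      proof (cases rule: Field_lo_plus1E)
        case s: 1
        from st(2) have False
        proof (cases rule: Field_lo_plus1E)
          case 1
          then show False using less s by (simp add: lo_less_def)
        next
          case (2 y)
          then show False using less s by (simp add: lo_less_def)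
        qed
        then show ?thesis ..
      next
        case s: (2 x)
        from st(2) show ?thesis
        proof (cases rule: Field_lo_plus1E)
          case 1
          then show ?thesis using s by (simp add: e r_def)
        next
          case t: (2 y)
          have "lo_less (pd_ord D (card (a \<union> b))) (pd_map D (card a) (card (a \<union> b)) f x)
              (pd_map D (card b) (card (a \<union> b)) g y)"
            using less s t by (simp add: lo_less_def)
          moreover have "(a, x) \<in> ext_carrier D X" "(b, y) \<in> ext_carrier D X"
            using 1(5,6) s(1) t(1) by (simp_all add: ext_carrier_def)
          ultimately have "((a, x), (b, y)) \<in> ext_less D X" unfolding 1(3,4) by (intro ext_lessI)
          then show ?thesis using s(1) t(1) by (simp add: e r_def)
        qed
      qed
    qed
  qed
  moreover have "wf (inv_image (less_than <*lex*> ext_less D X) r)"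
    by (intro wf_inv_image wf_lex_prod wf_less_than dilator_wf[OF dil X])
  ultimately show "wf (ext_less (pd_plus1 D) X)" by (rule wf_subset[rotated])
qed

lemma tr_less_wf:
  assumes "dilator D"
  shows "wf {(\<rho>, \<rho>'). tr_less D \<rho> \<rho>'}"
proof -
  have "{(\<rho>, \<rho>'). tr_less D \<rho> \<rho>'} = inv_image (ext_less D natLeq) (\<lambda>(n, \<sigma>). ({..<n}, \<sigma>))"
    by (auto simp: tr_less_def)
  then show ?thesis using wf_inv_image[OF dilator_wf[OF assms natLeq_Well_order]] by simp
qed

text \<open>
  The extension of \<open>P\<^sup>*(D)\<close> to a well order \<open>X\<close> is a sum of extensions of the dilators
  \<open>P(D[\<rho>]) + 1\<close> along the order on the trace, which is well founded because it is
  contained in the extension of \<open>D\<close> to \<open>\<omega>\<close>.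
\<close>

lemma star_dilator:
  assumes P: "ptyx P" and dil: "dilator D"
  shows "dilator (star_ob P D)"
  unfolding dilator_def
proof (intro conjI allI impI)
  have pP: "preptyx P" using P by (simp add: ptyx_def)
  have D: "predilator D" using dil by (simp add: dilator_def)
  show pS: "predilator (star_ob P D)" by (rule star_predilator[OF pP D])
  have F: "dilator (star_fibre P D \<rho>)" for \<rho>
    using P sub_dilator[OF dil] plus1_dilator by (simp add: star_fibre_def pd_below_def ptyx_def)
  note pF = star_fibre_predilator[OF pP D]
  fix X :: "nat rel" assume X: "Well_order X"
  let ?L = "{(\<rho>, \<rho>'). tr_less D \<rho> \<rho>'} <*lex*>
    same_fst (\<lambda>_. True) (\<lambda>\<rho>. ext_less (star_fibre P D \<rho>) X)"
  (* the first component is doubled: once to be compared, once to select the fibre *)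
  define r where "r = (\<lambda>(a :: nat set, x). case pair_decode x of (\<rho>, s) \<Rightarrow> (\<rho>, \<rho>, a, s))"
  have "ext_less (star_ob P D) X \<subseteq> inv_image ?L r"
  proof (rule subrelI)
    fix p q assume pq: "(p, q) \<in> ext_less (star_ob P D) X"
    obtain a x b y where e: "p = (a, x)" "q = (b, y)" by (cases p; cases q)
    from Well_Linear[OF X] pq[unfolded e] show "(p, q) \<in> inv_image ?L r"
    proof (cases rule: ext_lessE)
      case (1 f g)
      let ?k = "card (a \<union> b)"
      have tr: "(card a, x) \<in> Tr (star_ob P D)" "(card b, y) \<in> Tr (star_ob P D)"
        and fin: "a \<in> Fpow (Field X)" "b \<in> Fpow (Field X)"
        using 1(5,6) by (simp_all add: ext_carrier_def)
      then have "x \<in> star_carrier P D (card a)" "y \<in> star_carrier P D (card b)"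
        by (simp_all add: Tr_iff star_Field[OF pP D])
      then obtain \<rho> s \<rho>' t where x: "x = pair_code (\<rho>, s)" and y: "y = pair_code (\<rho>', t)"
        by (elim star_carrierE)
      have \<rho>: "\<rho> \<in> Tr D" "(card a, s) \<in> Tr (star_fibre P D \<rho>)"
        and \<rho>': "\<rho>' \<in> Tr D" "(card b, t) \<in> Tr (star_fibre P D \<rho>')"
        using tr by (simp_all add: x y star_Tr_iff[OF pP D])
      have less: "lo_less (pd_ord (star_ob P D) ?k)
          (pair_code (\<rho>, pd_map (star_fibre P D \<rho>) (card a) ?k f s))
          (pair_code (\<rho>', pd_map (star_fibre P D \<rho>') (card b) ?k g t))"
        using 1(1,2,7) \<rho> \<rho>' by (simp add: x y star_pd_map Tr_iff)
      then consider "tr_less D \<rho> \<rho>'"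
        | "\<rho> = \<rho>'" "lo_less (pd_ord (star_fibre P D \<rho>) ?k)
            (pd_map (star_fibre P D \<rho>) (card a) ?k f s) (pd_map (star_fibre P D \<rho>) (card b) ?k g t)"
        unfolding lo_less_def star_ord_iff by auto
      then show ?thesis
      proof cases
        case 1
        then show ?thesis by (simp add: e x y r_def)
      next
        case 2
        have "((a, s), (b, t)) \<in> ext_less (star_fibre P D \<rho>) X"
        proof (rule ext_lessI)
          show "(a, s) \<in> ext_carrier (star_fibre P D \<rho>) X" "(b, t) \<in> ext_carrier (star_fibre P D \<rho>) X"
            using fin \<rho>(2) \<rho>'(2) 2(1) by (simp_all add: ext_carrier_def)
        qed (use 2(2) in \<open>simp add: 1(3,4)\<close>)
        then show ?thesis using 2(1) by (simp add: e x y r_def same_fst_def)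
      qed
    qed
  qed
  moreover have "wf (inv_image ?L r)"
    by (intro wf_inv_image wf_lex_prod tr_less_wf[OF dil] wf_same_fst dilator_wf[OF F X])
  ultimately show "wf (ext_less (star_ob P D) X)" by (rule wf_subset[rotated])
qed

section \<open>The morphisms from \<open>P(D) + 1\<close> to \<open>P\<^sup>*(D + 1)\<close>\<close>

definition top_tr :: tr where "top_tr = (0, opt_code None)"

lemma top_tr_mem: "top_tr \<in> Tr (pd_plus1 D)"
  by (simp add: top_tr_def)

lemma Tr_map_top_tr: "Tr_map (mor_plus1 D \<nu>) top_tr = top_tr"
  by (simp add: top_tr_def)

text \<open>
  All of \<open>D\<close> lies below the new maximum, so that \<open>D\<close> embeds into \<open>(D + 1)[\<top>]\<close>.
\<close>

lemma plus1_incl_below: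
  assumes D: "predilator D"
  shows "plus1_incl D \<in> pd_hom D (pd_below (pd_plus1 D) top_tr)"
  unfolding pd_below_def
proof (rule hom_into_sub[OF D plus1_predilator[OF D] plus1_incl_hom[OF D]])
  fix \<tau> assume \<tau>: "\<tau> \<in> Tr D"
  obtain n t where e: "\<tau> = (n, t)" by (cases \<tau>)
  have t: "t \<in> pd_carrier D n" using \<tau> by (simp add: e Tr_iff)
  have "tr_ll (pd_plus1 D) (n, opt_code (Some t)) top_tr"
    using t by (simp add: tr_ll_def top_tr_def lo_less_def pd_map_mem[OF D])
  then show "Tr_map (plus1_incl D) \<tau> \<in> below (pd_plus1 D) top_tr"
    using \<tau> t by (simp add: e below_def)
qed

text \<open>
  This is \<open>\<xi>\<^sup>D\<close>: apply \<open>P\<close> to the embedding of \<open>D\<close> into \<open>(D + 1)[\<top>]\<close>, and include the result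
  as the fibre over \<open>\<top>\<close>.
\<close>

definition star_unit :: "preptyx_data \<Rightarrow> predilator_data \<Rightarrow> pd_mor" where
  "star_unit P D = pd_comp (pd_plus1 (px_ob P D)) (star_in P (pd_plus1 D) top_tr)
     (mor_plus1 (px_ob P D) (px_map P D (pd_below (pd_plus1 D) top_tr) (plus1_incl D)))"

lemma plus1_incl_fibre_hom:
  assumes P: "preptyx P" and D: "predilator D"
  shows "mor_plus1 (px_ob P D) (px_map P D (pd_below (pd_plus1 D) top_tr) (plus1_incl D))
    \<in> pd_hom (pd_plus1 (px_ob P D)) (star_fibre P (pd_plus1 D) top_tr)"
proof -
  note B = below_predilator[OF plus1_predilator[OF D]]
  show ?thesis
    unfolding star_fibre_def
    by (rule mor_plus1_hom[OF px_predilator[OF P D] px_predilator[OF P B]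
          px_hom[OF P D B plus1_incl_below[OF D]]])
qed

lemma star_unit_hom:
  assumes P: "preptyx P" and D: "predilator D"
  shows "star_unit P D \<in> pd_hom (pd_plus1 (px_ob P D)) (star_ob P (pd_plus1 D))"
  unfolding star_unit_def
  by (rule hom_comp[OF plus1_incl_fibre_hom[OF P D]
        star_in_hom[OF P plus1_predilator[OF D] top_tr_mem]
        plus1_predilator[OF px_predilator[OF P D]]])

text \<open>
  The embeddings of \<open>D\<close> into \<open>(D + 1)[\<top>]\<close> are natural, because \<open>(\<nu> + 1)\<^sup>\<top>\<close> restricts \<open>\<nu> + 1\<close>.
  The rest is functoriality of \<open>P\<close>.
\<close>

lemma star_unit_natural:
  assumes P: "preptyx P" and D: "predilator D" and E: "predilator E" and \<nu>: "\<nu> \<in> pd_hom D E"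
  shows "pd_comp (pd_plus1 (px_ob P D)) (star_unit P E) (mor_plus1 (px_ob P D) (px_map P D E \<nu>))
    = pd_comp (pd_plus1 (px_ob P D)) (star_map P (pd_plus1 D) (pd_plus1 E) (mor_plus1 D \<nu>))
        (star_unit P D)"
proof -
  note D1 = plus1_predilator[OF D] and E1 = plus1_predilator[OF E]
  note \<nu>1 = mor_plus1_hom[OF D E \<nu>]
  note PD = px_predilator[OF P D] and PE = px_predilator[OF P E]
  note PD1 = plus1_predilator[OF PD]
  note P\<nu> = px_hom[OF P D E \<nu>]
  let ?DT = "pd_below (pd_plus1 D) top_tr" and ?ET = "pd_below (pd_plus1 E) top_tr"
  note DT = below_predilator[OF D1, of top_tr] and ET = below_predilator[OF E1, of top_tr]
  note jD = plus1_incl_below[OF D] and jE = plus1_incl_below[OF E]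
  let ?\<nu>T = "mor_below (pd_plus1 D) (pd_plus1 E) (mor_plus1 D \<nu>) top_tr"
  have \<nu>T: "?\<nu>T \<in> pd_hom ?DT ?ET"
    using mor_below_hom[OF D1 E1 \<nu>1 top_tr_mem] by (simp add: Tr_map_top_tr)
  have "pd_comp D (plus1_incl E) \<nu> = pd_comp D ?\<nu>T (plus1_incl D)"
  proof (rule hom_eqI[OF hom_comp[OF \<nu> jE D] hom_comp[OF jD \<nu>T D]])
    fix n \<sigma> assume \<sigma>: "\<sigma> \<in> pd_carrier D n"
    then show "pd_comp D (plus1_incl E) \<nu> n \<sigma> = pd_comp D ?\<nu>T (plus1_incl D) n \<sigma>"
      using mor_below_apply[OF D1 E1 \<nu>1 top_tr_mem hom_mem[OF jD \<sigma>]] hom_mem[OF \<nu> \<sigma>]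
      by (simp add: pd_comp_apply)
  qed
  then have square: "pd_comp (px_ob P D) (px_map P E ?ET (plus1_incl E)) (px_map P D E \<nu>)
      = pd_comp (px_ob P D) (px_map P ?DT ?ET ?\<nu>T) (px_map P D ?DT (plus1_incl D))"
    using px_comp[OF P D E ET \<nu> jE] px_comp[OF P D DT ET jD \<nu>T] by simp
  show ?thesis
  proof (rule hom_eqI[OF
        hom_comp[OF mor_plus1_hom[OF PD PE P\<nu>] star_unit_hom[OF P E] PD1]
        hom_comp[OF star_unit_hom[OF P D] star_map_hom[OF P D1 E1 \<nu>1] PD1]])
    fix n s assume s: "s \<in> pd_carrier (pd_plus1 (px_ob P D)) n"
    let ?u = "mor_plus1 (px_ob P D) (px_map P D ?DT (plus1_incl D)) n s"
    let ?v = "mor_plus1 (px_ob P D) (px_map P D E \<nu>) n s"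
    let ?w = "mor_plus1 (px_ob P E) (px_map P E ?ET (plus1_incl E)) n ?v"
    have u: "?u \<in> pd_carrier (star_fibre P (pd_plus1 D) top_tr) n"
      by (rule hom_mem[OF plus1_incl_fibre_hom[OF P D] s])
    have v: "?v \<in> pd_carrier (pd_plus1 (px_ob P E)) n"
      by (rule hom_mem[OF mor_plus1_hom[OF PD PE P\<nu>] s])
    have w: "?w \<in> pd_carrier (star_fibre P (pd_plus1 E) top_tr) n"
      by (rule hom_mem[OF plus1_incl_fibre_hom[OF P E] v])
    have "?w = star_fibre_map P (pd_plus1 D) (pd_plus1 E) (mor_plus1 D \<nu>) top_tr n ?u"
      using mor_plus1_comp[OF P\<nu> s, of "px_map P E ?ET (plus1_incl E)"]
        mor_plus1_comp[OF px_hom[OF P D DT jD] s, of "px_map P ?DT ?ET ?\<nu>T"] square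
      by (simp add: star_fibre_map_def Tr_map_top_tr)
    then have "pair_code (top_tr, ?w)
        = star_map P (pd_plus1 D) (pd_plus1 E) (mor_plus1 D \<nu>) n (pair_code (top_tr, ?u))"
      using u by (simp add: star_map_apply top_tr_mem Tr_map_top_tr)
    then show "pd_comp (pd_plus1 (px_ob P D)) (star_unit P E)
          (mor_plus1 (px_ob P D) (px_map P D E \<nu>)) n s
        = pd_comp (pd_plus1 (px_ob P D))
          (star_map P (pd_plus1 D) (pd_plus1 E) (mor_plus1 D \<nu>)) (star_unit P D) n s"
      using s u v w
      by (simp add: star_unit_def pd_comp_apply star_in_apply del: pd_plus1_ord)
  qed
qed

theorem theorem4p21:
  fixes P :: preptyx_data
  assumes "preptyx P"
  shows "normal_preptyx (star P) \<and>
    (ptyx P \<longrightarrow> ptyx (star P)) \<and>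
    (\<exists>\<xi> :: predilator_data \<Rightarrow> pd_mor.
       (\<forall>D. predilator D \<longrightarrow>
          \<xi> D \<in> pd_hom (pd_plus1 (px_ob P D)) (px_ob (star P) (pd_plus1 D))) \<and>
       (\<forall>D E \<nu>. predilator D \<longrightarrow> predilator E \<longrightarrow> \<nu> \<in> pd_hom D E \<longrightarrow>
          pd_comp (pd_plus1 (px_ob P D)) (\<xi> E) (mor_plus1 (px_ob P D) (px_map P D E \<nu>))
            = pd_comp (pd_plus1 (px_ob P D))
                (px_map (star P) (pd_plus1 D) (pd_plus1 E) (mor_plus1 D \<nu>)) (\<xi> D)))"
proof (intro conjI impI exI[of _ "star_unit P"] allI)
  have ob: "px_ob (star P) = star_ob P" and map: "px_map (star P) = star_map P"
    by (simp_all add: star_def)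
  show "normal_preptyx (star P)"
    unfolding normal_preptyx_def ob map
    using star_preptyx[OF assms] star_map_segment[OF assms] by blast
  show "ptyx (star P)" if "ptyx P"
    unfolding ptyx_def ob using star_preptyx[OF assms] star_dilator[OF that] by blast
  show "star_unit P D \<in> pd_hom (pd_plus1 (px_ob P D)) (px_ob (star P) (pd_plus1 D))"
    if "predilator D" for D
    unfolding ob by (rule star_unit_hom[OF assms that])
  show "pd_comp (pd_plus1 (px_ob P D)) (star_unit P E) (mor_plus1 (px_ob P D) (px_map P D E \<nu>))
      = pd_comp (pd_plus1 (px_ob P D))
          (px_map (star P) (pd_plus1 D) (pd_plus1 E) (mor_plus1 D \<nu>)) (star_unit P D)"
    if "predilator D" "predilator E" "\<nu> \<in> pd_hom D E" for D E \<nu>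
    unfolding map by (rule star_unit_natural[OF assms that])
qed

end
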